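(* Let $p>2$ be a prime, $\mathbf{F}$ a field of characteristic $p$, and $M\in\mathbf{F}^{2\times4}$. If $\gamma_{1234}(M)=0$, $\gamma_{1235}(M)=0$, $\gamma_{1357}(M)\neq0$ and $\gamma_{1257}(M)\neq0$, then, with $h_1,h_2$ and $N_M(z)$ as defined in the context, the set $\mathcal B:=\{x,h_1,h_2,N_M(z)\}$ is a SAGBI basis for $\mathbf{F}[V_M]^E$. Furthermore, $\mathbf{F}[V_M]^E$ is a hypersurface with the relation coming from the subduction of the tête-à-tête $(h_2^p,h_1^{p^3+p^2+p+2})$.
   Context: For $M=(c_{ij})\in\mathbf{F}^{2\times4}$, $E=\langle e_1,e_2,e_3,e_4\rangle\cong(\mathbf{Z}/p)^4$ acts on $\mathbf{F}[V_M]=\mathbf{F}[x,y,z]$ (on the right, by algebra automorphisms) by $x\cdot e_j=x$, $y\cdot e_j=y+c_{1j}x$, $z\cdot e_j=z+2c_{1j}y+(c_{1j}^2+c_{2j})x$; $\mathbf{F}[V_M]^E$ is the ring of invariants. For $f\in\mathbf{F}[V_M]$, $N_M(f)$ is the product of the distinct elements of the $E$-orbit of $f$. Minors: $\Gamma(M)$ is the $10\times4$ matrix whose row $2k+1$ is $(c_{11}^{p^k},\dots,c_{14}^{p^k})$ and whose row $2k+2$ is $(c_{21}^{p^k},\dots,c_{24}^{p^k})$, $k=0,\dots,4$; $\gamma_{ijk\ell}(M)$ is its $4\times4$ minor with rows $i,j,k,\ell$, written $\bar\gamma_{ijk\ell}$. Put $\delta:=y^2-xz$, $\alpha:=\bar\gamma_{1357}/\bar\gamma_{1257}$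 and $$h_1:=y^p+\frac{\bar\gamma_{1357}}{\bar\gamma_{1257}}\delta x^{p-2}+\frac{\bar\gamma_{2357}}{\bar\gamma_{1257}}yx^{p-1},$$ $$\widetilde{h_2}:=N_M(y)-h_1^{p^3}+\alpha^{p^3}h_1^{2p^2}x^{p^4-2p^3}-2\alpha^{p^3+p^2}h_1^{p^2+2p}x^{p^4-p^3-2p^2}+4\alpha^{p^3+p^2+p}h_1^{p^2+p+2}x^{p^4-p^3-p^2-2p},$$ $$h_2:=\frac{\widetilde{h_2}}{8\alpha^{p^3+p^2+p+1}x^{p^4-p^3-p^2-p-2}}.$$ Under the hypotheses of the claim these are elements of $\mathbf{F}[V_M]^E$ with lead terms $y^p$ and $y^{p^3+p^2+p+2}$ for $h_1$ and $h_2$ respectively. Conventions: graded reverse lexicographic order with $x<y<z$; $\mathrm{LM}$, $\mathrm{LT}$ denote lead monomial and lead term (with coefficient). A finite subset $\mathcal B=\{b_1,\dots,b_m\}$ of a subalgebra $A$ of a polynomial ring is a SAGBI basis for $A$ if the monomials $\mathrm{LM}(b_i)$ generate the algebra spanned by the lead monomials of the elements of $A$. A tête-à-tête is a pair $(b^I,b^J)$ of products of elements of $\mathcal B$ with $\mathrm{LM}(b^I)=\mathrm{LM}(b^J)$. Its subduction: choose a scalar $c$ with $\mathrm{LT}(b^I)=\mathrm{LT}(cb^J)$ and repeatedly cancel the lead term of $b^I-cb^J$ by scalar multiples of products of elements of $\mathcal B$; if this ends at zero, it expresses $b^I-cb^J$ as a polynomial in $\mathcal B$, giving a relation. "Hypersurface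 with the relation coming from the subduction of" a tête-à-tête means that the kernel of the surjection from the polynomial ring on $m$ variables sending the variables to $b_1,\dots,b_m$ is the principal ideal generated by the relation so obtained. *)

theory Defs
  imports
    "HOL-Analysis.Determinants"
    "HOL-Library.Poly_Mapping"
    "HOL-Computational_Algebra.Primes"
    "HOL-Algebra.Elementary_Groups"
    "HOL-Algebra.Product_Groups"
    "HOL-Algebra.Group_Action"
begin

section \<open>Multivariate polynomials\<close>

type_synonym 'v mono = "'v \<Rightarrow>\<^sub>0 nat"
type_synonym ('v, 'a) mpoly = "('v \<Rightarrow>\<^sub>0 nat) \<Rightarrow>\<^sub>0 'a"

definition Const :: "'a::zero \<Rightarrow> ('v, 'a) mpoly" where
  "Const c = Poly_Mapping.single 0 c"

definition Var :: "'v \<Rightarrow> ('v, 'a::zero_neq_one) mpoly" where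
  "Var v = Poly_Mapping.single (Poly_Mapping.single v 1) 1"

text \<open>The product \<open>b\<^sup>I\<close> of members of a family \<open>b\<close>, for an exponent vector \<open>I\<close>.\<close>

definition fam_prod :: "('i \<Rightarrow> 'r::comm_monoid_mult) \<Rightarrow> 'i mono \<Rightarrow> 'r" where
  "fam_prod b I = (\<Prod>i\<in>Poly_Mapping.keys I. b i ^ Poly_Mapping.lookup I i)"

text \<open>The algebra homomorphism of polynomial rings that sends the variable \<open>i\<close> to \<open>b i\<close>.\<close>

definition subst :: "('i \<Rightarrow> ('v, 'a) mpoly) \<Rightarrow> ('i, 'a::comm_ring_1) mpoly \<Rightarrow> ('v, 'a) mpoly" where
  "subst b f =
     (\<Sum>I\<in>Poly_Mapping.keys f. Const (Poly_Mapping.lookup f I) * fam_prod b I)"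

definition is_subalgebra :: "('v, 'a::comm_ring_1) mpoly set \<Rightarrow> bool" where
  "is_subalgebra A \<longleftrightarrow>
     range Const \<subseteq> A \<and> (\<forall>f\<in>A. \<forall>g\<in>A. f + g \<in> A) \<and> (\<forall>f\<in>A. \<forall>g\<in>A. f * g \<in> A)"

lemma vector_space_mpoly:
  "vector_space (\<lambda>(c::'a::field) (f :: ('v, 'a) mpoly). Const c * f)"
  by unfold_locales
    (simp_all add: Const_def algebra_simps single_add mult_single flip: mult.assoc)

abbreviation linear_span :: "('v, 'a::field) mpoly set \<Rightarrow> ('v, 'a) mpoly set" where
  "linear_span \<equiv> module.span (\<lambda>c f. Const c * f)"


section \<open>Graded reverse lexicographic order, lead terms, SAGBI bases\<close>

definition total_deg :: "'v mono \<Rightarrow> nat" where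
  "total_deg m = (\<Sum>v\<in>Poly_Mapping.keys m. Poly_Mapping.lookup m v)"

text \<open>In equal degree, the monomial with the smaller exponent at the smallest variable where
  the two differ is the larger one.\<close>

definition grevlex_less :: "'v::linorder mono \<Rightarrow> 'v mono \<Rightarrow> bool" where
  "grevlex_less m n \<longleftrightarrow>
     total_deg m < total_deg n \<or>
     total_deg m = total_deg n \<and>
       (\<exists>v. Poly_Mapping.lookup m v > Poly_Mapping.lookup n v \<and>
            (\<forall>u<v. Poly_Mapping.lookup m u = Poly_Mapping.lookup n u))"

text \<open>The exponent vector of the lead monomial; meaningful for \<open>f \<noteq> 0\<close> only.\<close>

definition lead_exp :: "('v::linorder, 'a::zero) mpoly \<Rightarrow> 'v mono" where
  "lead_exp f = (THE m. m \<in> Poly_Mapping.keys f \<and>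
                        (\<forall>n\<in>Poly_Mapping.keys f. n \<noteq> m \<longrightarrow> grevlex_less n m))"

definition LM :: "('v::linorder, 'a::zero_neq_one) mpoly \<Rightarrow> ('v, 'a) mpoly" where
  "LM f = Poly_Mapping.single (lead_exp f) 1"

text \<open>Here \<open>LT 0 = 0\<close>.\<close>

definition LT :: "('v::linorder, 'a::zero) mpoly \<Rightarrow> ('v, 'a) mpoly" where
  "LT f = Poly_Mapping.single (lead_exp f) (Poly_Mapping.lookup f (lead_exp f))"

definition is_sagbi_basis ::
  "('v::linorder, 'a::field) mpoly set \<Rightarrow> ('v, 'a) mpoly set \<Rightarrow> bool" where
  "is_sagbi_basis B A \<longleftrightarrow>
     is_subalgebra A \<and> finite B \<and> B \<subseteq> A \<and>
     is_subalgebra hull (LM ` (B - {0})) = linear_span (LM ` (A - {0}))"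

definition is_tete_a_tete ::
  "('i \<Rightarrow> ('v::linorder, 'a::field) mpoly) \<Rightarrow> 'i mono \<Rightarrow> 'i mono \<Rightarrow> bool" where
  "is_tete_a_tete b I J \<longleftrightarrow> LM (fam_prod b I) = LM (fam_prod b J)"

text \<open>\<open>subducts b f Q g\<close>: finitely many cancellations of lead terms by scalar multiples of
  products of members of \<open>b\<close> lead from \<open>f\<close> to \<open>g\<close>, and \<open>Q\<close> is the formal sum of what was
  subtracted, so that \<open>f = subst b Q + g\<close>.\<close>

inductive subducts ::
  "('i \<Rightarrow> ('v::linorder, 'a::field) mpoly) \<Rightarrow> ('v, 'a) mpoly \<Rightarrow> ('i, 'a) mpoly \<Rightarrow> ('v, 'a) mpoly \<Rightarrow> bool"
  for b f where
  start: "subducts b f 0 f"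
| cancel: "\<lbrakk>subducts b f Q g; g \<noteq> 0; LT g = LT (Const d * fam_prod b K)\<rbrakk>
    \<Longrightarrow> subducts b f (Q + Poly_Mapping.single K d) (g - Const d * fam_prod b K)"

text \<open>\<open>R\<close> is a relation obtained from a subduction to zero of the
  tete-a-tete \<open>(b\<^sup>I, b\<^sup>J)\<close>. Subduction is not deterministic, so there may be several.\<close>

definition subduction_relation ::
  "('i \<Rightarrow> ('v::linorder, 'a::field) mpoly) \<Rightarrow> 'i mono \<Rightarrow> 'i mono \<Rightarrow> ('i, 'a) mpoly \<Rightarrow> bool" where
  "subduction_relation b I J R \<longleftrightarrow>
     (\<exists>c Q. LT (fam_prod b I) = LT (Const c * fam_prod b J) \<and>
            subducts b (fam_prod b I - Const c * fam_prod b J) Q 0 \<and>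
            R = Poly_Mapping.single I 1 - Poly_Mapping.single J c - Q)"

text \<open>\<open>A\<close> is generated by the family \<open>b\<close>, with ideal of relations the principal ideal \<open>(R)\<close>.\<close>

definition is_hypersurface_with ::
  "('v, 'a::field) mpoly set \<Rightarrow> ('i \<Rightarrow> ('v, 'a) mpoly) \<Rightarrow> ('i, 'a) mpoly \<Rightarrow> bool" where
  "is_hypersurface_with A b R \<longleftrightarrow>
     range (subst b) = A \<and> {P. subst b P = 0} = {R * P | P. True}"


section \<open>The representation and its invariants\<close>

datatype xyz = VX | VY | VZ

text \<open>The order of the variables is \<open>VX < VY < VZ\<close>.\<close>

fun xyz_rank :: "xyz \<Rightarrow> nat" where
  "xyz_rank VX = 0"
| "xyz_rank VY = 1"
| "xyz_rank VZ = 2"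

instantiation xyz :: linorder
begin

definition less_eq_xyz :: "xyz \<Rightarrow> xyz \<Rightarrow> bool" where
  "u \<le> v \<longleftrightarrow> xyz_rank u \<le> xyz_rank v"

definition less_xyz :: "xyz \<Rightarrow> xyz \<Rightarrow> bool" where
  "u < v \<longleftrightarrow> xyz_rank u < xyz_rank v"

instance
proof
  fix u v :: xyz
  show "u \<le> v \<Longrightarrow> v \<le> u \<Longrightarrow> u = v"
    by (cases u; cases v) (simp_all add: less_eq_xyz_def)
qed (auto simp: less_eq_xyz_def less_xyz_def)

end

abbreviation px :: "(xyz, 'a::zero_neq_one) mpoly" where "px \<equiv> Var VX"
abbreviation py :: "(xyz, 'a::zero_neq_one) mpoly" where "py \<equiv> Var VY"
abbreviation pz :: "(xyz, 'a::zero_neq_one) mpoly" where "pz \<equiv> Var VZ"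

text \<open>The group \<open>(\<int>/p)\<^sup>4\<close>; its element \<open>a\<close> stands for \<open>e\<^sub>1\<^bsup>a 1\<^esup> e\<^sub>2\<^bsup>a 2\<^esup> e\<^sub>3\<^bsup>a 3\<^esup> e\<^sub>4\<^bsup>a 4\<^esup>\<close>.\<close>

definition E_group :: "nat \<Rightarrow> (4 \<Rightarrow> int) monoid" where
  "E_group p = product_group UNIV (\<lambda>_. integer_mod_group p)"

primrec e_image :: "'a::field^4^2 \<Rightarrow> 4 \<Rightarrow> xyz \<Rightarrow> (xyz, 'a) mpoly" where
  "e_image M j VX = px"
| "e_image M j VY = py + Const (M $ 1 $ j) * px"
| "e_image M j VZ = pz + 2 * Const (M $ 1 $ j) * py + Const ((M $ 1 $ j)\<^sup>2 + M $ 2 $ j) * px"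

definition e_act :: "'a::field^4^2 \<Rightarrow> 4 \<Rightarrow> (xyz, 'a) mpoly \<Rightarrow> (xyz, 'a) mpoly" where
  "e_act M j = subst (e_image M j)"

definition E_act :: "'a::field^4^2 \<Rightarrow> (4 \<Rightarrow> int) \<Rightarrow> (xyz, 'a) mpoly \<Rightarrow> (xyz, 'a) mpoly" where
  "E_act M a f =
     (e_act M 4 ^^ nat (a 4)) ((e_act M 3 ^^ nat (a 3))
       ((e_act M 2 ^^ nat (a 2)) ((e_act M 1 ^^ nat (a 1)) f)))"

definition invariant_ring :: "nat \<Rightarrow> 'a::field^4^2 \<Rightarrow> (xyz, 'a) mpoly set" where
  "invariant_ring p M = {f. \<forall>a\<in>carrier (E_group p). E_act M a f = f}"

definition orbit_prod :: "nat \<Rightarrow> 'a::field^4^2 \<Rightarrow> (xyz, 'a) mpoly \<Rightarrow> (xyz, 'a) mpoly" where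
  "orbit_prod p M f = \<Prod>(orbit (E_group p) (E_act M) f)"


section \<open>Minors and the generators\<close>

definition frob_row :: "nat \<Rightarrow> 'a::field^4^2 \<Rightarrow> 2 \<Rightarrow> nat \<Rightarrow> 'a^4" where
  "frob_row p M i k = (\<chi> j. (M $ i $ j) ^ (p ^ k))"

definition Gamma_mat :: "nat \<Rightarrow> 'a::field^4^2 \<Rightarrow> 'a^4^10" where
  "Gamma_mat p M =
     vector [frob_row p M 1 0, frob_row p M 2 0, frob_row p M 1 1, frob_row p M 2 1,
             frob_row p M 1 2, frob_row p M 2 2, frob_row p M 1 3, frob_row p M 2 3,
             frob_row p M 1 4, frob_row p M 2 4]"

definition gamma :: "nat \<Rightarrow> 'a::field^4^2 \<Rightarrow> 10 \<Rightarrow> 10 \<Rightarrow> 10 \<Rightarrow> 10 \<Rightarrow> 'a" where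
  "gamma p M i j k l =
     det (vector [Gamma_mat p M $ i, Gamma_mat p M $ j, Gamma_mat p M $ k, Gamma_mat p M $ l]
          :: 'a^4^4)"

definition delta :: "(xyz, 'a::field) mpoly" where
  "delta = py\<^sup>2 - px * pz"

definition alpha :: "nat \<Rightarrow> 'a::field^4^2 \<Rightarrow> 'a" where
  "alpha p M = gamma p M 1 3 5 7 / gamma p M 1 2 5 7"

definition h1 :: "nat \<Rightarrow> 'a::field^4^2 \<Rightarrow> (xyz, 'a) mpoly" where
  "h1 p M = py ^ p
     + Const (gamma p M 1 3 5 7 / gamma p M 1 2 5 7) * delta * px ^ (p - 2)
     + Const (gamma p M 2 3 5 7 / gamma p M 1 2 5 7) * py * px ^ (p - 1)"

definition h2_tilde :: "nat \<Rightarrow> 'a::field^4^2 \<Rightarrow> (xyz, 'a) mpoly" where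
  "h2_tilde p M =
     orbit_prod p M py - h1 p M ^ (p^3)
     + Const (alpha p M ^ (p^3)) * h1 p M ^ (2 * p^2) * px ^ (p^4 - 2 * p^3)
     - 2 * Const (alpha p M ^ (p^3 + p^2)) * h1 p M ^ (p^2 + 2 * p)
         * px ^ (p^4 - p^3 - 2 * p^2)
     + 4 * Const (alpha p M ^ (p^3 + p^2 + p)) * h1 p M ^ (p^2 + p + 2)
         * px ^ (p^4 - p^3 - p^2 - 2 * p)"

text \<open>The quotient of \<open>f\<close> by \<open>g \<noteq> 0\<close> in the polynomial ring, meaningful if \<open>g dvd f\<close>.\<close>

definition exact_quot :: "('v, 'a::comm_ring_1) mpoly \<Rightarrow> ('v, 'a) mpoly \<Rightarrow> ('v, 'a) mpoly" where
  "exact_quot f g = (THE q. f = g * q)"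

definition h2 :: "nat \<Rightarrow> 'a::field^4^2 \<Rightarrow> (xyz, 'a) mpoly" where
  "h2 p M = exact_quot (h2_tilde p M)
     (8 * Const (alpha p M ^ (p^3 + p^2 + p + 1)) * px ^ (p^4 - p^3 - p^2 - p - 2))"

text \<open>The four generators as a family, indexed by the variables of the polynomial ring that
  maps onto the invariants.\<close>

datatype gen = GX | GH1 | GH2 | GNZ

primrec generators :: "nat \<Rightarrow> 'a::field^4^2 \<Rightarrow> gen \<Rightarrow> (xyz, 'a) mpoly" where
  "generators p M GX = px"
| "generators p M GH1 = h1 p M"
| "generators p M GH2 = h2 p M"
| "generators p M GNZ = orbit_prod p M pz"

end

theory Submission
  imports Defs "HOL-Computational_Algebra.Polynomial" "HOL-Number_Theory.Cong"
begin

text \<open>Write \<open>c\<close> and \<open>d\<close> for the rows of \<open>M\<close>. Since \<open>\<gamma>\<^sub>1\<^sub>3\<^sub>5\<^sub>7 \<noteq> 0\<close>, the first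
row and its entrywise Frobenius powers up to the third form a basis, and the other three conditions
on the minors say precisely that \<open>d = r c + s c\<^sup>p\<close> with \<open>s \<noteq> 0\<close> (lemma
\<open>second_row_of_minors\<close>). So the group acts through the \<open>\<F>\<^sub>p\<close>-span \<open>U\<close> of
the entries of \<open>c\<close>, of order \<open>p\<^sup>4\<close>: an element \<open>u\<close> sends \<open>y\<close> to
\<open>y + u x\<close> and \<open>z\<close> to \<open>z + 2 u y + (u\<^sup>2 + r u + s u\<^sup>p) x\<close>. The last coefficient is what makes \<open>h\<^sub>1\<close>
invariant.

Everything follows from one fact (lemma \<open>invariant_lead\<close>): the lead monomial of a nonzero
invariant is a product of the lead monomials \<open>x\<close>, \<open>y\<^sup>p\<close>, \<open>y\<^sup>m\<close>, \<open>z\<^sup>q\<close> of the generators, where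
\<open>m = p\<^sup>3 + p\<^sup>2 + p + 2\<close> and \<open>q = p\<^sup>4\<close>. To see it, first invert \<open>x\<close>. As \<open>h\<^sub>1\<close> is linear in \<open>z\<close> with
leading coefficient a unit times a power of \<open>x\<close>, the polynomial ring becomes
\<open>\<F>[x, x\<^sup>-\<^sup>1, h\<^sub>1][y]\<close>, on which \<open>U\<close> acts by translating \<open>y\<close>; hence the invariants become
\<open>\<F>[x, x\<^sup>-\<^sup>1, h\<^sub>1, N(y)]\<close> (lemma \<open>localised_generation\<close>), and \<open>N(y)\<close> is \<open>h\<^sub>2\<close> times a constant
and a power of \<open>x\<close>, plus a polynomial in \<open>x\<close> and \<open>h\<^sub>1\<close>. Secondly, expressing \<open>z\<close> by \<open>y\<close> and \<open>h\<^sub>1\<close> shows that \<open>N(z)\<close>,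
up to a constant and a power of \<open>x\<close>, is a monic polynomial of degree \<open>p\<close> in \<open>N(y)\<close> over \<open>\<F>[x, h\<^sub>1]\<close> (lemma
\<open>NZ_relation\<close>). This trades \<open>h\<^sub>2\<^sup>p\<close> for \<open>N(z)\<close> and lower powers of \<open>h\<^sub>2\<close>. So for each invariant
\<open>f\<close> some \<open>x\<^sup>k f\<close> is a linear combination of products of generators in which \<open>h\<^sub>2\<close> has exponent
less than \<open>p\<close>. Such products have pairwise distinct lead monomials, because \<open>m\<close> is \<open>2\<close> modulo
the odd prime \<open>p\<close>; so the lead monomial of \<open>x\<^sup>k f\<close> is that of one of them. Only the generator \<open>x\<close> has a lead
monomial involving \<open>x\<close>, so the factor \<open>x\<^sup>k\<close> can be cancelled.

The remaining statements are formal consequences. Subduction of any invariant ends at zero, which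
gives the relation; its lead product is \<open>h\<^sub>2\<^sup>p\<close>, so division by it reduces every polynomial in the
generators to one with \<open>h\<^sub>2\<close>-exponents less than \<open>p\<close>, and on those the substitution of the
generators is injective, again by distinctness of lead monomials.\<close>

section \<open>Ring homomorphisms out of polynomial rings\<close>

locale rhom =
  fixes \<phi> :: "'r::comm_ring_1 \<Rightarrow> 's::comm_ring_1"
  assumes add: "\<phi> (a + b) = \<phi> a + \<phi> b"
    and mult: "\<phi> (a * b) = \<phi> a * \<phi> b"
    and one: "\<phi> 1 = 1"
begin

lemma zero: "\<phi> 0 = 0"
  using add[of 0 0] by simp

lemma uminus: "\<phi> (- a) = - \<phi> a"
  using add[of a "- a"] zero by (simp add: eq_neg_iff_add_eq_0 add.commute)

lemma minus: "\<phi> (a - b) = \<phi> a - \<phi> b"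
  using add[of a "- b"] uminus by simp

lemma power: "\<phi> (a ^ n) = \<phi> a ^ n"
  by (induction n) (simp_all add: one mult)

lemma of_nat: "\<phi> (of_nat n) = of_nat n"
  by (induction n) (simp_all add: zero one add)

lemma numeral: "\<phi> (numeral n) = numeral n"
  using of_nat[of "numeral n"] by simp

lemma sum: "\<phi> (sum f S) = (\<Sum>i\<in>S. \<phi> (f i))"
  by (induction S rule: infinite_finite_induct) (simp_all add: zero add)

lemma prod: "\<phi> (prod f S) = (\<Prod>i\<in>S. \<phi> (f i))"
  by (induction S rule: infinite_finite_induct) (simp_all add: one mult)

lemmas simps = zero one add mult uminus minus power of_nat numeral sum prod

end

text \<open>Evaluation of a univariate polynomial after mapping its coefficients by \<open>\<phi>\<close>. Iterating it turns
\<open>\<F>[x]\<close>, \<open>\<F>[x][y]\<close> and \<open>\<F>[x][y][z]\<close>, for which division and degrees are at hand, into sources of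
homomorphisms to the polynomial ring in \<open>x, y, z\<close>.\<close>

definition peval :: "('r::comm_ring_1 \<Rightarrow> 's::comm_ring_1) \<Rightarrow> 's \<Rightarrow> 'r poly \<Rightarrow> 's" where
  "peval \<phi> u f = poly (map_poly \<phi> f) u"

lemma peval_pCons:
  assumes "rhom \<phi>" shows "peval \<phi> u (pCons a f) = \<phi> a + u * peval \<phi> u f"
  by (simp add: peval_def map_poly_pCons rhom.zero[OF assms])

lemma peval_0 [simp]: "peval \<phi> u 0 = 0"
  by (simp add: peval_def)

lemma peval_const: "rhom \<phi> \<Longrightarrow> peval \<phi> u [:a:] = \<phi> a"
  by (simp add: peval_pCons)

lemma rhom_peval:
  assumes "rhom \<phi>" shows "rhom (peval \<phi> u)"
proof -
  interpret rhom \<phi> by fact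
  note pc = peval_pCons[OF assms]
  have add': "peval \<phi> u (f + g) = peval \<phi> u f + peval \<phi> u g" for f g
    by (induction f g rule: poly_induct2) (simp_all add: pc add algebra_simps)
  have smult': "peval \<phi> u (smult a f) = \<phi> a * peval \<phi> u f" for a f
    by (induction f) (simp_all add: pc mult algebra_simps)
  have "peval \<phi> u (f * g) = peval \<phi> u f * peval \<phi> u g" for f g
    by (induction f) (simp_all add: pc add' smult' zero algebra_simps)
  then show ?thesis
    by unfold_locales (simp_all add: add' one_pCons pc one)
qed

lemma peval_monom:
  assumes "rhom \<phi>" shows "peval \<phi> u (monom a n) = \<phi> a * u ^ n"
  by (induction n) (simp_all add: monom_0 monom_Suc peval_pCons[OF assms] rhom.zero[OF assms])

lemma peval_sum_coeff:
  assumes "rhom \<phi>" shows "peval \<phi> u f = (\<Sum>i\<le>degree f. \<phi> (coeff f i) * u ^ i)"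
proof -
  interpret e: rhom "peval \<phi> u" using rhom_peval[OF assms] .
  have "peval \<phi> u f = peval \<phi> u (\<Sum>i\<le>degree f. monom (coeff f i) i)"
    by (simp add: poly_as_sum_of_monoms)
  then show ?thesis by (simp add: e.sum peval_monom[OF assms])
qed

lemma peval_pcompose:
  assumes "rhom \<phi>" shows "peval \<phi> u (f \<circ>\<^sub>p g) = peval \<phi> (peval \<phi> u g) f"
proof -
  interpret e: rhom "peval \<phi> u" using rhom_peval[OF assms] .
  show ?thesis
    by (induction f) (simp_all add: pcompose_pCons e.add e.mult peval_pCons[OF assms] rhom.zero[OF assms])
qed

lemma peval_map_poly:
  assumes "rhom \<phi>" "rhom \<sigma>" shows "peval \<phi> u (map_poly \<sigma> f) = peval (\<phi> \<circ> \<sigma>) u f"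
proof -
  interpret s: rhom \<sigma> by fact
  interpret p: rhom \<phi> by fact
  have c: "rhom (\<phi> \<circ> \<sigma>)" by unfold_locales (simp_all add: s.simps p.simps)
  show ?thesis
    by (induction f)
      (simp_all add: s.zero p.zero peval_pCons[OF assms(1)] peval_pCons[OF c, unfolded o_def] map_poly_pCons o_def)
qed

lemma rhom_comp: "rhom \<phi> \<Longrightarrow> rhom \<sigma> \<Longrightarrow> rhom (\<phi> \<circ> \<sigma>)"
  by (simp add: rhom_def)

lemma rhom_pcompose: "rhom (\<lambda>f. f \<circ>\<^sub>p g)"
  by unfold_locales (simp_all add: pcompose_add pcompose_mult one_pCons)

lemma rhom_peval_comp: "rhom \<psi> \<Longrightarrow> rhom \<phi> \<Longrightarrow> \<psi> (peval \<phi> u f) = peval (\<psi> \<circ> \<phi>) (\<psi> u) f"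
  by (induction f) (simp_all add: peval_pCons rhom_comp rhom.simps)

lemma fam_prod_superset:
  assumes "finite S" "Poly_Mapping.keys I \<subseteq> S"
  shows "fam_prod b I = (\<Prod>i\<in>S. b i ^ Poly_Mapping.lookup I i)"
  unfolding fam_prod_def
  by (rule prod.mono_neutral_left) (use assms in \<open>auto simp: in_keys_iff\<close>)

lemma fam_prod_0 [simp]: "fam_prod b 0 = 1"
  by (simp add: fam_prod_def)

lemma fam_prod_single: "fam_prod b (Poly_Mapping.single i n) = b i ^ n"
  by (simp add: fam_prod_def)

lemma fam_prod_add: "fam_prod b (I + J) = fam_prod b I * fam_prod b J"
proof -
  let ?S = "Poly_Mapping.keys I \<union> Poly_Mapping.keys J"
  have "fam_prod b (I + J) = (\<Prod>i\<in>?S. b i ^ Poly_Mapping.lookup (I + J) i)"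
    by (rule fam_prod_superset) (simp_all add: keys_add)
  also have "\<dots> = fam_prod b I * fam_prod b J"
    by (simp add: fam_prod_superset[of ?S] lookup_add power_add prod.distrib)
  finally show ?thesis .
qed

lemma poly_mapping_induct_single [case_names zero single add]:
  fixes f :: "'k \<Rightarrow>\<^sub>0 'a::comm_monoid_add"
  assumes "P 0" "\<And>k a. P (Poly_Mapping.single k a)" "\<And>f g. P f \<Longrightarrow> P g \<Longrightarrow> P (f + g)"
  shows "P f"
proof -
  have eq: "f = (\<Sum>k\<in>Poly_Mapping.keys f. Poly_Mapping.single k (Poly_Mapping.lookup f k))"
    by (rule poly_mapping_eqI) (simp add: lookup_sum lookup_single when_def in_keys_iff)
  have "P (\<Sum>k\<in>S. Poly_Mapping.single k (Poly_Mapping.lookup f k))" for S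
    by (induction S rule: infinite_finite_induct) (simp_all add: assms)
  then show ?thesis using eq by metis
qed

lemma rhom_Const: "rhom (Const :: 'a::comm_ring_1 \<Rightarrow> ('v, 'a) mpoly)"
  by unfold_locales (simp_all add: Const_def single_add mult_single)

interpretation Const: rhom "Const :: 'a::comm_ring_1 \<Rightarrow> ('v, 'a) mpoly" by (rule rhom_Const)

lemma subst_superset:
  assumes "finite S" "Poly_Mapping.keys f \<subseteq> S"
  shows "subst b f = (\<Sum>I\<in>S. Const (Poly_Mapping.lookup f I) * fam_prod b I)"
  unfolding subst_def
  by (rule sum.mono_neutral_left) (use assms in \<open>auto simp: in_keys_iff Const.zero\<close>)

lemma subst_single: "subst b (Poly_Mapping.single I a) = Const a * fam_prod b I"
  by (simp add: subst_def Const.zero)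

lemma subst_add: "subst b (f + g) = subst b f + subst b g"
proof -
  let ?S = "Poly_Mapping.keys f \<union> Poly_Mapping.keys g"
  have "subst b (f + g) = (\<Sum>I\<in>?S. Const (Poly_Mapping.lookup (f + g) I) * fam_prod b I)"
    by (rule subst_superset) (simp_all add: keys_add)
  also have "\<dots> = subst b f + subst b g"
    by (simp add: subst_superset[of ?S] lookup_add Const.add sum.distrib algebra_simps)
  finally show ?thesis .
qed

lemma rhom_subst: "rhom (subst b)"
proof
  show "subst b 1 = 1"
    using subst_single[of b 0 1] by (simp add: Const.one)
  show "subst b (f + g) = subst b f + subst b g" for f g by (rule subst_add)
  show "subst b (f * g) = subst b f * subst b g" for f g
  proof (induction f rule: poly_mapping_induct_single)
    case (single I c)
    have [simp]: "subst b 0 = 0" by (simp add: subst_def)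
    show ?case
      by (induction g rule: poly_mapping_induct_single)
        (simp_all add: mult_single subst_single fam_prod_add Const.mult subst_add algebra_simps)
  qed (simp_all add: subst_add distrib_right, simp add: subst_def)
qed

interpretation subst: rhom "subst b" for b by (rule rhom_subst)

lemma subst_Const [simp]: "subst b (Const c) = Const c"
  by (simp add: Const_def subst_single)

lemma subst_Var [simp]: "subst b (Var v) = b v"
  by (simp add: Var_def subst_single fam_prod_single Const.one)

lemma mpoly_induct [case_names Const Var add mult]:
  fixes f :: "('v, 'a::comm_ring_1) mpoly"
  assumes "\<And>c. P (Const c)" "\<And>v. P (Var v)" "\<And>f g. P f \<Longrightarrow> P g \<Longrightarrow> P (f + g)"
    "\<And>f g. P f \<Longrightarrow> P g \<Longrightarrow> P (f * g)"
  shows "P f"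
proof (induction f rule: poly_mapping_induct_single)
  case zero
  show ?case using assms(1)[of 0] by (simp add: Const.zero)
next
  case (single I c)
  have V: "P (Poly_Mapping.single (Poly_Mapping.single v n) 1)" for v n
  proof (induction n)
    case 0 then show ?case using assms(1)[of 1] by (simp add: Const.one)
  next
    case (Suc n)
    have "Poly_Mapping.single (Poly_Mapping.single v (Suc n)) (1::'a)
        = Var v * Poly_Mapping.single (Poly_Mapping.single v n) 1"
      by (simp add: Var_def mult_single flip: single_add)
    then show ?case using Suc assms by simp
  qed
  have "P (Poly_Mapping.single I 1)"
  proof (induction I rule: poly_mapping_induct_single)
    case zero then show ?case using assms(1)[of 1] by (simp add: Const.one)
  next
    case (single k a) then show ?case by (rule V)
  next
    case (add f g)
    then show ?case using assms(4)[OF add] by (simp add: mult_single)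
  qed
  moreover have "Poly_Mapping.single I c = Const c * Poly_Mapping.single I 1"
    by (simp add: Const_def mult_single)
  ultimately show ?case using assms by simp
next
  case (add f g)
  then show ?case using assms by simp
qed

lemma rhom_mpoly_eqI:
  assumes "rhom \<phi>" "rhom \<psi>" "\<And>c. \<phi> (Const c) = \<psi> (Const c)" "\<And>v. \<phi> (Var v) = \<psi> (Var v)"
  shows "\<phi> f = \<psi> f"
  by (induction f rule: mpoly_induct) (simp_all add: assms rhom.simps)

section \<open>Lead exponents\<close>

lemma total_deg_superset:
  assumes "finite S" "Poly_Mapping.keys m \<subseteq> S"
  shows "total_deg m = (\<Sum>v\<in>S. Poly_Mapping.lookup m v)"
  unfolding total_deg_def
  by (rule sum.mono_neutral_left) (use assms in \<open>auto simp: in_keys_iff\<close>)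

lemma total_deg_add: "total_deg (m + n) = total_deg m + total_deg n"
proof -
  let ?S = "Poly_Mapping.keys m \<union> Poly_Mapping.keys n"
  have "total_deg (m + n) = (\<Sum>v\<in>?S. Poly_Mapping.lookup (m + n) v)"
    by (rule total_deg_superset) (simp_all add: keys_add)
  then show ?thesis
    by (simp add: total_deg_superset[of ?S] lookup_add sum.distrib)
qed

lemma total_deg_single [simp]: "total_deg (Poly_Mapping.single v n) = n"
  by (simp add: total_deg_def)

lemma grevlex_irrefl: "\<not> grevlex_less m m"
  by (simp add: grevlex_less_def)

lemma grevlex_trans:
  assumes "grevlex_less k m" "grevlex_less m n" shows "grevlex_less k n"
proof (cases "total_deg k = total_deg m \<and> total_deg m = total_deg n")
  case True
  obtain u where u: "Poly_Mapping.lookup k u > Poly_Mapping.lookup m u"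
      "\<And>w. w < u \<Longrightarrow> Poly_Mapping.lookup k w = Poly_Mapping.lookup m w"
    using assms(1) True by (auto simp: grevlex_less_def)
  obtain v where v: "Poly_Mapping.lookup m v > Poly_Mapping.lookup n v"
      "\<And>w. w < v \<Longrightarrow> Poly_Mapping.lookup m w = Poly_Mapping.lookup n w"
    using assms(2) True by (auto simp: grevlex_less_def)
  have "Poly_Mapping.lookup k (min u v) > Poly_Mapping.lookup n (min u v)"
    using u v by (cases u v rule: linorder_cases) (auto simp: min_def)
  moreover have "\<forall>w<min u v. Poly_Mapping.lookup k w = Poly_Mapping.lookup n w"
    using u v by simp
  ultimately show ?thesis using True unfolding grevlex_less_def by auto
qed (use assms in \<open>auto simp: grevlex_less_def\<close>)

lemma grevlex_asym: "grevlex_less m n \<Longrightarrow> \<not> grevlex_less n m"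
  using grevlex_trans grevlex_irrefl by blast

lemma grevlex_total: "m \<noteq> n \<Longrightarrow> grevlex_less m n \<or> grevlex_less n m"
proof (cases "total_deg m" "total_deg n" rule: linorder_cases)
  case equal
  assume "m \<noteq> n"
  let ?S = "{v. Poly_Mapping.lookup m v \<noteq> Poly_Mapping.lookup n v}"
  have "?S \<subseteq> Poly_Mapping.keys m \<union> Poly_Mapping.keys n" by (auto simp: in_keys_iff)
  then have fin: "finite ?S" by (rule finite_subset) simp
  have ne: "?S \<noteq> {}" using \<open>m \<noteq> n\<close> poly_mapping_eqI[of m n] by auto
  have "Poly_Mapping.lookup m (Min ?S) \<noteq> Poly_Mapping.lookup n (Min ?S)"
    using Min_in[OF fin ne] by simp
  moreover have "\<forall>u<Min ?S. Poly_Mapping.lookup m u = Poly_Mapping.lookup n u"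
    using Min_le[OF fin] leD by blast
  ultimately obtain v where "Poly_Mapping.lookup m v \<noteq> Poly_Mapping.lookup n v"
      "\<forall>u<v. Poly_Mapping.lookup m u = Poly_Mapping.lookup n u" by blast
  then show ?thesis
    using equal unfolding grevlex_less_def by (cases "Poly_Mapping.lookup m v < Poly_Mapping.lookup n v") force+
qed (auto simp: grevlex_less_def)

lemma grevlex_add_left: "grevlex_less m n \<Longrightarrow> grevlex_less (k + m) (k + n)"
  by (auto simp: grevlex_less_def total_deg_add lookup_add)

lemma grevlex_add_right: "grevlex_less m n \<Longrightarrow> grevlex_less (m + k) (n + k)"
  using grevlex_add_left[of m n k] by (simp add: add.commute)

text \<open>With finitely many variables only finitely many monomials lie below a given one, whence the order
is well-founded.\<close>

lemma finite_total_deg_le: "finite {m :: 'v::finite mono. total_deg m \<le> d}"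
proof (rule finite_imageD)
  have "Poly_Mapping.lookup ` {m :: 'v mono. total_deg m \<le> d} \<subseteq> PiE UNIV (\<lambda>_. {..d})"
  proof safe
    fix m :: "'v mono" and v assume "total_deg m \<le> d"
    moreover have "Poly_Mapping.lookup m v \<le> total_deg m"
      by (subst total_deg_superset[of UNIV]) (auto intro: member_le_sum)
    ultimately show "Poly_Mapping.lookup m v \<le> d" by simp
  qed auto
  then show "finite (Poly_Mapping.lookup ` {m :: 'v mono. total_deg m \<le> d})"
    by (rule finite_subset) (auto intro: finite_PiE)
qed (auto simp: inj_on_def)

lemma wf_grevlex: "wf {(m, n :: 'v::{finite,linorder} mono). grevlex_less m n}"
proof (rule wf_subset)
  let ?c = "\<lambda>n :: 'v mono. card {m. grevlex_less m n}"
  have fin: "finite {m :: 'v mono. grevlex_less m n}" for n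
    by (rule finite_subset[OF _ finite_total_deg_le[of "total_deg n"]])
       (auto simp: grevlex_less_def)
  have "?c m < ?c n" if "grevlex_less m n" for m n :: "'v mono"
  proof (rule psubset_card_mono[OF fin])
    have "m \<in> {k. grevlex_less k n}" "m \<notin> {k. grevlex_less k m}"
      using that grevlex_irrefl by auto
    moreover have "{k. grevlex_less k m} \<subseteq> {k. grevlex_less k n}"
      using that grevlex_trans by blast
    ultimately show "{k. grevlex_less k m} \<subset> {k. grevlex_less k n}" by blast
  qed
  then show "{(m, n). grevlex_less m n} \<subseteq> measure ?c" by auto
qed simp

lemma grevlex_greatest_exists:
  assumes "finite S" "S \<noteq> {}"
  shows "\<exists>m\<in>S. \<forall>n\<in>S. n \<noteq> m \<longrightarrow> grevlex_less n m"
  using assms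
proof (induction S rule: finite_ne_induct)
  case (insert x S)
  then obtain m where m: "m \<in> S" "\<forall>n\<in>S. n \<noteq> m \<longrightarrow> grevlex_less n m" by blast
  show ?case
  proof (cases "grevlex_less m x")
    case True
    then show ?thesis using m grevlex_trans[of _ m x] by (metis insert_iff)
  next
    case False
    then show ?thesis using m grevlex_total[of m x] by (metis insert_iff)
  qed
qed simp

lemma lead_exp_eqI:
  assumes "m \<in> Poly_Mapping.keys f" "\<And>n. n \<in> Poly_Mapping.keys f \<Longrightarrow> n \<noteq> m \<Longrightarrow> grevlex_less n m"
  shows "lead_exp f = m"
  unfolding lead_exp_def
proof (rule the_equality)
  fix k assume k: "k \<in> Poly_Mapping.keys f \<and> (\<forall>n\<in>Poly_Mapping.keys f. n \<noteq> k \<longrightarrow> grevlex_less n k)"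
  show "k = m"
  proof (rule ccontr)
    assume "k \<noteq> m"
    then have "grevlex_less k m" "grevlex_less m k" using k assms by auto
    then show False using grevlex_asym by blast
  qed
qed (use assms in blast)

lemma lead_exp_greatest:
  assumes "f \<noteq> 0"
  shows "lead_exp f \<in> Poly_Mapping.keys f"
    and "n \<in> Poly_Mapping.keys f \<Longrightarrow> n \<noteq> lead_exp f \<Longrightarrow> grevlex_less n (lead_exp f)"
proof -
  have "Poly_Mapping.keys f \<noteq> {}" using assms by simp
  then obtain m where m: "m \<in> Poly_Mapping.keys f" "\<forall>n\<in>Poly_Mapping.keys f. n \<noteq> m \<longrightarrow> grevlex_less n m"
    using grevlex_greatest_exists[of "Poly_Mapping.keys f"] by auto
  then have "lead_exp f = m" by (intro lead_exp_eqI) auto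
  then show "lead_exp f \<in> Poly_Mapping.keys f"
    "n \<in> Poly_Mapping.keys f \<Longrightarrow> n \<noteq> lead_exp f \<Longrightarrow> grevlex_less n (lead_exp f)"
    using m by auto
qed

abbreviation lead_coef :: "('v::linorder, 'a::zero) mpoly \<Rightarrow> 'a" where
  "lead_coef f \<equiv> Poly_Mapping.lookup f (lead_exp f)"

lemma lead_coef_nz: "f \<noteq> 0 \<Longrightarrow> lead_coef f \<noteq> 0"
  using lead_exp_greatest(1) by (auto simp: in_keys_iff)

text \<open>The tails that may stand behind a lead term at \<open>m\<close>.\<close>

definition below :: "'v::linorder mono \<Rightarrow> ('v, 'a::zero) mpoly \<Rightarrow> bool" where
  "below m r \<longleftrightarrow> (\<forall>k\<in>Poly_Mapping.keys r. grevlex_less k m)"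

lemma below_lookup: "below m r \<Longrightarrow> Poly_Mapping.lookup r m = 0"
  using grevlex_irrefl[of m] unfolding below_def not_in_keys_iff_lookup_eq_zero[symmetric] by blast

lemma below_add: "below m r \<Longrightarrow> below m s \<Longrightarrow> below m (r + s)"
  using keys_add[of r s] by (auto simp: below_def)

lemma below_lead: "below m r \<Longrightarrow> r \<noteq> 0 \<Longrightarrow> grevlex_less (lead_exp r) m"
  using lead_exp_greatest(1) by (auto simp: below_def)

lemma lead_split:
  fixes f :: "('v::linorder, 'a::ab_group_add) mpoly"
  assumes "f \<noteq> 0"
  obtains r where "f = Poly_Mapping.single (lead_exp f) (lead_coef f) + r" "below (lead_exp f) r"
proof
  let ?r = "f - Poly_Mapping.single (lead_exp f) (lead_coef f)"
  show "f = Poly_Mapping.single (lead_exp f) (lead_coef f) + ?r" by simp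
  show "below (lead_exp f) ?r"
    unfolding below_def
  proof
    fix k assume "k \<in> Poly_Mapping.keys ?r"
    then have "k \<noteq> lead_exp f \<and> k \<in> Poly_Mapping.keys f"
      by (auto simp: in_keys_iff lookup_minus lookup_single when_def split: if_splits)
    then show "grevlex_less k (lead_exp f)" using lead_exp_greatest(2)[OF assms] by auto
  qed
qed

lemma lead_unsplit:
  fixes r :: "('v::linorder, 'a::ab_group_add) mpoly"
  assumes "c \<noteq> 0" "below m r"
  shows "Poly_Mapping.single m c + r \<noteq> 0" (is "?f \<noteq> 0")
    and "lead_exp (Poly_Mapping.single m c + r) = m"
    and "Poly_Mapping.lookup (Poly_Mapping.single m c + r) m = c"
proof -
  show c: "Poly_Mapping.lookup ?f m = c"
    using below_lookup[OF assms(2)] by (simp add: lookup_add)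
  then show "?f \<noteq> 0" using assms(1) by auto
  show "lead_exp ?f = m"
  proof (rule lead_exp_eqI)
    show "m \<in> Poly_Mapping.keys ?f" using c assms(1) by (simp add: in_keys_iff)
    fix n assume "n \<in> Poly_Mapping.keys ?f" "n \<noteq> m"
    then have "n \<in> Poly_Mapping.keys r" by (auto simp: in_keys_iff lookup_add lookup_single when_def)
    then show "grevlex_less n m" using assms(2) by (auto simp: below_def)
  qed
qed

lemma lead_mult:
  fixes f g :: "('v::linorder, 'a::idom) mpoly"
  assumes "f \<noteq> 0" "g \<noteq> 0"
  shows "f * g \<noteq> 0" "lead_exp (f * g) = lead_exp f + lead_exp g"
    "lead_coef (f * g) = lead_coef f * lead_coef g"
proof -
  obtain r where r: "f = Poly_Mapping.single (lead_exp f) (lead_coef f) + r" "below (lead_exp f) r"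
    using lead_split[OF assms(1)] .
  obtain s where s: "g = Poly_Mapping.single (lead_exp g) (lead_coef g) + s" "below (lead_exp g) s"
    using lead_split[OF assms(2)] .
  let ?m = "lead_exp f + lead_exp g"
  let ?t = "Poly_Mapping.single (lead_exp f) (lead_coef f) * s + r * g"
  have g: "k = lead_exp g \<or> grevlex_less k (lead_exp g)" if "k \<in> Poly_Mapping.keys g" for k
    using lead_exp_greatest(2)[OF assms(2) that] by blast
  have "below ?m (Poly_Mapping.single (lead_exp f) (lead_coef f) * s)"
    using keys_mult[of "Poly_Mapping.single (lead_exp f) (lead_coef f)" s] s(2)
    by (fastforce simp: below_def intro: grevlex_add_left split: if_splits)
  moreover have "below ?m (r * g)"
    unfolding below_def
  proof
    fix k assume "k \<in> Poly_Mapping.keys (r * g)"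
    then obtain a b where k: "k = a + b" "a \<in> Poly_Mapping.keys r" "b \<in> Poly_Mapping.keys g"
      using keys_mult[of r g] by blast
    have "grevlex_less (a + b) (lead_exp f + b)"
      using k r(2) by (auto simp: below_def intro: grevlex_add_right)
    then show "grevlex_less k ?m"
      using g[OF k(3)] k(1) grevlex_add_left grevlex_trans by metis
  qed
  ultimately have t: "below ?m ?t" by (rule below_add)
  have "f * g = Poly_Mapping.single (lead_exp f) (lead_coef f) *
      (Poly_Mapping.single (lead_exp g) (lead_coef g) + s) + r * g"
    by (metis r(1) s(1) distrib_right)
  then have fg: "f * g = Poly_Mapping.single ?m (lead_coef f * lead_coef g) + ?t"
    by (simp add: distrib_left mult_single add.assoc)
  have nz: "lead_coef f * lead_coef g \<noteq> 0"
    using lead_coef_nz assms by auto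
  show "f * g \<noteq> 0" using lead_unsplit(1)[OF nz t] fg by simp
  show "lead_exp (f * g) = ?m" using lead_unsplit(2)[OF nz t] fg by simp
  then show "lead_coef (f * g) = lead_coef f * lead_coef g"
    using lead_unsplit(3)[OF nz t] fg by simp
qed

lemma lead_single: "c \<noteq> 0 \<Longrightarrow> lead_exp (Poly_Mapping.single m c) = m"
  by (rule lead_exp_eqI) auto

lemma lead_1 [simp]: "lead_exp (1 :: ('v::linorder, 'a::zero_neq_one) mpoly) = 0"
  by (rule lead_exp_eqI) auto

lemma lead_Var [simp]:
  "lead_exp (Var v :: ('v::linorder, 'a::zero_neq_one) mpoly) = Poly_Mapping.single v 1"
  by (simp add: Var_def lead_single)

lemma Const_eq_0_iff [simp]: "Const c = 0 \<longleftrightarrow> c = 0"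
  unfolding Const_def by (metis lookup_single_eq lookup_zero single_zero)

lemma Var_nz [simp]: "(Var v :: ('v, 'a::zero_neq_one) mpoly) \<noteq> 0"
  unfolding Var_def by (metis lookup_single_eq lookup_zero zero_neq_one)

lemma lead_Const_mult:
  fixes f :: "('v::linorder, 'a::idom) mpoly"
  shows "c \<noteq> 0 \<Longrightarrow> f \<noteq> 0 \<Longrightarrow> lead_exp (Const c * f) = lead_exp f"
  by (simp add: lead_mult) (simp add: Const_def lead_single)

lemma lookup_Const_mult: "Poly_Mapping.lookup (Const c * f) k = c * Poly_Mapping.lookup f k"
proof (induction f rule: poly_mapping_induct_single)
  case (single m a)
  show ?case by (simp add: Const_def mult_single lookup_single when_def)
qed (simp_all add: lookup_add distrib_left)

lemma lookup_lead_power: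
  fixes f :: "('v::linorder, 'a::idom) mpoly"
  assumes "f \<noteq> 0"
  shows "f ^ n \<noteq> 0 \<and> Poly_Mapping.lookup (lead_exp (f ^ n)) v = n * Poly_Mapping.lookup (lead_exp f) v"
  by (induction n) (auto simp: lead_mult assms lookup_add)

lemma lead_prod:
  fixes f :: "'i \<Rightarrow> ('v::linorder, 'a::idom) mpoly"
  assumes "\<And>i. i \<in> S \<Longrightarrow> f i \<noteq> 0" "finite S"
  shows "prod f S \<noteq> 0 \<and> Poly_Mapping.lookup (lead_exp (prod f S)) v = (\<Sum>i\<in>S. Poly_Mapping.lookup (lead_exp (f i)) v)"
  using assms(2,1)
  by (induction S rule: finite_induct) (auto simp: lead_mult lookup_add)

lemma LT_eq_0_iff: "LT f = 0 \<longleftrightarrow> f = 0"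
  for f :: "('v::linorder, 'a::ab_group_add) mpoly"
  unfolding LT_def
  by (metis lead_coef_nz lookup_single_eq lookup_zero single_zero)

lemma LT_eqD:
  fixes f g :: "('v::linorder, 'a::ab_group_add) mpoly"
  assumes "LT f = LT g" "f \<noteq> 0"
  shows "g \<noteq> 0" "lead_exp f = lead_exp g" "below (lead_exp f) (f - g)"
proof -
  show g: "g \<noteq> 0" using assms LT_eq_0_iff by metis
  have "Poly_Mapping.keys (LT f) = {lead_exp f}" "Poly_Mapping.keys (LT g) = {lead_exp g}"
    using assms(2) g lead_coef_nz by (auto simp: LT_def)
  then show e: "lead_exp f = lead_exp g" using assms(1) by simp
  obtain r where r: "f = LT f + r" "below (lead_exp f) r" using lead_split[OF assms(2)] LT_def by metis
  obtain s where s: "g = LT g + s" "below (lead_exp g) s" using lead_split[OF g] LT_def by metis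
  have "f - g = r - s" using r(1) s(1) assms(1) by (metis add_diff_cancel_left)
  moreover have "below (lead_exp f) (- s)"
    using s(2) e by (simp add: below_def in_keys_iff)
  ultimately show "below (lead_exp f) (f - g)"
    using below_add[OF r(2)] by (metis diff_conv_add_uminus)
qed

text \<open>No cancellation can occur at the greatest of several distinct lead monomials.\<close>

lemma distinct_leads:
  fixes b :: "'i \<Rightarrow> ('v::linorder, 'a::idom) mpoly"
  assumes nz: "\<And>K. fam_prod b K \<noteq> 0"
    and inj: "inj_on (\<lambda>K. lead_exp (fam_prod b K)) (Poly_Mapping.keys P)" and "P \<noteq> 0"
  shows "subst b P \<noteq> 0" "\<exists>K\<in>Poly_Mapping.keys P. lead_exp (subst b P) = lead_exp (fam_prod b K)"
proof -
  let ?l = "\<lambda>K. lead_exp (fam_prod b K)"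
  have "Poly_Mapping.keys P \<noteq> {}" using \<open>P \<noteq> 0\<close> by simp
  then obtain K where K: "K \<in> Poly_Mapping.keys P"
      "\<forall>n\<in>?l ` Poly_Mapping.keys P. n \<noteq> ?l K \<longrightarrow> grevlex_less n (?l K)"
    using grevlex_greatest_exists[of "?l ` Poly_Mapping.keys P"] by auto
  have le: "m = ?l J \<or> grevlex_less m (?l J)" if "Poly_Mapping.lookup (fam_prod b J) m \<noteq> 0" for J m
    using that lead_exp_greatest(2)[OF nz] by (auto simp: in_keys_iff)
  have lk: "Poly_Mapping.lookup (subst b P) m =
      (\<Sum>J\<in>Poly_Mapping.keys P. Poly_Mapping.lookup P J * Poly_Mapping.lookup (fam_prod b J) m)" for m
    by (simp add: subst_def lookup_sum lookup_Const_mult)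
  have other: "Poly_Mapping.lookup (fam_prod b J) (?l K) = 0"
    if "J \<in> Poly_Mapping.keys P" "J \<noteq> K" for J
  proof (rule ccontr)
    assume "Poly_Mapping.lookup (fam_prod b J) (?l K) \<noteq> 0"
    from le[OF this] have "grevlex_less (?l K) (?l J)"
      using that K(1) inj unfolding inj_on_def by metis
    moreover have "?l J = ?l K \<or> grevlex_less (?l J) (?l K)" using K(2) that(1) by blast
    ultimately show False using grevlex_asym[of "?l K" "?l J"] grevlex_irrefl[of "?l K"] by auto
  qed
  have "Poly_Mapping.lookup (subst b P) (?l K) = Poly_Mapping.lookup P K * lead_coef (fam_prod b K)"
    unfolding lk by (subst sum.remove[of _ K]) (auto simp: K other)
  then have nzK: "Poly_Mapping.lookup (subst b P) (?l K) \<noteq> 0"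
    using K(1) lead_coef_nz[OF nz] by (simp add: in_keys_iff)
  then show "subst b P \<noteq> 0" by auto
  have "lead_exp (subst b P) = ?l K"
  proof (rule lead_exp_eqI)
    show "?l K \<in> Poly_Mapping.keys (subst b P)" using nzK by (simp add: in_keys_iff)
    fix m assume "m \<in> Poly_Mapping.keys (subst b P)" and ne: "m \<noteq> ?l K"
    then obtain J where J: "J \<in> Poly_Mapping.keys P" "Poly_Mapping.lookup (fam_prod b J) m \<noteq> 0"
      using lk[of m] by (metis (no_types, lifting) in_keys_iff mult_zero_right sum.neutral)
    have "?l J = ?l K \<or> grevlex_less (?l J) (?l K)" using K(2) J(1) by blast
    with le[OF J(2)] ne show "grevlex_less m (?l K)"
      using grevlex_trans[of m "?l J" "?l K"] by fastforce
  qed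
  then show "\<exists>K\<in>Poly_Mapping.keys P. lead_exp (subst b P) = ?l K" using K(1) by blast
qed

section \<open>Subalgebras with prescribed lead monomials\<close>

lemma subalgebra_range_subst: "is_subalgebra (range (subst b))"
proof -
  have "Const c \<in> range (subst b)" for c
    using subst_Const[of b c] by (metis rangeI)
  moreover have "f + g \<in> range (subst b)" "f * g \<in> range (subst b)"
    if "f \<in> range (subst b)" "g \<in> range (subst b)" for f g
    using that subst.add[of b] subst.mult[of b] by (metis (no_types, lifting) rangeE rangeI)+
  ultimately show ?thesis by (auto simp: is_subalgebra_def)
qed

lemma subalgebra_power: "is_subalgebra T \<Longrightarrow> f \<in> T \<Longrightarrow> f ^ n \<in> T"
proof (induction n)
  case 0
  then show ?case using Const.one unfolding is_subalgebra_def by (metis power_0 rangeI subsetD)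
qed (simp add: is_subalgebra_def)

lemma subalgebra_Const_mult: "is_subalgebra T \<Longrightarrow> f \<in> T \<Longrightarrow> Const c * f \<in> T"
  unfolding is_subalgebra_def by (meson rangeI subsetD)

lemma subalgebra_0: "is_subalgebra T \<Longrightarrow> 0 \<in> T"
  using Const.zero unfolding is_subalgebra_def by (metis rangeI subsetD)

lemma subalgebra_sum: "is_subalgebra T \<Longrightarrow> (\<And>i. i \<in> S \<Longrightarrow> f i \<in> T) \<Longrightarrow> sum f S \<in> T"
  by (induction S rule: infinite_finite_induct) (simp_all add: subalgebra_0, simp add: is_subalgebra_def)

lemma subalgebra_prod: "is_subalgebra T \<Longrightarrow> (\<And>i. i \<in> S \<Longrightarrow> f i \<in> T) \<Longrightarrow> prod f S \<in> T"
proof (induction S rule: infinite_finite_induct)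
  case (insert x F)
  then show ?case by (simp add: is_subalgebra_def)
qed (use subalgebra_power[of T _ 0] subalgebra_0 in \<open>metis power_0 prod.infinite prod.empty\<close>)+

lemma LM_mult:
  fixes f g :: "('v::linorder, 'a::field) mpoly"
  shows "f \<noteq> 0 \<Longrightarrow> g \<noteq> 0 \<Longrightarrow> LM (f * g) = LM f * LM g"
  by (simp add: LM_def lead_mult mult_single)

lemma linear_span_is_subalgebra:
  fixes S :: "('v, 'a::field) mpoly set"
  assumes "1 \<in> S" "\<And>f g. f \<in> S \<Longrightarrow> g \<in> S \<Longrightarrow> f * g \<in> S"
  shows "is_subalgebra (linear_span S)"
proof -
  interpret vs: vector_space "\<lambda>(c::'a) (f :: ('v, 'a) mpoly). Const c * f"
    by (rule vector_space_mpoly)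
  have "Const c \<in> linear_span S" for c
    using vs.span_scale[OF vs.span_base[OF assms(1)], of c] by simp
  moreover have "f * g \<in> linear_span S" if "f \<in> linear_span S" "g \<in> linear_span S" for f g
    using that(1)
  proof (induction rule: vs.span_induct_alt)
    case base then show ?case by (simp add: vs.span_zero)
  next
    case (step c x y)
    have "x * g \<in> linear_span S"
      using that(2)
    proof (induction rule: vs.span_induct_alt)
      case base then show ?case by (simp add: vs.span_zero)
    next
      case (step d z w)
      have "Const d * (x * z) + x * w \<in> linear_span S"
        using step(1,2) assms(2) \<open>x \<in> S\<close>
        by (intro vs.span_add[OF vs.span_scale[OF vs.span_base]]) auto
      then show ?case by (simp add: algebra_simps)
    qed
    then have "Const c * (x * g) + y * g \<in> linear_span S"
      using step(2) by (intro vs.span_add[OF vs.span_scale])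
    then show ?case by (simp add: algebra_simps)
  qed
  ultimately show ?thesis by (auto simp: is_subalgebra_def vs.span_add)
qed

lemma hull_is_subalgebra: "is_subalgebra (is_subalgebra hull S)"
  unfolding hull_def is_subalgebra_def by auto

lemma LT_Const_mult_fam:
  fixes b :: "'i \<Rightarrow> ('v::linorder, 'a::field) mpoly"
  assumes "g \<noteq> 0" "LT g = LT (Const d * fam_prod b K)"
  shows "d \<noteq> 0" "lead_exp g = lead_exp (fam_prod b K)"
    "below (lead_exp g) (g - Const d * fam_prod b K)"
proof -
  have nz: "Const d * fam_prod b K \<noteq> 0" using LT_eqD(1)[OF assms(2,1)] .
  then show "d \<noteq> 0" by auto
  then show "lead_exp g = lead_exp (fam_prod b K)"
    using LT_eqD(2)[OF assms(2,1)] nz by (auto simp: lead_Const_mult)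
  show "below (lead_exp g) (g - Const d * fam_prod b K)"
    using LT_eqD(3)[OF assms(2,1)] .
qed

lemma subducts_sum: "subducts b f Q g \<Longrightarrow> f = subst b Q + g"
  by (induction rule: subducts.induct) (simp_all add: subst.simps subst_single)

text \<open>Subduction only descends: this is what makes the two products of a tete-a-tete exceed every product
that is subtracted afterwards.\<close>

lemma subducts_below:
  fixes b :: "'i \<Rightarrow> ('v::linorder, 'a::field) mpoly"
  assumes "subducts b f Q g" "below m f"
  shows "below m g \<and> (\<forall>K\<in>Poly_Mapping.keys Q. grevlex_less (lead_exp (fam_prod b K)) m)"
  using assms
proof (induction rule: subducts.induct)
  case (cancel Q g d K)
  note lt = LT_Const_mult_fam[OF cancel.hyps(2,3)]
  have g: "grevlex_less (lead_exp g) m"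
    using cancel by (auto intro: below_lead)
  then have "below m (g - Const d * fam_prod b K)"
    using lt(3) grevlex_trans unfolding below_def by blast
  moreover have "grevlex_less (lead_exp (fam_prod b L)) m"
    if "L \<in> Poly_Mapping.keys (Q + Poly_Mapping.single K d)" for L
  proof -
    have "L \<in> Poly_Mapping.keys Q \<or> L = K"
      using that keys_add[of Q "Poly_Mapping.single K d"] by (auto split: if_splits)
    then show ?thesis using cancel g lt(2) by auto
  qed
  ultimately show ?case by blast
qed simp

text \<open>The abstract core: products of members of the family \<open>b\<close> in \<open>A\<close> account for all lead monomials of
\<open>A\<close>. Everything claimed about generators, subduction and relations is derived from this.\<close>

context
  fixes b :: "'i \<Rightarrow> ('v::{finite,linorder}, 'a::field) mpoly" and A :: "('v, 'a) mpoly set"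
  assumes A: "is_subalgebra A" and bA: "\<And>i. b i \<in> A" and b_nz: "\<And>i. b i \<noteq> 0"
    and leads: "\<And>f. f \<in> A \<Longrightarrow> f \<noteq> 0 \<Longrightarrow> \<exists>K. lead_exp f = lead_exp (fam_prod b K)"
begin

lemma fam_prod_nz: "fam_prod b K \<noteq> 0"
  using b_nz by (simp add: fam_prod_def)

lemma fam_prod_mem: "fam_prod b K \<in> A"
  unfolding fam_prod_def by (intro subalgebra_prod subalgebra_power A bA)

lemma A_add: "f \<in> A \<Longrightarrow> g \<in> A \<Longrightarrow> f + g \<in> A"
  using A by (simp add: is_subalgebra_def)

lemma A_scale: "f \<in> A \<Longrightarrow> Const c * f \<in> A"
  by (rule subalgebra_Const_mult[OF A])

lemma A_diff: "f \<in> A \<Longrightarrow> g \<in> A \<Longrightarrow> f - Const c * g \<in> A"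
  using A_add[OF _ A_scale, of f g "- c"] by (simp add: Const.simps)

lemma subst_mem: "subst b P \<in> A"
proof (induction P rule: poly_mapping_induct_single)
  case zero
  show ?case using A_scale[OF fam_prod_mem, of 0] by (simp add: subst.zero Const.zero)
qed (simp_all add: subst_single subst_add A_add A_scale fam_prod_mem)

lemma cancel_lead:
  assumes "g \<in> A" "g \<noteq> 0"
  obtains d K where "LT g = LT (Const d * fam_prod b K)"
proof -
  obtain K where K: "lead_exp g = lead_exp (fam_prod b K)" using leads assms by blast
  \<comment> \<open>the scalar that makes the lead coefficients agree\<close>
  let ?d = "lead_coef g / lead_coef (fam_prod b K)"
  have d: "?d \<noteq> 0" using assms fam_prod_nz by (simp add: lead_coef_nz)
  have "lead_coef g = ?d * lead_coef (fam_prod b K)"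
    using fam_prod_nz by (simp add: lead_coef_nz)
  then have "LT g = LT (Const ?d * fam_prod b K)"
    unfolding LT_def lead_Const_mult[OF d fam_prod_nz] using K by (simp add: lookup_Const_mult)
  then show ?thesis by (rule that)
qed

text \<open>Each cancellation lowers the lead exponent, and the remainder stays in \<open>A\<close>, where lead monomials are
again products of lead monomials of the family.\<close>

lemma subduction_terminates:
  assumes "subducts b f Q g" "g \<in> A"
  shows "\<exists>Q. subducts b f Q 0"
  using assms
proof (induction "lead_exp g" arbitrary: g Q rule: wf_induct_rule[OF wf_grevlex])
  case 1
  show ?case
  proof (cases "g = 0")
    case False
    obtain d K where dK: "LT g = LT (Const d * fam_prod b K)"
      using cancel_lead[OF 1(3) False] .
    let ?g = "g - Const d * fam_prod b K"
    have s: "subducts b f (Q + Poly_Mapping.single K d) ?g"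
      by (rule subducts.cancel[OF 1(2) False dK])
    have m: "?g \<in> A" by (rule A_diff[OF 1(3) fam_prod_mem])
    show ?thesis
    proof (cases "?g = 0")
      case True then show ?thesis using s by auto
    next
      case nz: False
      then have "grevlex_less (lead_exp ?g) (lead_exp g)"
        using LT_Const_mult_fam(3)[OF False dK] below_lead by blast
      then show ?thesis using 1(1)[OF _ s m] by simp
    qed
  qed (use 1 in auto)
qed

lemma range_subst: "range (subst b) = A"
proof
  show "range (subst b) \<subseteq> A" using subst_mem by auto
  show "A \<subseteq> range (subst b)"
  proof
    fix f assume "f \<in> A"
    then obtain Q where "subducts b f Q 0" using subduction_terminates[OF subducts.start] by blast
    from subducts_sum[OF this] show "f \<in> range (subst b)" by auto
  qed
qed

lemma sagbi_basis:
  assumes "finite (range b)"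
  shows "is_sagbi_basis (range b) A"
proof -
  interpret vs: vector_space "\<lambda>(c::'a) (f :: ('v, 'a) mpoly). Const c * f"
    by (rule vector_space_mpoly)
  let ?L = "LM ` (A - {0})" and ?H = "is_subalgebra hull (LM ` (range b - {0}))"
  have "1 \<in> A - {0}" using fam_prod_mem[of 0] by simp
  then have "LM 1 \<in> ?L" by (rule imageI)
  then have one: "1 \<in> ?L" by (simp add: LM_def)
  have mul: "f * g \<in> ?L" if fg: "f \<in> ?L" "g \<in> ?L" for f g
  proof -
    obtain f' g' where f': "f' \<in> A - {0}" "f = LM f'" and g': "g' \<in> A - {0}" "g = LM g'"
      using fg by auto
    have "f' * g' \<in> A - {0}" using f' g' A by (auto simp: is_subalgebra_def)
    then show ?thesis using f' g' LM_mult[of f' g'] by (metis DiffD2 image_eqI insertCI)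
  qed
  have H: "is_subalgebra ?H" by (rule hull_is_subalgebra)
  have "is_subalgebra (linear_span ?L)"
    by (rule linear_span_is_subalgebra) (use one mul in auto)
  moreover have "LM ` (range b - {0}) \<subseteq> linear_span ?L"
    using bA by (intro order_trans[OF _ vs.span_superset] image_mono) auto
  ultimately have "?H \<subseteq> linear_span ?L" by (intro hull_minimal)
  moreover have "linear_span ?L \<subseteq> ?H"
  proof (rule vs.span_minimal)
    have C_H: "Const c \<in> ?H" for c using H unfolding is_subalgebra_def by blast
    have add_H: "x + y \<in> ?H" and mult_H: "x * y \<in> ?H" if "x \<in> ?H" "y \<in> ?H" for x y
      using H that unfolding is_subalgebra_def by blast+
    show "vs.subspace ?H"
      unfolding vs.subspace_def using C_H[of 0] by (auto simp: Const.zero intro: add_H mult_H[OF C_H])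
    have one_H: "1 \<in> ?H" using C_H[of 1] by (simp add: Const.one)
    have b_H: "LM (b i) \<in> ?H" for i
      using hull_subset[of "LM ` (range b - {0})" is_subalgebra] b_nz by auto
    have mul_H: "LM f \<in> ?H \<Longrightarrow> LM g \<in> ?H \<Longrightarrow> f \<noteq> 0 \<Longrightarrow> g \<noteq> 0 \<Longrightarrow> LM (f * g) \<in> ?H"
      for f g :: "('v, 'a) mpoly"
      by (simp add: LM_mult mult_H)
    have LM_1: "LM 1 = (1 :: ('v, 'a) mpoly)" by (simp add: LM_def)
    have pw: "LM (b i ^ n) \<in> ?H" for i n
      by (induction n) (auto simp: LM_1 one_H b_nz intro!: mul_H b_H)
    have "LM (\<Prod>i\<in>S. b i ^ Poly_Mapping.lookup K i) \<in> ?H" if "finite S" for S K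
      using that
      by (induction S rule: finite_induct) (auto simp: LM_1 one_H b_nz intro!: mul_H pw)
    then have fam: "LM (fam_prod b K) \<in> ?H" for K by (simp add: fam_prod_def)
    show "?L \<subseteq> ?H"
    proof
      fix m assume "m \<in> ?L"
      then obtain f where "f \<in> A" "f \<noteq> 0" "m = LM f" by auto
      then show "m \<in> ?H" using leads[of f] fam by (auto simp: LM_def)
    qed
  qed
  ultimately show ?thesis
    using A bA assms by (auto simp: is_sagbi_basis_def)
qed

lemma tete_a_tete_subduction:
  assumes "lead_exp (fam_prod b I) = lead_exp (fam_prod b J)"
  shows "is_tete_a_tete b I J" "\<exists>R. subduction_relation b I J R"
proof -
  show "is_tete_a_tete b I J" using assms by (simp add: is_tete_a_tete_def LM_def)
  let ?c = "lead_coef (fam_prod b I) / lead_coef (fam_prod b J)"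
  have c: "?c \<noteq> 0" using fam_prod_nz by (simp add: lead_coef_nz)
  have "lead_coef (fam_prod b I) = ?c * lead_coef (fam_prod b J)"
    using fam_prod_nz by (simp add: lead_coef_nz)
  then have LT: "LT (fam_prod b I) = LT (Const ?c * fam_prod b J)"
    unfolding LT_def lead_Const_mult[OF c fam_prod_nz] using assms by (simp add: lookup_Const_mult)
  obtain Q where "subducts b (fam_prod b I - Const ?c * fam_prod b J) Q 0"
    using subduction_terminates[OF subducts.start A_diff[OF fam_prod_mem fam_prod_mem]] by blast
  with LT show "\<exists>R. subduction_relation b I J R"
    unfolding subduction_relation_def by blast
qed

text \<open>The relation has the shape \<open>b\<^sub>g\<^sup>n = c b\<^sup>J + \<dots>\<close> with smaller products in the dots, so it can be used
to rewrite every monomial with \<open>g\<close>-exponent at least \<open>n\<close>. Rewriting terminates because it lowers the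
lead exponent of the product, or keeps it and lowers the \<open>g\<close>-exponent (as \<open>g\<close> does not occur in \<open>J\<close>).
What remains of an element of the kernel is then zero by \<open>distinct_leads\<close>.\<close>

lemma relation_ideal_principal:
  assumes rel: "subduction_relation b (Poly_Mapping.single g n) J R"
    and "n > 0" and J: "Poly_Mapping.lookup J g = 0"
    and inj: "inj_on (\<lambda>K. lead_exp (fam_prod b K)) {K. Poly_Mapping.lookup K g < n}"
  shows "is_hypersurface_with A b R"
proof -
  let ?I = "Poly_Mapping.single g n" and ?l = "\<lambda>K. lead_exp (fam_prod b K)"
  obtain c Q where LT: "LT (fam_prod b ?I) = LT (Const c * fam_prod b J)"
    and Q: "subducts b (fam_prod b ?I - Const c * fam_prod b J) Q 0"
    and R: "R = Poly_Mapping.single ?I 1 - Poly_Mapping.single J c - Q"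
    using rel unfolding subduction_relation_def by blast
  note lt = LT_Const_mult_fam[OF fam_prod_nz LT]
  have Q_less: "grevlex_less (?l K) (?l ?I)" if "K \<in> Poly_Mapping.keys Q" for K
    using subducts_below[OF Q lt(3)] that by blast
  have R0: "subst b R = 0"
    using subducts_sum[OF Q] by (simp add: R subst.simps subst_single Const.one)
  have l_add: "?l (K + L) = ?l K + ?l L" for K L
    by (simp add: fam_prod_add lead_mult fam_prod_nz)
  define normal where "normal P \<longleftrightarrow> (\<forall>K\<in>Poly_Mapping.keys P. Poly_Mapping.lookup K g < n)"
    for P :: "('i, 'a) mpoly"
  have normal_add: "normal (P + P')" if "normal P" "normal P'" for P P'
    using that keys_add[of P P'] by (auto simp: normal_def)
  have normal_scale: "normal (Const a * P)" if "normal P" for a P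
    using that by (auto simp: normal_def in_keys_iff lookup_Const_mult)
  define red where "red P \<longleftrightarrow> (\<exists>P' S. P = R * S + P' \<and> normal P')" for P
  have red_add: "red (P + P')" if "red P" "red P'" for P P'
  proof -
    from that obtain N S N' S' where "P = R * S + N" "normal N" "P' = R * S' + N'" "normal N'"
      unfolding red_def by blast
    then have "P + P' = R * (S + S') + (N + N') \<and> normal (N + N')"
      by (auto simp: algebra_simps normal_add)
    then show ?thesis unfolding red_def by blast
  qed
  have red_scale: "red (Const a * P)" if "red P" for a P
  proof -
    from that obtain N S where "P = R * S + N" "normal N"
      unfolding red_def by blast
    then have "Const a * P = R * (Const a * S) + Const a * N \<and> normal (Const a * N)"
      using normal_scale by (auto simp: algebra_simps)
    then show ?thesis unfolding red_def by blast
  qed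
  have red_0: "red 0" unfolding red_def by (intro exI[of _ 0]) (simp add: normal_def)
  have red_sum: "red (sum h T)" if "\<And>x. x \<in> T \<Longrightarrow> red (h x)" for h :: "'i mono \<Rightarrow> ('i, 'a) mpoly" and T
    using that by (induction T rule: infinite_finite_induct) (auto simp: red_0 red_add)
  have red_R: "red (R * S)" for S
    unfolding red_def by (rule exI[of _ 0], rule exI[of _ S], simp add: normal_def)
  let ?rel = "inv_image ({(m, m'). grevlex_less m m'} <*lex*> less_than)
      (\<lambda>K. (?l K, Poly_Mapping.lookup K g))"
  have wf: "wf ?rel" by (intro wf_inv_image wf_lex_prod wf_grevlex wf_less_than)
  have red_single: "red (Poly_Mapping.single K 1)" for K
  proof (induction K rule: wf_induct_rule[OF wf])
    case (1 K)
    show ?case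
    proof (cases "Poly_Mapping.lookup K g < n")
      case True
      then have "Poly_Mapping.single K 1 = R * 0 + Poly_Mapping.single K 1
          \<and> normal (Poly_Mapping.single K 1)"
        by (simp add: normal_def)
      then show ?thesis unfolding red_def by blast
    next
      case False
      define K' where "K' = K - ?I"
      have K: "K = K' + ?I"
        using False by (intro poly_mapping_eqI) (auto simp: K'_def lookup_add lookup_minus lookup_single when_def)
      have sc: "red (Poly_Mapping.single L a)" if "red (Poly_Mapping.single L 1)" for L a
        using red_scale[OF that, of a] by (simp add: Const_def mult_single)
      have redJ: "red (Poly_Mapping.single (K' + J) 1)"
        using \<open>n > 0\<close> J lt(2) by (intro 1) (auto simp: K l_add lookup_add)
      have redQ: "red (Poly_Mapping.single (K' + L) 1)" if "L \<in> Poly_Mapping.keys Q" for L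
        using Q_less[OF that] by (intro 1) (auto simp: K l_add intro: grevlex_add_left)
      have "Q = (\<Sum>L\<in>Poly_Mapping.keys Q. Poly_Mapping.single L (Poly_Mapping.lookup Q L))"
        by (rule poly_mapping_eqI) (simp add: lookup_sum lookup_single when_def in_keys_iff)
      then have sum: "Poly_Mapping.single K' 1 * Q =
          (\<Sum>L\<in>Poly_Mapping.keys Q. Poly_Mapping.single (K' + L) (Poly_Mapping.lookup Q L))"
        by (metis (no_types, lifting) sum_distrib_left mult_single mult_1 sum.cong)
      have "red (Poly_Mapping.single K' 1 * Q)"
        unfolding sum by (rule red_sum) (rule sc[OF redQ])
      moreover have "Poly_Mapping.single K 1 = R * Poly_Mapping.single K' 1
          + Poly_Mapping.single (K' + J) c + Poly_Mapping.single K' 1 * Q"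
        by (simp add: R K algebra_simps mult_single)
      ultimately show ?thesis
        using red_add[OF red_add[OF red_R[of "Poly_Mapping.single K' 1"] sc[OF redJ, of c]]] by metis
    qed
  qed
  have red_all: "red P" for P
  proof (induction P rule: poly_mapping_induct_single)
    case (single K a)
    show ?case using red_scale[OF red_single[of K], of a] by (simp add: Const_def mult_single)
  qed (simp_all add: red_0 red_add)
  have "P \<in> {R * S | S. True}" if "subst b P = 0" for P
  proof -
    obtain N S where P: "P = R * S + N" "normal N" using red_all[of P] unfolding red_def by blast
    have "subst b N = 0" using that P(1) R0 by (simp add: subst.simps)
    moreover have "inj_on ?l (Poly_Mapping.keys N)"
      using P(2) by (intro inj_on_subset[OF inj]) (auto simp: normal_def)
    ultimately have "N = 0" using distinct_leads(1)[OF fam_prod_nz] by blast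
    then show ?thesis using P(1) by auto
  qed
  moreover have "subst b (R * S) = 0" for S using R0 by (simp add: subst.simps)
  ultimately show ?thesis
    using range_subst by (auto simp: is_hypersurface_with_def)
qed

end

section \<open>What the minors say about the matrix\<close>

lemma det_4:
  "det (A::'a::comm_ring_1^4^4) =
    A$1$1 * (A$2$2 * (A$3$3 * A$4$4 - A$3$4 * A$4$3)
           - A$2$3 * (A$3$2 * A$4$4 - A$3$4 * A$4$2)
           + A$2$4 * (A$3$2 * A$4$3 - A$3$3 * A$4$2))
  - A$1$2 * (A$2$1 * (A$3$3 * A$4$4 - A$3$4 * A$4$3)
           - A$2$3 * (A$3$1 * A$4$4 - A$3$4 * A$4$1)
           + A$2$4 * (A$3$1 * A$4$3 - A$3$3 * A$4$1))
  + A$1$3 * (A$2$1 * (A$3$2 * A$4$4 - A$3$4 * A$4$2)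
           - A$2$2 * (A$3$1 * A$4$4 - A$3$4 * A$4$1)
           + A$2$4 * (A$3$1 * A$4$2 - A$3$2 * A$4$1))
  - A$1$4 * (A$2$1 * (A$3$2 * A$4$3 - A$3$3 * A$4$2)
           - A$2$2 * (A$3$1 * A$4$3 - A$3$3 * A$4$1)
           + A$2$3 * (A$3$1 * A$4$2 - A$3$2 * A$4$1))"
proof -
  have f: "finite {2::4, 3, 4}" "1 \<notin> {2::4, 3, 4}" "finite {3::4, 4}" "2 \<notin> {3::4, 4}"
    "finite {4::4}" "3 \<notin> {4::4}"
    by auto
  show ?thesis
    unfolding det_def UNIV_4
    unfolding sum_over_permutations_insert[OF f(1,2)]
    unfolding sum_over_permutations_insert[OF f(3,4)]
    unfolding sum_over_permutations_insert[OF f(5,6)]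
    unfolding permutes_sing
    by (simp add: sign_swap_id permutation_swap_id permutation_compose sign_compose sign_id
        swap_id_eq algebra_simps)
qed

lemma vector_4 [simp]:
  "(vector [a, b, c, d] :: 'a::zero^4) $ 1 = a" "(vector [a, b, c, d] :: 'a^4) $ 2 = b"
  "(vector [a, b, c, d] :: 'a^4) $ 3 = c" "(vector [a, b, c, d] :: 'a^4) $ 4 = d"
  unfolding vector_def by simp_all

lemma forall_4: "(\<forall>i::4. P i) \<longleftrightarrow> P 1 \<and> P 2 \<and> P 3 \<and> P 4"
  by (metis exhaust_4)

abbreviation rows4 :: "'a^4 \<Rightarrow> 'a^4 \<Rightarrow> 'a^4 \<Rightarrow> 'a^4 \<Rightarrow> 'a::field^4^4" where
  "rows4 a b c d \<equiv> vector [a, b, c, d]"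

lemma rows4_mult: "rows4 (a v* V) (b v* V) (c v* V) (d v* V) = rows4 a b c d ** V"
  by (simp add: vec_eq_iff forall_4 vector_matrix_mult_def matrix_matrix_mult_def mult.commute)

lemma Gamma_mat_rows:
  "Gamma_mat p M $ 1 = frob_row p M 1 0" "Gamma_mat p M $ 2 = frob_row p M 2 0"
  "Gamma_mat p M $ 3 = frob_row p M 1 1" "Gamma_mat p M $ 4 = frob_row p M 2 1"
  "Gamma_mat p M $ 5 = frob_row p M 1 2" "Gamma_mat p M $ 7 = frob_row p M 1 3"
  unfolding Gamma_mat_def vector_def by simp_all

definition moore :: "nat \<Rightarrow> 'a::field^4^2 \<Rightarrow> 'a^4^4" where
  "moore p M = rows4 (frob_row p M 1 0) (frob_row p M 1 1) (frob_row p M 1 2) (frob_row p M 1 3)"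

lemma det_moore: "gamma p M 1 3 5 7 = det (moore p M)"
  by (simp add: gamma_def moore_def Gamma_mat_rows)

lemma moore_row:
  "(vector [a, b, c, d] v* moore p M) $ j
    = a * M$1$j + b * (M$1$j) ^ p + c * (M$1$j) ^ p^2 + d * (M$1$j) ^ p^3"
  by (simp add: moore_def vector_matrix_mult_def sum_4 frob_row_def mult.commute)

lemma moore_span:
  assumes "gamma p M 1 3 5 7 \<noteq> 0"
  obtains a b c d where "\<And>j. w $ j = a * M$1$j + b * (M$1$j) ^ p + c * (M$1$j) ^ p^2 + d * (M$1$j) ^ p^3"
proof -
  obtain W where W: "W ** moore p M = mat 1"
    using assms invertible_det_nz[of "moore p M"] by (auto simp: det_moore invertible_left_inverse)
  define r where "r = w v* W"
  have "r v* moore p M = w"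
    by (simp add: r_def vector_matrix_mul_assoc W)
  moreover have "r = vector [r$1, r$2, r$3, r$4]" by (simp add: vec_eq_iff forall_4)
  ultimately show ?thesis using moore_row that by metis
qed

lemma moore_independent:
  assumes "gamma p M 1 3 5 7 \<noteq> 0"
    and "\<And>k. k < 4 \<Longrightarrow> (\<Sum>j\<in>UNIV. M$1$j ^ p^k * n $ j) = 0"
  shows "n = 0"
proof -
  obtain W where W: "W ** moore p M = mat 1"
    using assms invertible_det_nz[of "moore p M"] by (auto simp: det_moore invertible_left_inverse)
  have "moore p M *v n = 0"
    using assms(2)[of 0] assms(2)[of 1] assms(2)[of 2] assms(2)[of 3]
    by (simp add: vec_eq_iff forall_4 matrix_vector_mult_def moore_def frob_row_def)
  then show ?thesis
    using matrix_left_invertible_ker W by metis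
qed

text \<open>Expand the second row in the basis of Frobenius powers of the first. The minor with rows
\<open>1, 2, 3, 5\<close> is the last coefficient times the basis determinant. Once that coefficient vanishes, the
Frobenius map gives the expansion of the fourth row, and the minor with rows \<open>1, 2, 3, 4\<close> is the
basis determinant times, up to sign, the \<open>(p+1)\<close>-st power of the third coefficient. The two
remaining coefficients are quotients of minors.\<close>

lemma second_row_of_minors:
  fixes M :: "'a::field^4^2"
  assumes p: "prime p" "CHAR('a) = p"
    and g: "gamma p M 1 2 3 4 = 0" "gamma p M 1 2 3 5 = 0"
      "gamma p M 1 3 5 7 \<noteq> 0" "gamma p M 1 2 5 7 \<noteq> 0"
  obtains r s where "s \<noteq> 0" "\<And>j. M$2$j = r * M$1$j + s * (M$1$j) ^ p"
    "gamma p M 1 3 5 7 / gamma p M 1 2 5 7 = 1 / s"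
    "gamma p M 2 3 5 7 / gamma p M 1 2 5 7 = r / s"
proof -
  let ?V = "moore p M"
  obtain a b c d where abcd: "\<And>j. frob_row p M 2 0 $ j
      = a * M$1$j + b * (M$1$j) ^ p + c * (M$1$j) ^ p^2 + d * (M$1$j) ^ p^3"
    using moore_span[OF g(3)] by metis
  have row: "frob_row p M 2 0 = vector [a, b, c, d] v* ?V"
    by (simp only: vec_eq_iff moore_row) (use abcd in simp)
  have V: "frob_row p M 1 0 = vector [1, 0, 0, 0] v* ?V" "frob_row p M 1 1 = vector [0, 1, 0, 0] v* ?V"
    "frob_row p M 1 2 = vector [0, 0, 1, 0] v* ?V" "frob_row p M 1 3 = vector [0, 0, 0, 1] v* ?V"
    by (simp_all only: vec_eq_iff moore_row) (simp_all add: frob_row_def)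
  have D: "det ?V \<noteq> 0" using g(3) by (simp add: det_moore)
  have "gamma p M 1 2 3 5 = d * det ?V"
    unfolding gamma_def Gamma_mat_rows row V rows4_mult det_mul by (simp add: det_4)
  then have d: "d = 0" using g(2) D by simp
  have "frob_row p M 2 1 $ j = (vector [0, a ^ p, b ^ p, c ^ p] v* ?V) $ j" for j
  proof -
    have "frob_row p M 2 1 $ j = (frob_row p M 2 0 $ j) ^ p" by (simp add: frob_row_def)
    also have "\<dots> = (a * M$1$j + b * (M$1$j) ^ p + c * (M$1$j) ^ p^2) ^ p" by (simp add: abcd d)
    also have "\<dots> = a ^ p * (M$1$j) ^ p + b ^ p * (M$1$j) ^ p^2 + c ^ p * (M$1$j) ^ p^3"
      using p by (simp add: freshmans_dream power_mult_distrib power2_eq_square power3_eq_cube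
          ac_simps flip: power_mult)
    finally show ?thesis unfolding moore_row by simp
  qed
  then have row': "frob_row p M 2 1 = vector [0, a ^ p, b ^ p, c ^ p] v* ?V"
    by (simp add: vec_eq_iff)
  have "gamma p M 1 2 3 4 = c * c ^ p * det ?V \<or> gamma p M 1 2 3 4 = - (c * c ^ p * det ?V)"
    unfolding gamma_def Gamma_mat_rows row row' V rows4_mult det_mul by (simp add: det_4 d)
  then have c: "c = 0" using g(1) D by auto
  have s: "gamma p M 1 2 5 7 = b * det ?V"
    unfolding gamma_def Gamma_mat_rows row V rows4_mult det_mul by (simp add: det_4 c d)
  have r: "gamma p M 2 3 5 7 = a * det ?V"
    unfolding gamma_def Gamma_mat_rows row V rows4_mult det_mul by (simp add: det_4 c d)
  have "b \<noteq> 0" using s g(4) by auto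
  moreover have "M$2$j = a * M$1$j + b * (M$1$j) ^ p" for j
    using abcd[of j] by (simp add: frob_row_def c d)
  ultimately show ?thesis
    using that[of b a] s r D by (simp add: det_moore)
qed

section \<open>Polynomials invariant under translations\<close>

lemma prod_linear_dvd:
  fixes q :: "'d::idom poly"
  assumes "finite V" "\<And>v. v \<in> V \<Longrightarrow> poly q (- v) = 0"
  shows "(\<Prod>v\<in>V. [:v, 1:]) dvd q"
  using assms
proof (induction V arbitrary: q rule: finite_induct)
  case (insert w V)
  have "[:w, 1:] dvd q" using insert.prems[of w] by (simp add: poly_eq_0_iff_dvd)
  then obtain r where r: "q = [:w, 1:] * r" by (elim dvdE)
  have "poly r (- v) = 0" if "v \<in> V" for v
  proof -
    have "poly q (- v) = 0" "v \<noteq> w" using that insert by auto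
    then show ?thesis by (simp add: r)
  qed
  then have "(\<Prod>v\<in>V. [:v, 1:]) dvd r" using insert.IH by blast
  then show ?case unfolding r prod.insert[OF insert.hyps(1,2)] by (intro mult_dvd_mono dvd_refl)
qed simp

lemma prod_linear_monic:
  fixes V :: "'d::idom set"
  assumes "finite V"
  shows "degree (\<Prod>v\<in>V. [:v, 1:]) = card V" "lead_coeff (\<Prod>v\<in>V. [:v, 1:]) = 1"
proof -
  show "degree (\<Prod>v\<in>V. [:v, 1:]) = card V"
    by (subst degree_prod_eq_sum_degree) auto
  show "lead_coeff (\<Prod>v\<in>V. [:v, 1:]) = 1"
    by (simp add: lead_coeff_prod)
qed

text \<open>A translation maps \<open>V\<close> injectively into itself, so by finiteness onto itself.\<close>

lemma bij_betw_translation: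
  fixes V :: "'d::ab_group_add set"
  assumes "finite V" "\<And>v w. v \<in> V \<Longrightarrow> w \<in> V \<Longrightarrow> v + w \<in> V" "u \<in> V"
  shows "bij_betw ((+) u) V V"
proof -
  have "inj_on ((+) u) V" by (simp add: inj_on_def)
  moreover have "(+) u ` V \<subseteq> V" using assms by auto
  ultimately show ?thesis
    using endo_inj_surj[OF assms(1), of "(+) u"] unfolding bij_betw_def by blast
qed

text \<open>A translation by an element of the group permutes the factors.\<close>

lemma translation_invariant_prod:
  fixes g :: "'d::idom poly"
  assumes "finite V" "\<And>v w. v \<in> V \<Longrightarrow> w \<in> V \<Longrightarrow> v + w \<in> V" "u \<in> V"
  shows "(\<Prod>v\<in>V. g \<circ>\<^sub>p [:v, 1:]) \<circ>\<^sub>p [:u, 1:] = (\<Prod>v\<in>V. g \<circ>\<^sub>p [:v, 1:])"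
proof -
  interpret c: rhom "\<lambda>f. f \<circ>\<^sub>p [:u, 1:]" by (rule rhom_pcompose)
  have "(\<Prod>v\<in>V. g \<circ>\<^sub>p [:v, 1:]) \<circ>\<^sub>p [:u, 1:] = (\<Prod>v\<in>V. g \<circ>\<^sub>p [:u + v, 1:])"
    by (simp add: c.prod pcompose_assoc[symmetric] pcompose_pCons add.commute)
  also have "\<dots> = (\<Prod>v\<in>V. g \<circ>\<^sub>p [:v, 1:])"
    using prod.reindex_bij_betw[OF bij_betw_translation[OF assms], of "\<lambda>v. g \<circ>\<^sub>p [:v, 1:]"] .
  finally show ?thesis .
qed

lemma pcompose_X: "[:0, 1:] \<circ>\<^sub>p q = (q :: 'd::comm_ring_1 poly)"
  by (simp add: pcompose_pCons)

text \<open>If \<open>q\<close> is invariant, \<open>q - q(0)\<close> vanishes on the group, so it is divisible by the product \<open>N\<close> of its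
linear factors, and the quotient is invariant of smaller degree.\<close>

lemma translation_invariant_poly:
  fixes q :: "'d::idom poly"
  assumes V: "finite V" "0 \<in> V" "\<And>v w. v \<in> V \<Longrightarrow> w \<in> V \<Longrightarrow> v + w \<in> V"
    and "\<And>v. v \<in> V \<Longrightarrow> q \<circ>\<^sub>p [:v, 1:] = q"
  shows "\<exists>s. q = s \<circ>\<^sub>p (\<Prod>v\<in>V. [:v, 1:])"
  using assms(4)
proof (induction "degree q" arbitrary: q rule: less_induct)
  case (less q)
  let ?N = "\<Prod>v\<in>V. [:v, 1:]"
  have inv_N: "?N \<circ>\<^sub>p [:v, 1:] = ?N" if "v \<in> V" for v
    using translation_invariant_prod[OF V(1,3) that, of "[:0, 1:]"] by (simp only: pcompose_X)
  have N0: "?N \<noteq> 0" using V(1) by simp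
  show ?case
  proof (cases "degree q = 0")
    case True
    then obtain c where "q = [:c:]" using degree_eq_zeroE by blast
    then show ?thesis by (intro exI[of _ "[:c:]"]) simp
  next
    case False
    let ?q0 = "[:poly q 0:]"
    have "poly q (- v) = poly q 0" if "v \<in> V" for v
    proof -
      have "poly q (- v) = poly (q \<circ>\<^sub>p [:v, 1:]) (- v)" using less.prems[OF that] by simp
      then show ?thesis by (simp add: poly_pcompose)
    qed
    then have "?N dvd q - ?q0" by (intro prod_linear_dvd[OF V(1)]) simp
    then obtain r where r: "q - ?q0 = ?N * r" by (elim dvdE)
    have "r \<circ>\<^sub>p [:v, 1:] = r" if "v \<in> V" for v
    proof -
      have "?N * (r \<circ>\<^sub>p [:v, 1:]) = (q - ?q0) \<circ>\<^sub>p [:v, 1:]"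
        unfolding r by (simp add: pcompose_mult inv_N that)
      also have "\<dots> = q - ?q0" using less.prems[OF that] by (simp add: pcompose_diff)
      finally show ?thesis using r N0 by simp
    qed
    moreover have "degree r < degree q"
    proof -
      have "r \<noteq> 0" using r False by (metis degree_pCons_0 eq_iff_diff_eq_0 mult_zero_right)
      have "degree (q - ?q0) = degree ?N + degree r" unfolding r using N0 \<open>r \<noteq> 0\<close> by (rule degree_mult_eq)
      moreover have "degree (q - ?q0) \<le> degree q" by (rule degree_diff_le) auto
      moreover have "card V > 0" using V(1,2) by (auto simp: card_gt_0_iff)
      ultimately show ?thesis using prod_linear_monic(1)[OF V(1)] by simp
    qed
    ultimately obtain s where "r = s \<circ>\<^sub>p ?N" using less.hyps by blast
    then have "q = ?q0 + ?N * (s \<circ>\<^sub>p ?N)"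
      using r by (metis add_diff_cancel_left' diff_add_cancel add.commute)
    then have "q = pCons (poly q 0) s \<circ>\<^sub>p ?N"
      by (simp only: pcompose_pCons)
    then show ?thesis ..
  qed
qed

text \<open>Injectivity passes to one more variable: \<open>\<sigma>\<close> sets the new variable to zero, which kills all but the
constant coefficient.\<close>

lemma peval_kernel:
  fixes \<phi> :: "'r::comm_ring_1 \<Rightarrow> 's::idom"
  assumes "rhom \<phi>" "\<And>a. \<phi> a = 0 \<Longrightarrow> a = 0"
    and "rhom \<sigma>" "\<And>a. \<sigma> (\<phi> a) = \<phi> a" "\<sigma> u = 0" "u \<noteq> 0"
    and "peval \<phi> u f = 0"
  shows "f = 0"
  using assms(7)
proof (induction f)
  case (pCons a f)
  interpret s: rhom \<sigma> by fact
  have eq: "\<phi> a + u * peval \<phi> u f = 0"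
    using pCons.prems by (simp add: peval_pCons[OF assms(1)])
  from arg_cong[OF this, of \<sigma>] have "a = 0"
    using assms(2,4,5) by (simp add: s.simps)
  then show ?case using eq pCons assms(6) by (simp add: rhom.zero[OF assms(1)])
qed simp

lemma peval_mem:
  assumes "rhom \<phi>" "is_subalgebra T" "\<And>a. \<phi> a \<in> T" "u \<in> T"
  shows "peval \<phi> u f \<in> T"
proof (induction f)
  case 0
  show ?case using assms(3)[of 0] by (simp add: rhom.zero[OF assms(1)])
next
  case (pCons a f)
  then show ?case using assms by (simp add: peval_pCons is_subalgebra_def)
qed

section \<open>The group as an additive group of scalars\<close>

lemma CHAR_mpoly: "CHAR(('v, 'a::field) mpoly) = CHAR('a)"
proof (rule CHAR_eqI)
  show "of_nat CHAR('a) = (0 :: ('v, 'a) mpoly)"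
    using Const.of_nat[of "CHAR('a)"] by (metis Const.zero of_nat_CHAR)
  show "CHAR('a) dvd n" if "of_nat n = (0 :: ('v, 'a) mpoly)" for n
    using that Const.of_nat[of n] by (metis Const_eq_0_iff of_nat_eq_0_iff_char_dvd)
qed

definition shift_image :: "nat \<Rightarrow> 'a::field \<Rightarrow> 'a \<Rightarrow> 'a \<Rightarrow> xyz \<Rightarrow> (xyz, 'a) mpoly" where
  "shift_image p r s u v = (case v of VX \<Rightarrow> px | VY \<Rightarrow> py + Const u * px
     | VZ \<Rightarrow> pz + 2 * Const u * py + Const (u\<^sup>2 + (r * u + s * u ^ p)) * px)"

text \<open>The situation that the conditions on the minors produce; see \<open>second_row_of_minors\<close>.\<close>

locale rank_four =
  fixes p :: nat and M :: "'a::field^4^2" and r s :: 'a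
  assumes prime_p: "prime p" and p_gt_2: "p > 2" and char_p: "CHAR('a) = p"
    and independent: "gamma p M 1 3 5 7 \<noteq> 0"
    and second_row: "\<And>j. M$2$j = r * M$1$j + s * (M$1$j) ^ p"
    and s_nz: "s \<noteq> 0"
    and minor_1357: "gamma p M 1 3 5 7 / gamma p M 1 2 5 7 = 1 / s"
    and minor_2357: "gamma p M 2 3 5 7 / gamma p M 1 2 5 7 = r / s"
begin

lemma frob_add: "(x + y :: 'a) ^ p ^ k = x ^ p ^ k + y ^ p ^ k"
  using freshmans_dream'[of "p ^ k" k x y] prime_p char_p by simp

lemma frob_sum: "(sum f S :: 'a) ^ p ^ k = (\<Sum>i\<in>S. f i ^ p ^ k)"
  using freshmans_dream_sum'[of "p ^ k" k f S] prime_p char_p by simp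

lemma frob_mpoly: "(f + g :: ('v, 'a) mpoly) ^ p ^ k = f ^ p ^ k + g ^ p ^ k"
  using freshmans_dream'[of "p ^ k" k f g] prime_p char_p by (simp add: CHAR_mpoly)

lemma frob_of_nat: "(of_nat n :: 'a) ^ p ^ k = of_nat n"
  by (induction n) (use prime_p prime_gt_0_nat in \<open>auto simp: frob_add power_0_left\<close>)

lemma of_nat_inj: "m < p \<Longrightarrow> n < p \<Longrightarrow> (of_nat m :: 'a) = of_nat n \<Longrightarrow> m = n"
  using char_p by (simp add: of_nat_eq_iff_cong_CHAR cong_less_modulus_unique_nat)

lemma carrier_E: "carrier (E_group p) = {a. \<forall>j. a j \<in> {0..<int p}}"
  using p_gt_2 by (auto simp: E_group_def carrier_product_group carrier_integer_mod_group PiE_iff)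

text \<open>The scalar by which a group element translates \<open>y\<close>.\<close>

definition comb :: "(4 \<Rightarrow> int) \<Rightarrow> 'a" where
  "comb a = (\<Sum>j\<in>UNIV. of_nat (nat (a j)) * M$1$j)"

definition U :: "'a set" where
  "U = comb ` carrier (E_group p)"

lemma comb_frob: "comb a ^ p ^ k = (\<Sum>j\<in>UNIV. of_nat (nat (a j)) * (M$1$j) ^ p ^ k)"
  by (simp add: comb_def frob_sum power_mult_distrib frob_of_nat)

text \<open>If two combinations agree, so do their Frobenius powers; so the difference of the two coefficient
vectors is in the kernel of the Moore matrix of the first row.\<close>

lemma comb_inj: "inj_on comb (carrier (E_group p))"
proof
  fix a b assume ab: "a \<in> carrier (E_group p)" "b \<in> carrier (E_group p)" "comb a = comb b"
  \<comment> \<open>the vector of differences of the coefficients, which lie in the prime field\<close>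
  define n :: "'a^4" where "n = (\<chi> j. of_nat (nat (a j)) - of_nat (nat (b j)))"
  have "(\<Sum>j\<in>UNIV. M$1$j ^ p^k * n $ j) = comb a ^ p ^ k - comb b ^ p ^ k" for k
    by (simp add: n_def comb_frob algebra_simps sum_subtractf)
  then have "n = 0" using ab(3) by (intro moore_independent[OF independent]) simp
  then have "of_nat (nat (a j)) = (of_nat (nat (b j)) :: 'a)" for j
    by (simp add: n_def vec_eq_iff)
  moreover have "nat (a j) < p" "nat (b j) < p" "0 \<le> a j" "0 \<le> b j" for j
    using ab by (simp_all add: carrier_E nat_less_iff)
  ultimately show "a = b"
    by (intro ext) (metis of_nat_inj eq_nat_nat_iff)
qed

lemma finite_U: "finite U" and card_U: "card U = p ^ 4"
proof -
  have "carrier (E_group p) = PiE UNIV (\<lambda>_. {0..<int p})"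
    by (auto simp: carrier_E PiE_iff)
  then have "finite (carrier (E_group p))" "card (carrier (E_group p)) = p ^ 4"
    by (simp_all add: finite_PiE card_PiE)
  then show "finite U" "card U = p ^ 4"
    using comb_inj by (simp_all add: U_def card_image)
qed

lemma U_add: "u \<in> U \<Longrightarrow> v \<in> U \<Longrightarrow> u + v \<in> U"
proof -
  assume "u \<in> U" "v \<in> U"
  then obtain a b where ab: "a \<in> carrier (E_group p)" "b \<in> carrier (E_group p)"
    and uv: "u = comb a" "v = comb b" by (auto simp: U_def)
  define c where "c = (\<lambda>j. (a j + b j) mod int p)"
  have c: "c \<in> carrier (E_group p)" using p_gt_2 by (simp add: c_def carrier_E)
  have "of_nat (nat (c j)) = (of_nat (nat (a j)) + of_nat (nat (b j)) :: 'a)" for j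
  proof -
    have "0 \<le> a j" "0 \<le> b j" using ab by (simp_all add: carrier_E)
    then have "nat (c j) = (nat (a j) + nat (b j)) mod p"
      by (simp add: c_def nat_mod_distrib nat_add_distrib)
    then have "of_nat (nat (c j)) = (of_nat (nat (a j) + nat (b j)) :: 'a)"
      using char_p by (simp add: of_nat_eq_iff_cong_CHAR del: of_nat_add)
    then show ?thesis by simp
  qed
  then have "comb c = u + v" by (simp add: comb_def uv algebra_simps sum.distrib)
  then show "u + v \<in> U" using c unfolding U_def by (metis imageI)
qed

lemma U_0: "0 \<in> U"
proof -
  have "comb (\<lambda>_. 0) = 0" "(\<lambda>_. 0) \<in> carrier (E_group p)"
    using p_gt_2 by (simp_all add: comb_def carrier_E)
  then show ?thesis unfolding U_def by (metis image_eqI)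
qed

definition shift :: "'a \<Rightarrow> (xyz, 'a) mpoly \<Rightarrow> (xyz, 'a) mpoly" where
  "shift u = subst (shift_image p r s u)"

lemma rhom_shift: "rhom (shift u)"
  unfolding shift_def by (rule rhom_subst)

sublocale shift: rhom "shift u" for u by (rule rhom_shift)

lemma shift_Const [simp]: "shift u (Const c) = Const c"
  by (simp add: shift_def)

lemma shift_Var [simp]:
  "shift u px = px" "shift u py = py + Const u * px"
  "shift u pz = pz + 2 * Const u * py + Const (u\<^sup>2 + (r * u + s * u ^ p)) * px"
  by (simp_all add: shift_def shift_image_def)

lemma shift_0: "shift 0 f = f"
proof (rule rhom_mpoly_eqI[of "shift 0" "\<lambda>f. f"])
  show "shift 0 (Var v) = Var v" for v
    using p_gt_2 by (cases v) (simp_all add: Const.zero power_0_left)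
qed (unfold_locales, simp_all add: shift.simps)

text \<open>The coefficient of \<open>x\<close> in the image of \<open>z\<close> is \<open>u\<^sup>2\<close> plus an additive function of \<open>u\<close>, and \<open>2 u y\<close>
accounts for the cross term of the square.\<close>

lemma shift_shift: "shift u (shift v f) = shift (u + v) f"
proof (rule rhom_mpoly_eqI[of "\<lambda>f. shift u (shift v f)"])
  have "(u + v) ^ p = u ^ p + v ^ p" using frob_add[of u v 1] by simp
  then show "shift u (shift v (Var w)) = shift (u + v) (Var w)" for w
    by (cases w) (simp_all add: shift.simps Const.simps algebra_simps power2_eq_square)
qed (unfold_locales, simp_all add: shift.simps)

lemma e_act_shift: "e_act M j = shift (M$1$j)"
proof -
  have "e_image M j = shift_image p r s (M$1$j)"
  proof
    fix v show "e_image M j v = shift_image p r s (M$1$j) v"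
      by (cases v) (simp_all add: shift_image_def second_row)
  qed
  then show ?thesis by (simp add: e_act_def shift_def)
qed

lemma shift_funpow: "(shift u ^^ n) f = shift (of_nat n * u) f"
  by (induction n) (simp_all add: shift_0 shift_shift algebra_simps)

lemma E_act_shift: "E_act M a f = shift (comb a) f"
  by (simp add: E_act_def e_act_shift shift_funpow shift_shift comb_def sum_4 algebra_simps)

lemma invariant_iff: "f \<in> invariant_ring p M \<longleftrightarrow> (\<forall>u\<in>U. shift u f = f)"
  by (auto simp: invariant_ring_def E_act_shift U_def)

lemma invariantsI: "(\<And>u. u \<in> U \<Longrightarrow> shift u f = f) \<Longrightarrow> f \<in> invariant_ring p M"
  by (simp add: invariant_iff)

lemma invariants_subalgebra: "is_subalgebra (invariant_ring p M)"
  by (auto simp: is_subalgebra_def invariant_iff shift.simps)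

text \<open>The orbit product runs over distinct elements, so it is a product over the group as soon as the
stabiliser is trivial.\<close>

lemma orbit_prod_shift:
  assumes "inj_on (\<lambda>u. shift u f) U"
  shows "orbit_prod p M f = (\<Prod>u\<in>U. shift u f)"
proof -
  have "orbit (E_group p) (E_act M) f = (\<lambda>u. shift u f) ` U"
    by (auto simp: orbit_def U_def E_act_shift)
  then show ?thesis
    using assms by (simp add: orbit_prod_def prod.reindex)
qed

lemma shift_py_inj: "inj_on (\<lambda>u. shift u py) U"
proof
  fix u v assume "shift u py = shift v py"
  then have "Const (u - v) * px = (0 :: (xyz, 'a) mpoly)" by (simp add: Const.simps algebra_simps)
  then show "u = v" by simp
qed

lemma two_nz: "(2 :: 'a) \<noteq> 0"
  using of_nat_inj[of 2 0] p_gt_2 by auto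

lemma shift_pz_inj: "inj_on (\<lambda>u. shift u pz) U"
proof
  fix u v assume "shift u pz = shift v pz"
  then have "Poly_Mapping.lookup (shift u pz) (Poly_Mapping.single VY 1)
      = Poly_Mapping.lookup (shift v pz) (Poly_Mapping.single VY 1)" by (rule arg_cong)
  moreover have "2 * Const w * py = (Const (2 * w) * py :: (xyz, 'a) mpoly)" for w
    by (simp add: Const.simps)
  moreover have "Poly_Mapping.single VX (Suc 0) \<noteq> Poly_Mapping.single VY (Suc 0)"
    "Poly_Mapping.single VZ (Suc 0) \<noteq> Poly_Mapping.single VY (Suc 0)"
    by (metis keys_single nat.distinct(1) singleton_inject xyz.distinct)+
  ultimately show "u = v"
    using two_nz by (simp add: lookup_add lookup_Const_mult) (simp add: Var_def lookup_single)
qed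

abbreviation NY :: "(xyz, 'a) mpoly" where "NY \<equiv> orbit_prod p M py"
abbreviation NZ :: "(xyz, 'a) mpoly" where "NZ \<equiv> orbit_prod p M pz"

lemma NY_eq: "NY = (\<Prod>u\<in>U. py + Const u * px)"
  using orbit_prod_shift[OF shift_py_inj] by simp

lemma NZ_eq: "NZ = (\<Prod>u\<in>U. shift u pz)"
  by (rule orbit_prod_shift[OF shift_pz_inj])

lemma norm_invariant: "(\<Prod>u\<in>U. shift u f) \<in> invariant_ring p M"
proof (rule invariantsI)
  fix v assume v: "v \<in> U"
  have "shift v (\<Prod>u\<in>U. shift u f) = (\<Prod>u\<in>U. shift (v + u) f)"
    by (simp add: shift.prod shift_shift)
  also have "\<dots> = (\<Prod>u\<in>U. shift u f)"
    using prod.reindex_bij_betw[OF bij_betw_translation[OF finite_U U_add v], of "\<lambda>u. shift u f"] .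
  finally show "shift v (\<Prod>u\<in>U. shift u f) = (\<Prod>u\<in>U. shift u f)" .
qed

lemma NY_invariant: "NY \<in> invariant_ring p M" and NZ_invariant: "NZ \<in> invariant_ring p M"
  using norm_invariant[of py] norm_invariant[of pz] orbit_prod_shift[OF shift_py_inj]
    orbit_prod_shift[OF shift_pz_inj] by simp_all

lemma h1_eq: "h1 p M = py ^ p + Const (1 / s) * delta * px ^ (p - 2) + Const (r / s) * py * px ^ (p - 1)"
  by (simp add: h1_def minor_1357 minor_2357)

text \<open>The translation adds \<open>u\<^sup>p x\<^sup>p\<close> to \<open>y\<^sup>p\<close> and subtracts \<open>(r u + s u\<^sup>p) x\<^sup>2\<close> from \<open>\<delta>\<close>; the coefficients
\<open>1/s\<close> and \<open>r/s\<close> balance these.\<close>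

lemma h1_invariant: "h1 p M \<in> invariant_ring p M"
proof (rule invariantsI)
  fix u :: 'a
  have py: "shift u (py ^ p) = py ^ p + Const (u ^ p) * px ^ p"
    using frob_mpoly[of py "Const u * px" 1] by (simp add: shift.simps Const.simps power_mult_distrib)
  have d: "shift u delta = delta - Const (r * u + s * u ^ p) * px\<^sup>2"
    by (simp add: delta_def shift.simps Const.simps algebra_simps power2_eq_square)
  obtain q where q: "p = Suc (Suc q)"
    using p_gt_2 by (metis Suc_lessE numeral_2_eq_2)
  have x: "px ^ p = px\<^sup>2 * (px :: (xyz, 'a) mpoly) ^ (p - 2)"
      "px ^ (p - 1) = px * (px :: (xyz, 'a) mpoly) ^ (p - 2)"
    by (simp_all add: q power2_eq_square mult.assoc)
  \<comment> \<open>the balance of the coefficients of \<open>x\<^sup>p\<close>\<close>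
  have "Const (1 / s) * Const (r * u + s * u ^ p) = (Const (r / s) * Const u + Const (u ^ p) :: (xyz, 'a) mpoly)"
    unfolding Const.mult[symmetric] Const.add[symmetric] using s_nz by (simp add: field_simps)
  then have "y' + Const (u ^ p) * (px\<^sup>2 * x') + Const (1 / s) * (d' - Const (r * u + s * u ^ p) * px\<^sup>2) * x'
      + Const (r / s) * (py + Const u * px) * (px * x')
    = y' + Const (1 / s) * d' * x' + Const (r / s) * py * (px * x')" for y' x' d' :: "(xyz, 'a) mpoly"
    by algebra
  then show "shift u (h1 p M) = h1 p M"
    unfolding h1_eq by (simp only: shift.add shift.mult shift.power[of _ px] py d x shift_Const shift_Var)
qed

end

section \<open>Homogeneous polynomials and their lead exponents\<close>

definition homogeneous :: "nat \<Rightarrow> ('v, 'a::zero) mpoly \<Rightarrow> bool" where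
  "homogeneous d f \<longleftrightarrow> (\<forall>m\<in>Poly_Mapping.keys f. total_deg m = d)"

lemma homogeneous_add: "homogeneous d f \<Longrightarrow> homogeneous d g \<Longrightarrow> homogeneous d (f + g)"
  using keys_add[of f g] by (auto simp: homogeneous_def)

lemma homogeneous_uminus: "homogeneous d f \<Longrightarrow> homogeneous d (- f :: ('v, 'a::ab_group_add) mpoly)"
  by (simp add: homogeneous_def in_keys_iff)

lemma homogeneous_diff: "homogeneous d f \<Longrightarrow> homogeneous d g \<Longrightarrow> homogeneous d (f - g :: ('v, 'a::ab_group_add) mpoly)"
  using homogeneous_add[OF _ homogeneous_uminus, of d f g] by simp

lemma homogeneous_mult:
  fixes f g :: "('v, 'a::comm_ring_1) mpoly"
  shows "homogeneous d f \<Longrightarrow> homogeneous e g \<Longrightarrow> homogeneous (d + e) (f * g)"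
  using keys_mult[of f g] by (fastforce simp: homogeneous_def total_deg_add)

lemma homogeneous_Const: "homogeneous 0 (Const c)"
  by (simp add: homogeneous_def Const_def total_deg_def)

lemma homogeneous_Var: "homogeneous (Suc 0) (Var v :: ('v, 'a::comm_ring_1) mpoly)"
  by (simp add: homogeneous_def Var_def)

lemma homogeneous_one: "homogeneous 0 (1 :: ('v, 'a::comm_ring_1) mpoly)"
  by (simp add: homogeneous_def total_deg_def)

lemma homogeneous_power:
  fixes f :: "('v, 'a::comm_ring_1) mpoly"
  assumes "homogeneous d f" shows "homogeneous (d * n) (f ^ n)"
  by (induction n) (simp_all add: homogeneous_one homogeneous_mult[OF assms])

lemma homogeneous_Var_power: "homogeneous n (Var v ^ n :: ('v, 'a::comm_ring_1) mpoly)"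
  using homogeneous_power[OF homogeneous_Var, of n v] by simp

lemma homogeneous_prod:
  fixes f :: "'i \<Rightarrow> ('v, 'a::comm_ring_1) mpoly"
  assumes "\<And>i. i \<in> S \<Longrightarrow> homogeneous d (f i)" shows "homogeneous (d * card S) (prod f S)"
  using assms
proof (induction S rule: infinite_finite_induct)
  case (insert x F)
  then have "homogeneous (d + d * card F) (f x * prod f F)" by (intro homogeneous_mult) auto
  then show ?case using insert by simp
qed (simp_all add: homogeneous_one)

lemma homogeneous_Const_mult:
  fixes f :: "('v, 'a::comm_ring_1) mpoly"
  shows "homogeneous d f \<Longrightarrow> homogeneous d (Const c * f)"
  using homogeneous_mult[OF homogeneous_Const, of d f c] by simp

lemma Var_power: "Var v ^ n = Poly_Mapping.single (Poly_Mapping.single v n) (1::'a::comm_ring_1)"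
  by (induction n) (simp_all add: Var_def mult_single flip: single_add)

instance xyz :: finite
proof
  have "UNIV = {VX, VY, VZ}" using xyz.exhaust by blast
  then show "finite (UNIV :: xyz set)" by (metis finite.emptyI finite.insertI)
qed

lemma VX_least: "\<not> v < VX"
  by (cases v) (simp_all add: less_xyz_def)

text \<open>In a homogeneous polynomial a smaller exponent of \<open>x\<close> wins, so the lead monomial can be read off
modulo a power of \<open>x\<close>.\<close>

lemma lead_exp_of_congruence:
  fixes f :: "(xyz, 'a::field) mpoly"
  assumes hom: "homogeneous d f" and f: "f = Const c * px ^ e * py ^ m + px ^ Suc e * g" and "c \<noteq> 0"
  shows "f \<noteq> 0" "lead_exp f = Poly_Mapping.single VX e + Poly_Mapping.single VY m"
proof -
  let ?m = "Poly_Mapping.single VX e + Poly_Mapping.single VY m"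
  have mono: "Const c * px ^ e * py ^ m = Poly_Mapping.single ?m c"
    by (simp add: Const_def Var_power mult_single)
  have VX: "Poly_Mapping.lookup k VX \<ge> Suc e" if "k \<in> Poly_Mapping.keys (px ^ Suc e * g)" for k
    using that keys_mult[of "px ^ Suc e" g] unfolding Var_power by (auto simp: lookup_add)
  have m_VX: "Poly_Mapping.lookup ?m VX = e" by (simp add: lookup_add lookup_single)
  then have "?m \<notin> Poly_Mapping.keys (px ^ Suc e * g)" using VX by fastforce
  then have lm: "Poly_Mapping.lookup f ?m = c"
    by (simp only: f mono lookup_add) (simp add: in_keys_iff)
  then show "f \<noteq> 0" using \<open>c \<noteq> 0\<close> by auto
  have mem: "?m \<in> Poly_Mapping.keys f" using lm \<open>c \<noteq> 0\<close> by (simp add: in_keys_iff)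
  show "lead_exp f = ?m"
  proof (rule lead_exp_eqI[OF mem])
    fix k assume k: "k \<in> Poly_Mapping.keys f" "k \<noteq> ?m"
    then have "k \<in> Poly_Mapping.keys (px ^ Suc e * g)"
      using keys_add[of "Poly_Mapping.single ?m c" "px ^ Suc e * g"] unfolding f mono
      by (auto split: if_splits)
    then have "Poly_Mapping.lookup k VX > Poly_Mapping.lookup ?m VX" using VX m_VX by fastforce
    moreover have "total_deg k = total_deg ?m" using hom k mem by (auto simp: homogeneous_def)
    ultimately show "grevlex_less k ?m"
      using VX_least unfolding grevlex_less_def by blast
  qed
qed

context rank_four
begin

lemma homogeneous_shift_Var: "homogeneous (Suc 0) (shift u (Var v))"
proof -
  have "homogeneous (Suc 0) (2 * Const u * py)"
    using homogeneous_Const_mult[OF homogeneous_Var, of "2 * u" VY] by (simp add: Const.simps)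
  then show ?thesis
    by (cases v) (auto intro!: homogeneous_add homogeneous_Const_mult homogeneous_Var)
qed

lemma homogeneous_NY: "homogeneous (p ^ 4) NY"
  using homogeneous_prod[of U "Suc 0" "\<lambda>u. shift u py", OF homogeneous_shift_Var]
  by (simp add: NY_eq card_U)

lemma homogeneous_delta: "homogeneous 2 (delta :: (xyz, 'a) mpoly)"
  unfolding delta_def
  using homogeneous_mult[OF homogeneous_Var homogeneous_Var, of VX VZ]
  by (intro homogeneous_diff homogeneous_Var_power) (simp add: numeral_2_eq_2)

lemma homogeneous_h1: "homogeneous p (h1 p M)"
proof -
  have p: "2 + (p - 2) = p" "Suc 0 + (p - 1) = p" using p_gt_2 by simp_all
  have "homogeneous (2 + (p - 2)) (Const (1 / s) * delta * px ^ (p - 2))"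
    by (intro homogeneous_mult homogeneous_Const_mult homogeneous_Var_power homogeneous_delta)
  moreover have "homogeneous (Suc 0 + (p - 1)) (Const (r / s) * py * px ^ (p - 1))"
    by (intro homogeneous_mult homogeneous_Const_mult homogeneous_Var_power homogeneous_Var)
  ultimately show ?thesis
    unfolding h1_eq p by (intro homogeneous_add homogeneous_Var_power)
qed

text \<open>The exponents of \<open>x\<close> that occur in the Frobenius powers of \<open>h\<^sub>1\<close>. In terms of them, and of the linear
inequalities in lemma \<open>exponents\<close>, all exponents in the construction of \<open>h\<^sub>2\<close> are sums.\<close>

definition a1 :: nat where "a1 = p - 2"
definition a2 :: nat where "a2 = p^2 - 2 * p"
definition a3 :: nat where "a3 = p^3 - 2 * p^2"
definition a4 :: nat where "a4 = p^4 - 2 * p^3"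

lemma exponents:
  "p = a1 + 2" "p^2 = a2 + 2 * p" "p^3 = a3 + 2 * p^2" "p^4 = a4 + 2 * p^3"
  "1 \<le> a1" "p \<le> a2" "p^2 \<le> a3" "p^3 \<le> a4"
proof -
  have "3 * p ^ k \<le> p ^ Suc k" for k using p_gt_2 by simp
  from this[of 1] this[of 2] this[of 3] have
    "3 * p \<le> p^2" "3 * p^2 \<le> p^3" "3 * p^3 \<le> p^4"
    by (simp_all add: eval_nat_numeral)
  then show "p = a1 + 2" "p^2 = a2 + 2 * p" "p^3 = a3 + 2 * p^2" "p^4 = a4 + 2 * p^3"
    "1 \<le> a1" "p \<le> a2" "p^2 \<le> a3" "p^3 \<le> a4"
    using p_gt_2 unfolding a1_def a2_def a3_def a4_def by linarith+
qed

text \<open>The Frobenius powers of the scalar \<open>\<alpha>\<close>.\<close>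

abbreviation al :: "nat \<Rightarrow> (xyz, 'a) mpoly" where "al k \<equiv> Const ((1 / s) ^ p ^ k)"

lemma alpha_eq: "alpha p M = 1 / s"
  by (simp add: alpha_def minor_1357)

lemma h1_frob:
  "\<exists>D. h1 p M ^ p ^ k = py ^ p ^ Suc k + px ^ (a1 * p ^ k) * (al k * (py ^ p ^ k)\<^sup>2 + px ^ p ^ k * D)"
proof -
  have "p - 1 = Suc a1" using exponents(1) by simp
  then have x: "px ^ (p - 1) = (px :: (xyz, 'a) mpoly) * px ^ a1" "p - 2 = a1"
    by (simp_all add: a1_def)
  have "h1 p M = py ^ p + px ^ a1 * (Const (1 / s) * py\<^sup>2 + px * (Const (r / s) * py - Const (1 / s) * pz))"
    unfolding h1_eq x delta_def by (simp add: algebra_simps)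
  then have "h1 p M ^ p ^ k = (py ^ p) ^ p ^ k + (px ^ a1) ^ p ^ k * ((Const (1 / s)) ^ p ^ k * (py\<^sup>2) ^ p ^ k
      + px ^ p ^ k * (Const (r / s) * py - Const (1 / s) * pz) ^ p ^ k)"
    by (simp only: frob_mpoly power_mult_distrib)
  then have "h1 p M ^ p ^ k = py ^ p ^ Suc k + px ^ (a1 * p ^ k) * (al k * (py ^ p ^ k)\<^sup>2
      + px ^ p ^ k * (Const (r / s) * py - Const (1 / s) * pz) ^ p ^ k)"
    by (simp add: Const.power power_mult mult.commute flip: power_mult)
  then show ?thesis by blast
qed

text \<open>As a polynomial in \<open>y\<close>, the orbit product of \<open>y\<close> is additive. Its coefficients solve a linear system
with the Moore matrix: with that solution, the additive polynomial of degree \<open>p\<^sup>4\<close> vanishes on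
\<open>U x\<close>, so it is the product of the linear factors. All that matters below is the gap between the
degrees \<open>p\<^sup>4\<close> and \<open>p\<^sup>3\<close> in \<open>y\<close>.\<close>

lemma NY_expansion: "\<exists>Y. NY = py ^ p ^ 4 + px ^ (p ^ 4 - p ^ 3) * Y"
proof -
  obtain l :: "nat \<Rightarrow> 'a" where l: "\<And>j. M$1$j ^ p ^ 4 = (\<Sum>k<4. l k * (M$1$j) ^ p ^ k)"
  proof -
    obtain a b c d where abcd: "\<And>j. frob_row p M 1 4 $ j
      = a * M$1$j + b * (M$1$j) ^ p + c * (M$1$j) ^ p^2 + d * (M$1$j) ^ p^3"
      using moore_span[OF independent] by metis
    have "M$1$j ^ p ^ 4 = (\<Sum>k<4. (\<lambda>k. if k = 0 then a else if k = 1 then b else if k = 2 then c else d) k * (M$1$j) ^ p ^ k)" for j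
      using abcd[of j] by (simp add: frob_row_def eval_nat_numeral)
    then show ?thesis by (rule that)
  qed
  have U_l: "u ^ p ^ 4 = (\<Sum>k<4. l k * u ^ p ^ k)" if u: "u \<in> U" for u
  proof -
    obtain a where u: "u = comb a" using u unfolding U_def by (elim imageE)
    show ?thesis
      unfolding u comb_frob l by (simp add: sum_distrib_left sum.swap[of _ "{..<4}"] ac_simps)
  qed
  let ?f = "\<Sum>k<4. monom (Const (l k) * px ^ (p ^ 4 - p ^ k)) (p ^ k) :: (xyz, 'a) mpoly poly"
  let ?N = "\<Prod>v\<in>(\<lambda>u. Const u * px) ` U. [:v, 1:] :: (xyz, 'a) mpoly poly"
  let ?q = "monom 1 (p ^ 4) - ?f"
  have inj: "inj_on (\<lambda>u. Const u * px) U"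
    using shift_py_inj by (auto simp: inj_on_def)
  have fin: "finite ((\<lambda>u. Const u * px) ` U)" using finite_U by simp
  have deg_f: "degree ?f < p ^ 4"
  proof (rule degree_sum_less)
    fix k :: nat assume "k \<in> {..<4}"
    then have "p ^ k < p ^ 4" using p_gt_2 by (intro power_strict_increasing) auto
    then show "degree (monom (Const (l k) * px ^ (p ^ 4 - p ^ k)) (p ^ k)) < p ^ 4"
      using degree_monom_le le_less_trans by blast
  qed (use p_gt_2 in simp)
  have roots: "poly ?q (- v) = 0" if v: "v \<in> (\<lambda>u. Const u * px) ` U" for v
  proof -
    obtain u where u: "u \<in> U" "v = Const u * px" using v by auto
    have neg: "- u \<in> U"
    proof -
      have "0 \<in> (+) u ` U" using bij_betw_translation[OF finite_U U_add u(1)] U_0 by (simp add: bij_betw_def)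
      then obtain w where "w \<in> U" "0 = u + w" by auto
      then show ?thesis using minus_unique[of u w] by simp
    qed
    have v': "- v = Const (- u) * px" by (simp add: u Const.simps)
    have "poly ?f (- v) = (\<Sum>k<4. Const (l k * (- u) ^ p ^ k) * px ^ (p ^ 4))"
    proof (unfold v' poly_sum poly_monom, rule sum.cong[OF refl])
      fix k :: nat assume "k \<in> {..<4}"
      then have "p ^ k \<le> p ^ 4" using p_gt_2 by (intro power_increasing) auto
      then have "px ^ (p ^ 4) = (px :: (xyz, 'a) mpoly) ^ (p ^ 4 - p ^ k) * px ^ p ^ k"
        by (simp flip: power_add)
      then show "Const (l k) * px ^ (p ^ 4 - p ^ k) * (Const (- u) * px) ^ p ^ k
          = Const (l k * (- u) ^ p ^ k) * px ^ (p ^ 4)"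
        by (simp add: Const.mult Const.power power_mult_distrib mult_ac)
    qed
    also have "\<dots> = Const (\<Sum>k<4. l k * (- u) ^ p ^ k) * px ^ (p ^ 4)"
      by (simp only: Const.sum sum_distrib_right)
    also have "\<dots> = (- v) ^ p ^ 4"
      by (simp only: v' power_mult_distrib Const.power U_l[OF neg, symmetric])
    finally show ?thesis by (simp add: poly_monom)
  qed
  have "?N dvd ?q" using prod_linear_dvd[OF fin roots] .
  moreover have dN: "degree ?N = p ^ 4" and lN: "lead_coeff ?N = 1"
    using prod_linear_monic[OF fin] inj by (simp_all add: card_image card_U)
  moreover have "?N dvd ?q - ?N" using calculation(1) by (rule dvd_diff) simp
  moreover have "degree (?q - ?N) < p ^ 4"
  proof -
    have "degree (monom 1 (p ^ 4) - ?N) < p ^ 4"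
    proof (rule le_neq_implies_less)
      show "degree (monom 1 (p ^ 4) - ?N) \<le> p ^ 4"
        using dN by (intro degree_diff_le) (simp_all add: degree_monom_le)
      have "coeff (monom 1 (p ^ 4) - ?N) (p ^ 4) = 0" using dN lN by simp
      then show "degree (monom 1 (p ^ 4) - ?N) \<noteq> p ^ 4"
        using p_gt_2 by (metis degree_0 leading_coeff_0_iff power_eq_0_iff not_less_zero)
    qed
    then have "degree ((monom 1 (p ^ 4) - ?N) - ?f) < p ^ 4"
      using deg_f by (rule degree_diff_less)
    moreover have "(monom 1 (p ^ 4) - ?N) - ?f = ?q - ?N" by simp
    ultimately show ?thesis by (simp only:)
  qed
  ultimately have "?q - ?N = 0"
    using dvd_imp_degree_le[of ?N "?q - ?N"] by linarith
  then have "?q = ?N" by (simp only: right_minus_eq)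
  then have "poly ?q py = poly ?N py" by simp
  also have "\<dots> = NY"
    using inj by (simp add: NY_eq poly_prod prod.reindex add.commute)
  finally have NY: "NY = py ^ p ^ 4 - (\<Sum>k<4. Const (l k) * px ^ (p ^ 4 - p ^ k) * py ^ p ^ k)"
    by (simp add: poly_sum poly_monom)
  have "px ^ (p ^ 4 - p ^ 3) dvd (\<Sum>k<4. Const (l k) * px ^ (p ^ 4 - p ^ k) * py ^ p ^ k)"
  proof (rule dvd_sum)
    fix k :: nat assume "k \<in> {..<4}"
    then have "p ^ k \<le> p ^ 3" using p_gt_2 by (intro power_increasing) auto
    then have "(px :: (xyz, 'a) mpoly) ^ (p ^ 4 - p ^ 3) dvd px ^ (p ^ 4 - p ^ k)"
      by (intro le_imp_power_dvd) simp
    then show "px ^ (p ^ 4 - p ^ 3) dvd Const (l k) * px ^ (p ^ 4 - p ^ k) * py ^ p ^ k"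
      by (intro dvd_mult2 dvd_mult)
  qed
  then obtain Y where "(\<Sum>k<4. Const (l k) * px ^ (p ^ 4 - p ^ k) * py ^ p ^ k) = px ^ (p ^ 4 - p ^ 3) * Y"
    by (elim dvdE)
  then have "NY = py ^ p ^ 4 + px ^ (p ^ 4 - p ^ 3) * (- Y)" using NY by simp
  then show ?thesis by blast
qed

end

section \<open>The generator \<open>h\<^sub>2\<close>\<close>

lemma drop_tail:
  fixes X :: "'r::comm_ring_1"
  assumes "H = Y + X ^ a * Z" "t \<le> a"
  obtains W where "H = Y + X ^ t * W"
proof -
  have "X ^ a = X ^ t * X ^ (a - t)" using assms(2) by (simp flip: power_add)
  then have "H = Y + X ^ t * (X ^ (a - t) * Z)" using assms(1) by (simp add: mult.assoc)
  then show ?thesis by (rule that)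
qed

text \<open>Of the square only the cross term with the first part of the tail survives modulo a high power of
\<open>X\<close>.\<close>

lemma square_drop_tail:
  fixes X :: "'r::comm_ring_1"
  assumes "H = Y + X ^ a * (A * B + X ^ c * D)" "t \<le> a" "t \<le> c"
  obtains W where "H\<^sup>2 = Y\<^sup>2 + 2 * A * X ^ a * Y * B + X ^ a * X ^ t * W"
proof -
  have x: "X ^ a = X ^ t * X ^ (a - t)" "X ^ c = X ^ t * X ^ (c - t)"
    using assms by (simp_all flip: power_add)
  have "(Y + x * (A * B + t' * c' * D))\<^sup>2 = Y\<^sup>2 + 2 * A * x * Y * B
      + x * t' * (2 * Y * c' * D + a' * (A * B + t' * c' * D)\<^sup>2)" if "x = t' * a'" for x t' a' c' :: 'r
    unfolding that by (simp add: algebra_simps power2_eq_square)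
  from this[OF x(1)] show ?thesis
    using that assms(1) x(2) by metis
qed

context rank_four
begin

lemma a_mult: "a1 * p = a2" "a1 * p\<^sup>2 = a3" "a1 * p ^ 3 = a4"
  by (simp_all add: a1_def a2_def a3_def a4_def diff_mult_distrib flip: power_Suc)
     (simp_all add: eval_nat_numeral)

text \<open>The power of \<open>x\<close> that divides \<open>h2_tilde\<close>, and the \<open>y\<close>-degree of \<open>h2\<close>.\<close>

abbreviation "e0 \<equiv> p ^ 4 - p ^ 3 - p\<^sup>2 - p - 2"
abbreviation "m0 \<equiv> p ^ 3 + p\<^sup>2 + p + 2"

lemma e0_eq: "e0 = a1 + a2 + a3 + a4" "p ^ 4 - p ^ 3 - p\<^sup>2 - 2 * p = a2 + a3 + a4"
  "p ^ 4 - p ^ 3 - 2 * p\<^sup>2 = a3 + a4" "p ^ 4 - 2 * p ^ 3 = a4" "p ^ 4 - p ^ 3 = a4 + p ^ 3"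
  using exponents by linarith+

text \<open>Each correction term in \<open>h2_tilde\<close> cancels the lowest \<open>x\<close>-power of what precedes it and leaves the
cross term of a square at a higher \<open>x\<close>-power: \<open>N(y) - h\<^sub>1\<^bsup>p^3\<^esup>\<close> starts at \<open>a4\<close>, adding the second
term moves this to \<open>a3 + a4\<close>, the third to \<open>a2 + a3 + a4\<close> and the last to \<open>a1 + a2 + a3 + a4\<close>. The
factors \<open>2\<close> of the cross terms accumulate to \<open>8\<close>.\<close>

lemma h2_tilde_expansion:
  "\<exists>W. h2_tilde p M = Const (8 * (1 / s) ^ (p^3 + p^2 + p + 1)) * px ^ e0 * py ^ m0 + px ^ Suc e0 * W"
proof -
  obtain D0 where H0: "h1 p M = py ^ p + px ^ a1 * (al 0 * py\<^sup>2 + px ^ 1 * D0)"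
    using h1_frob[of 0] by auto
  obtain D1 where H1: "h1 p M ^ p = py ^ p\<^sup>2 + px ^ a2 * (al 1 * (py ^ p)\<^sup>2 + px ^ p * D1)"
    using h1_frob[of 1] by (auto simp: a_mult power2_eq_square)
  obtain D2 where H2: "h1 p M ^ p\<^sup>2 = py ^ p ^ 3 + px ^ a3 * (al 2 * (py ^ p\<^sup>2)\<^sup>2 + px ^ p\<^sup>2 * D2)"
    using h1_frob[of 2] by (auto simp: a_mult)
  obtain D3 where H3: "h1 p M ^ p ^ 3 = py ^ p ^ 4 + px ^ a4 * (al 3 * (py ^ p ^ 3)\<^sup>2 + px ^ p ^ 3 * D3)"
    using h1_frob[of 3] by (auto simp: a_mult)
  obtain Y where NY: "NY = py ^ p ^ 4 + px ^ (a4 + p ^ 3) * Y"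
    using NY_expansion unfolding e0_eq by blast
  let ?Y0 = "py :: (xyz, 'a) mpoly" and ?Y1 = "py ^ p :: (xyz, 'a) mpoly" and ?Y2 = "py ^ p\<^sup>2 :: (xyz, 'a) mpoly"
    and ?Y3 = "py ^ p ^ 3 :: (xyz, 'a) mpoly"
  let ?x1 = "px ^ a1 :: (xyz, 'a) mpoly" and ?x2 = "px ^ a2 :: (xyz, 'a) mpoly" and ?x3 = "px ^ a3 :: (xyz, 'a) mpoly"
    and ?x4 = "px ^ a4 :: (xyz, 'a) mpoly"
  note ex = exponents
  obtain W1 where W1: "(h1 p M)\<^sup>2 = ?Y1\<^sup>2 + 2 * al 0 * ?x1 * ?Y1 * ?Y0\<^sup>2 + ?x1 * px ^ 1 * W1"
    using square_drop_tail[OF H0, of 1] ex by auto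
  obtain W2 where W2: "(h1 p M ^ p)\<^sup>2 = ?Y2\<^sup>2 + 2 * al 1 * ?x2 * ?Y2 * ?Y1\<^sup>2 + ?x2 * px ^ (a1 + 1) * W2"
    using square_drop_tail[OF H1, of "a1 + 1"] ex by auto
  have "a2 + a1 + 1 \<le> a3" "a2 + a1 + 1 \<le> p\<^sup>2" using ex by linarith+
  from square_drop_tail[OF H2 this]
  obtain W3 where W3: "(h1 p M ^ p\<^sup>2)\<^sup>2 = ?Y3\<^sup>2 + 2 * al 2 * ?x3 * ?Y3 * ?Y2\<^sup>2 + ?x3 * px ^ (a2 + a1 + 1) * W3"
    by metis
  have "a1 + 1 \<le> a2" using ex by linarith
  from drop_tail[OF H1 this] obtain V1 where V1: "h1 p M ^ p = ?Y2 + px ^ (a1 + 1) * V1" by metis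
  have "a2 + a1 + 1 \<le> a3" using ex by linarith
  from drop_tail[OF H2 this] obtain V2 where V2: "h1 p M ^ p\<^sup>2 = ?Y3 + px ^ (a2 + a1 + 1) * V2" by metis
  have "NY - h1 p M ^ p ^ 3 = - (?x4 * al 3 * ?Y3\<^sup>2) + px ^ (a4 + p ^ 3) * (Y - D3)"
    unfolding NY H3 by (simp add: algebra_simps power_add)
  moreover have "a4 + (a3 + a2 + a1 + 1) \<le> a4 + p ^ 3" using ex by linarith
  ultimately obtain W4 where W4:
    "NY - h1 p M ^ p ^ 3 = - (?x4 * al 3 * ?Y3\<^sup>2) + px ^ (a4 + (a3 + a2 + a1 + 1)) * W4"
    by (rule drop_tail)
  have hp: "h1 p M ^ (2 * p\<^sup>2) = (h1 p M ^ p\<^sup>2)\<^sup>2"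
    "h1 p M ^ (p\<^sup>2 + 2 * p) = h1 p M ^ p\<^sup>2 * (h1 p M ^ p)\<^sup>2"
    "h1 p M ^ (p\<^sup>2 + p + 2) = h1 p M ^ p\<^sup>2 * h1 p M ^ p * (h1 p M)\<^sup>2"
    by (simp_all add: power_add mult.commute[of 2] power_mult power2_eq_square)
  have alp: "Const ((1 / s) ^ (p ^ 3 + p\<^sup>2)) = al 3 * al 2"
    "Const ((1 / s) ^ (p ^ 3 + p\<^sup>2 + p)) = al 3 * al 2 * al 1"
    "Const (8 * (1 / s) ^ (p ^ 3 + p\<^sup>2 + p + 1)) = 8 * (al 3 * al 2 * al 1 * al 0)"
    by (simp_all only: power_add Const.mult Const.numeral power_one_right power_0)
  have py: "py ^ m0 = ?Y3 * ?Y2 * ?Y1 * ?Y0\<^sup>2" by (simp only: power_add)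
  have "h2_tilde p M = (NY - h1 p M ^ p ^ 3) + al 3 * (h1 p M ^ p\<^sup>2)\<^sup>2 * ?x4
      - 2 * (al 3 * al 2) * (h1 p M ^ p\<^sup>2 * (h1 p M ^ p)\<^sup>2) * (?x3 * ?x4)
      + 4 * (al 3 * al 2 * al 1) * (h1 p M ^ p\<^sup>2 * h1 p M ^ p * (h1 p M)\<^sup>2) * (?x2 * ?x3 * ?x4)"
    unfolding h2_tilde_def hp e0_eq(2-4) alpha_eq alp by (simp only: power_add)
  also have "\<dots> = - (?x4 * al 3 * ?Y3\<^sup>2) + (?x4 * ?x3 * ?x2 * ?x1 * px) * W4
      + al 3 * (?Y3\<^sup>2 + 2 * al 2 * ?x3 * ?Y3 * ?Y2\<^sup>2 + ?x3 * (?x2 * ?x1 * px) * W3) * ?x4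
      - 2 * (al 3 * al 2) * ((?Y3 + (?x2 * ?x1 * px) * V2) * (?Y2\<^sup>2 + 2 * al 1 * ?x2 * ?Y2 * ?Y1\<^sup>2 + ?x2 * (?x1 * px) * W2)) * (?x3 * ?x4)
      + 4 * (al 3 * al 2 * al 1) * ((?Y3 + (?x2 * ?x1 * px) * V2) * (?Y2 + (?x1 * px) * V1)
          * (?Y1\<^sup>2 + 2 * al 0 * ?x1 * ?Y1 * ?Y0\<^sup>2 + ?x1 * px * W1)) * (?x2 * ?x3 * ?x4)"
    unfolding W4 W3 W2 W1 unfolding V2 V1 by (simp only: power_add power_one_right mult.assoc)
  finally have h: "h2_tilde p M = \<dots>" .
  \<comment> \<open>with the powers of \<open>x\<close> and \<open>y\<close> as independent quantities, this is an identity of polynomials\<close>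
  have general: "\<exists>W. - (x4 * A3 * Y3\<^sup>2) + (x4 * x3 * x2 * x1 * X) * W4
      + A3 * (Y3\<^sup>2 + 2 * A2 * x3 * Y3 * Y2\<^sup>2 + x3 * (x2 * x1 * X) * W3) * x4
      - 2 * (A3 * A2) * ((Y3 + (x2 * x1 * X) * V2) * (Y2\<^sup>2 + 2 * A1 * x2 * Y2 * Y1\<^sup>2 + x2 * (x1 * X) * W2)) * (x3 * x4)
      + 4 * (A3 * A2 * A1) * ((Y3 + (x2 * x1 * X) * V2) * (Y2 + (x1 * X) * V1)
          * (Y1\<^sup>2 + 2 * A0 * x1 * Y1 * Y0\<^sup>2 + x1 * X * W1)) * (x2 * x3 * x4)
    = 8 * (A3 * A2 * A1 * A0) * (x1 * x2 * x3 * x4) * (Y3 * Y2 * Y1 * Y0\<^sup>2) + (X * (x1 * x2 * x3 * x4)) * W"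
    for x1 x2 x3 x4 A0 A1 A2 A3 Y0 Y1 Y2 Y3 X :: "(xyz, 'a) mpoly"
    by (rule exI[of _ "W4 + A3 * W3
      - 2 * (A3 * A2) * (V2 * (Y2\<^sup>2 + 2 * A1 * x2 * Y2 * Y1\<^sup>2 + x2 * (x1 * X) * W2) + Y3 * W2)
      + 4 * (A3 * A2 * A1) * (x2 * V2 * (Y2 + (x1 * X) * V1) * (Y1\<^sup>2 + 2 * A0 * x1 * Y1 * Y0\<^sup>2 + x1 * X * W1)
         + Y3 * V1 * (Y1\<^sup>2 + 2 * A0 * x1 * Y1 * Y0\<^sup>2 + x1 * X * W1) + Y3 * Y2 * W1)"])
      (simp add: algebra_simps power2_eq_square)
  show ?thesis
    unfolding h alp py e0_eq(1) using general by (simp only: power_add power_Suc)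
qed

lemma homogeneous_h2_tilde: "homogeneous (p ^ 4) (h2_tilde p M)"
proof -
  have c: "homogeneous (p ^ 4) (c * h1 p M ^ i * px ^ j)"
    if "p * i + j = p ^ 4" "homogeneous 0 c" for c i j
  proof -
    have "homogeneous (0 + p * i + j) (c * h1 p M ^ i * px ^ j)"
      by (intro homogeneous_mult homogeneous_power homogeneous_h1 homogeneous_Var_power that)
    then show ?thesis using that by simp
  qed
  have n: "homogeneous 0 (numeral k * Const c)" for k and c :: 'a
    using homogeneous_Const[of "numeral k * c"] by (simp add: Const.simps)
  have pp: "p * p ^ 3 = p ^ 4" "p * (2 * p\<^sup>2) = 2 * p ^ 3" "p * (p\<^sup>2 + 2 * p) = p ^ 3 + 2 * p\<^sup>2"
    "p * (p\<^sup>2 + p + 2) = p ^ 3 + p\<^sup>2 + 2 * p"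
    by (simp_all add: eval_nat_numeral algebra_simps)
  have "homogeneous (p ^ 4) (h1 p M ^ p ^ 3)"
    using homogeneous_power[OF homogeneous_h1, of "p ^ 3"] pp by simp
  moreover have "p * (2 * p\<^sup>2) + (p ^ 4 - 2 * p ^ 3) = p ^ 4"
    "p * (p\<^sup>2 + 2 * p) + (p ^ 4 - p ^ 3 - 2 * p\<^sup>2) = p ^ 4"
    "p * (p\<^sup>2 + p + 2) + (p ^ 4 - p ^ 3 - p\<^sup>2 - 2 * p) = p ^ 4"
    unfolding pp using exponents by linarith+
  ultimately show ?thesis
    unfolding h2_tilde_def
    by (intro homogeneous_add homogeneous_diff homogeneous_NY c n homogeneous_Const)
qed

lemma h2_tilde_invariant: "h2_tilde p M \<in> invariant_ring p M"
proof (rule invariantsI)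
  fix u assume "u \<in> U"
  then have "shift u NY = NY" "shift u (h1 p M) = h1 p M"
    using NY_invariant h1_invariant by (simp_all add: invariant_iff)
  then show "shift u (h2_tilde p M) = h2_tilde p M"
    unfolding h2_tilde_def by (simp only: shift.simps shift_Const shift_Var)
qed

lemma eight_nz: "(8 :: 'a) \<noteq> 0"
proof -
  have "(8 :: 'a) = 2 * 2 * 2" by simp
  then show ?thesis using two_nz by (metis mult_eq_0_iff)
qed

text \<open>The constant by which \<open>h2_tilde\<close> is divided.\<close>

abbreviation "c0 \<equiv> 8 * (1 / s) ^ (p ^ 3 + p\<^sup>2 + p + 1)"

lemma c0_nz: "c0 \<noteq> 0"
  using eight_nz s_nz by simp

lemma h2_tilde_eq: "h2_tilde p M = Const c0 * px ^ e0 * h2 p M"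
proof -
  obtain W where W: "h2_tilde p M = Const c0 * px ^ e0 * py ^ m0 + px ^ Suc e0 * W"
    using h2_tilde_expansion by blast
  let ?g = "8 * Const (alpha p M ^ (p^3 + p^2 + p + 1)) * px ^ (p^4 - p^3 - p^2 - p - 2) :: (xyz, 'a) mpoly"
  have g: "?g = Const c0 * px ^ e0" by (simp only: alpha_eq Const.mult Const.numeral)
  have "?g \<noteq> 0" unfolding g using c0_nz by simp
  let ?q = "py ^ m0 + px * (Const (1 / c0) * W)"
  have cc: "Const c0 * Const (1 / c0) = (1 :: (xyz, 'a) mpoly)"
    unfolding Const.mult[symmetric] using c0_nz by (simp add: Const.one)
  have q: "h2_tilde p M = ?g * ?q"
  proof -
    have "C * x * (y + X * (C' * W)) = C * x * y + (C * C') * (X * x * W)" for C C' X x y :: "(xyz, 'a) mpoly"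
      by (simp add: algebra_simps)
    then show ?thesis unfolding W g by (simp only: cc power_Suc mult_1)
  qed
  have "h2 p M = ?q"
    unfolding h2_def exact_quot_def
  proof (rule the_equality)
    show "h2_tilde p M = ?g * ?q" by (rule q)
    show "q' = ?q" if "h2_tilde p M = ?g * q'" for q'
      using that q \<open>?g \<noteq> 0\<close> mult_left_cancel by metis
  qed
  then show ?thesis using q g by simp
qed

lemma h2_invariant: "h2 p M \<in> invariant_ring p M"
proof (rule invariantsI)
  fix u assume "u \<in> U"
  then have "shift u (h2_tilde p M) = h2_tilde p M"
    using h2_tilde_invariant by (simp add: invariant_iff)
  then have "Const c0 * px ^ e0 * shift u (h2 p M) = Const c0 * px ^ e0 * h2 p M"
    unfolding h2_tilde_eq by (simp only: shift.simps shift_Const shift_Var)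
  moreover have "Const c0 * px ^ e0 \<noteq> (0 :: (xyz, 'a) mpoly)" using c0_nz by simp
  ultimately show "shift u (h2 p M) = h2 p M" using mult_left_cancel by metis
qed

text \<open>Homogeneity is available for \<open>h2_tilde\<close> directly; the lead exponent of the quotient follows since
lead exponents are additive.\<close>

lemma lead_h2: "h2 p M \<noteq> 0" "lead_exp (h2 p M) = Poly_Mapping.single VY m0"
proof -
  obtain W where W: "h2_tilde p M = Const c0 * px ^ e0 * py ^ m0 + px ^ Suc e0 * W"
    using h2_tilde_expansion by blast
  note lead = lead_exp_of_congruence[OF homogeneous_h2_tilde W c0_nz]
  show nz: "h2 p M \<noteq> 0" using lead(1) unfolding h2_tilde_eq by force
  have "Const c0 * px ^ e0 = Poly_Mapping.single (Poly_Mapping.single VX e0) c0"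
    by (simp add: Const_def Var_power mult_single)
  then have lead_g: "lead_exp (Const c0 * px ^ e0) = Poly_Mapping.single VX e0"
    using lead_single[OF c0_nz] by (simp only:)
  have g_nz: "Const c0 * px ^ e0 \<noteq> (0 :: (xyz, 'a) mpoly)" using c0_nz by simp
  have "lead_exp (h2_tilde p M) = Poly_Mapping.single VX e0 + lead_exp (h2 p M)"
    unfolding h2_tilde_eq using lead_mult(2)[OF g_nz nz] lead_g by (simp only:)
  then show "lead_exp (h2 p M) = Poly_Mapping.single VY m0"
    using lead(2) by simp
qed

lemma lead_h1: "h1 p M \<noteq> 0" "lead_exp (h1 p M) = Poly_Mapping.single VY p"
proof -
  have "\<exists>W. h1 p M = Const 1 * px ^ 0 * py ^ p + px ^ Suc 0 * W"
  proof -
    obtain D where "h1 p M = py ^ p + px ^ a1 * (al 0 * py\<^sup>2 + px * D)" using h1_frob[of 0] by auto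
    moreover have "1 \<le> a1" using exponents by simp
    ultimately obtain W where "h1 p M = py ^ p + px ^ 1 * W" by (rule drop_tail)
    then show ?thesis by (auto simp: Const.one)
  qed
  then obtain W where W: "h1 p M = Const 1 * px ^ 0 * py ^ p + px ^ Suc 0 * W" by blast
  show "h1 p M \<noteq> 0" "lead_exp (h1 p M) = Poly_Mapping.single VY p"
    using lead_exp_of_congruence[OF homogeneous_h1 W] by simp_all
qed

lemma lead_shift_pz: "shift u pz \<noteq> 0" "lead_exp (shift u pz) = Poly_Mapping.single VZ 1"
proof -
  let ?r = "Const (2 * u) * py + Const (u\<^sup>2 + (r * u + s * u ^ p)) * px"
  have f: "shift u pz = Poly_Mapping.single (Poly_Mapping.single VZ 1) 1 + ?r"
    by (simp add: Const.simps) (simp add: Var_def)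
  have "grevlex_less (Poly_Mapping.single v 1) (Poly_Mapping.single VZ 1)" if "v \<noteq> VZ" for v
    unfolding grevlex_less_def using that
    by (intro disjI2) (auto simp: lookup_single when_def less_xyz_def intro!: exI[of _ v], cases v, auto)
  then have "below (Poly_Mapping.single VZ 1) (Const c * Var v :: (xyz, 'a) mpoly)" if "v \<noteq> VZ" for v c
    using that by (auto simp: below_def Const_def Var_def mult_single)
  then have b: "below (Poly_Mapping.single VZ 1) ?r" by (intro below_add) auto
  show "shift u pz \<noteq> 0" "lead_exp (shift u pz) = Poly_Mapping.single VZ 1"
    unfolding f using lead_unsplit[OF _ b, of 1] by simp_all
qed

lemma lead_NZ: "NZ \<noteq> 0" "lead_exp NZ = Poly_Mapping.single VZ (p ^ 4)"
proof -
  note lead = lead_prod[of U "\<lambda>u. shift u pz", OF lead_shift_pz(1) finite_U, folded NZ_eq]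
  show "NZ \<noteq> 0" using lead by simp
  show "lead_exp NZ = Poly_Mapping.single VZ (p ^ 4)"
    using lead by (intro poly_mapping_eqI) (simp add: lead_shift_pz(2) lookup_single when_def card_U del: shift_Var)
qed

end

section \<open>The invariants after inverting x\<close>

lemma peval_X: "rhom \<phi> \<Longrightarrow> peval \<phi> u [:0, 1:] = u"
  by (simp add: peval_pCons rhom.zero rhom.one)

abbreviation evX :: "'a::field poly \<Rightarrow> (xyz, 'a) mpoly" where "evX \<equiv> peval Const px"
abbreviation evXY :: "'a::field poly poly \<Rightarrow> (xyz, 'a) mpoly" where "evXY \<equiv> peval evX py"

lemma rhom_evX: "rhom evX"
  by (rule rhom_peval[OF rhom_Const])

lemma rhom_evXY: "rhom evXY"
  by (rule rhom_peval[OF rhom_evX])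

interpretation evX: rhom evX by (rule rhom_evX)
interpretation evXY: rhom evXY by (rule rhom_evXY)

declare evX.one [simp] evXY.one [simp]

text \<open>The variables \<open>x, y, z\<close> are algebraically independent, in the form needed for nested univariate
polynomials.\<close>

lemma evXYZ_kernel:
  fixes P :: "'a::field poly poly poly"
  assumes "peval evXY pz P = 0" shows "P = 0"
proof -
  define \<sigma> :: "xyz \<Rightarrow> (xyz, 'a) mpoly \<Rightarrow> (xyz, 'a) mpoly"
    where "\<sigma> w = subst (\<lambda>v. if v = w then 0 else Var v)" for w
  have \<sigma>: "rhom (\<sigma> w)" for w unfolding \<sigma>_def by (rule rhom_subst)
  have C: "\<sigma> w (Const c) = Const c" for w c by (simp add: \<sigma>_def)
  have V: "\<sigma> w (Var v) = (if v = w then 0 else Var v)" for w v by (simp add: \<sigma>_def)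
  have X: "\<sigma> w (evX a) = evX a" if "w \<noteq> VX" for w a
    using that by (simp add: rhom_peval_comp[OF \<sigma> rhom_Const] C V o_def)
  have XY: "\<sigma> VZ (evXY a) = evXY a" for a
    by (simp add: rhom_peval_comp[OF \<sigma> rhom_evX] X V o_def)
  have kX: "a = 0" if "evX a = 0" for a :: "'a poly"
    by (rule peval_kernel[OF rhom_Const _ \<sigma>[of VX] C _ _ that]) (simp_all add: V)
  have kXY: "a = 0" if "evXY a = 0" for a :: "'a poly poly"
    by (rule peval_kernel[OF rhom_evX kX \<sigma>[of VY] X _ _ that]) (simp_all add: V)
  show ?thesis
    by (rule peval_kernel[OF rhom_evXY kXY \<sigma>[of VZ] XY _ _ assms]) (simp_all add: V)
qed

context rank_four
begin

lemma px_power_pred: "px ^ (p - 1) = (px :: (xyz, 'a) mpoly) * px ^ (p - 2)"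
proof -
  have "p - 1 = Suc (p - 2)" using p_gt_2 by simp
  then show ?thesis by simp
qed

text \<open>Since \<open>h\<^sub>1\<close> has degree one in \<open>z\<close>, replacing \<open>z\<close> by \<open>h\<^sub>1\<close> is composition with a polynomial of degree
one, which is injective over a domain.\<close>

lemma evXY_h1_kernel:
  fixes P :: "'a poly poly poly"
  assumes "peval evXY (h1 p M) P = 0" shows "P = 0"
proof -
  let ?X = "[:[:0, 1:]:] :: 'a poly poly" and ?Y = "[:0, 1:] :: 'a poly poly"
  let ?C = "\<lambda>c. [:[:c:]:] :: 'a poly poly"
  have ev: "evXY ?X = px" "evXY ?Y = py" "evXY (?C c) = Const c" for c
    by (simp_all add: peval_pCons[OF rhom_evX] peval_pCons[OF rhom_Const] Const.simps)
  define G0 where "G0 = ?Y ^ p + ?C (1 / s) * ?Y\<^sup>2 * ?X ^ (p - 2) + ?C (r / s) * ?Y * ?X ^ (p - 1)"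
  \<comment> \<open>\<open>h\<^sub>1 = G0 + G1 z\<close>\<close>
  define G1 where "G1 = - ?C (1 / s) * ?X ^ (p - 1)"
  have G0: "evXY G0 = py ^ p + Const (1 / s) * py\<^sup>2 * px ^ (p - 2) + Const (r / s) * py * px ^ (p - 1)"
    unfolding G0_def by (simp only: evXY.simps ev)
  have G1: "evXY G1 = - Const (1 / s) * px ^ (p - 1)"
    unfolding G1_def by (simp only: evXY.simps ev)
  then have "G1 \<noteq> 0" using s_nz evXY.zero by (metis Const_eq_0_iff Var_nz divide_eq_0_iff mult_eq_0_iff neg_equal_0_iff_equal power_not_zero zero_neq_one)
  have "h1 p M = peval evXY pz [:G0, G1:]"
    unfolding peval_pCons[OF rhom_evXY] peval_0 G0 G1 h1_eq delta_def px_power_pred by (simp add: algebra_simps)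
  then have "peval evXY pz (P \<circ>\<^sub>p [:G0, G1:]) = 0"
    using assms by (simp add: peval_pcompose[OF rhom_evXY])
  then have "P \<circ>\<^sub>p [:G0, G1:] = 0" by (rule evXYZ_kernel)
  then show "P = 0" by (rule pcompose_eq_0) (use \<open>G1 \<noteq> 0\<close> in simp)
qed

text \<open>Solving for \<open>z\<close> in \<open>h\<^sub>1\<close> costs the denominator \<open>x\<^bsup>p-1\<^esup>\<close>.\<close>

lemma range_evXY_h1_localised: "\<exists>k P. px ^ k * f = peval evXY (h1 p M) P"
proof -
  let ?e = "peval evXY (h1 p M)"
  interpret e: rhom ?e by (rule rhom_peval[OF rhom_evXY])
  have eX: "?e [:[:[:0, 1:]:]:] = px" and eY: "?e [:[:0, 1:]:] = py" and eH: "?e [:0, 1:] = h1 p M"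
    and eC: "?e [:[:[:c:]:]:] = Const c" for c
    by (simp_all add: peval_pCons[OF rhom_evX] peval_pCons[OF rhom_evXY] peval_pCons[OF rhom_Const] Const.simps)
  have xk: "?e ([:[:[:0, 1:]:]:] ^ k) = px ^ k" for k by (simp only: e.power eX)
  have zero: "\<exists>k P. px ^ k * g = ?e P" if "g = ?e Q" for g Q
    using that by (intro exI[of _ 0] exI[of _ Q]) simp
  show ?thesis
  proof (induction f rule: mpoly_induct)
    case (Const c)
    show ?case by (rule zero) (rule eC[symmetric])
  next
    case (Var v)
    show ?case
    proof (cases v)
      case VX then show ?thesis using zero[OF eX[symmetric]] by simp
    next
      case VY then show ?thesis using zero[OF eY[symmetric]] by simp
    next
      case VZ
      let ?x = "[:[:[:0, 1:]:]:] :: 'a poly poly poly" and ?y = "[:[:0, 1:]:] :: 'a poly poly poly"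
      let ?c = "\<lambda>c. [:[:[:c:]:]:] :: 'a poly poly poly"
      have ss: "Const s * Const (1 / s) = (1 :: (xyz, 'a) mpoly)"
        unfolding Const.mult[symmetric] using s_nz by (simp add: Const.one)
      have "?e (?c s * (?y ^ p + ?c (1 / s) * ?y\<^sup>2 * ?x ^ (p - 2) + ?c (r / s) * ?y * ?x ^ (p - 1) - [:0, 1:]))
          = Const s * (py ^ p + Const (1 / s) * py\<^sup>2 * px ^ (p - 2) + Const (r / s) * py * px ^ (p - 1) - h1 p M)"
        by (simp only: e.simps eX eY eH eC)
      also have "\<dots> = (Const s * Const (1 / s)) * (px * px ^ (p - 2) * pz)"
        unfolding h1_eq delta_def by (simp add: algebra_simps)
      also have "\<dots> = px ^ (p - 1) * pz" by (simp only: ss px_power_pred mult_1)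
      finally show ?thesis using VZ by metis
    qed
  next
    case (add f g)
    then obtain k P l Q where fg: "px ^ k * f = ?e P" "px ^ l * g = ?e Q" by metis
    have "px ^ (k + l) * (f + g) = ?e ([:[:[:0, 1:]:]:] ^ l * P + [:[:[:0, 1:]:]:] ^ k * Q)"
      by (simp only: e.add e.mult xk fg[symmetric]) (simp add: power_add algebra_simps)
    then show ?case by blast
  next
    case (mult f g)
    then obtain k P l Q where fg: "px ^ k * f = ?e P" "px ^ l * g = ?e Q" by metis
    have "px ^ (k + l) * (f * g) = ?e (P * Q)"
      by (simp only: e.mult fg[symmetric]) (simp add: power_add algebra_simps)
    then show ?case by blast
  qed
qed

lemma translation_xy:
  defines "V \<equiv> (\<lambda>u. [:0, u:]) ` U"
  shows "finite V" "0 \<in> V" "\<And>v w. v \<in> V \<Longrightarrow> w \<in> V \<Longrightarrow> v + w \<in> V"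
    "evXY (\<Prod>v\<in>V. [:v, 1:]) = NY"
proof -
  show "finite V" "0 \<in> V" using finite_U U_0 by (force simp: V_def)+
  show "v + w \<in> V" if "v \<in> V" "w \<in> V" for v w
    using that U_add by (force simp: V_def)
  have inj: "inj_on (\<lambda>u. [:0, u:]) U" by (simp add: inj_on_def)
  show "evXY (\<Prod>v\<in>V. [:v, 1:]) = NY"
    unfolding NY_eq V_def prod.reindex[OF inj] o_def evXY.prod
    by (simp add: peval_pCons[OF rhom_evX] peval_pCons[OF rhom_Const] Const.simps algebra_simps)
qed

text \<open>Write \<open>x\<^sup>k f\<close> as a polynomial in \<open>h\<^sub>1\<close> over \<open>\<F>[x][y]\<close>. The group fixes \<open>h\<^sub>1\<close>, so by algebraic
independence it fixes every coefficient, and each coefficient is a polynomial in \<open>N(y)\<close> over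
\<open>\<F>[x]\<close> by \<open>translation_invariant_poly\<close>.\<close>

lemma localised_generation:
  assumes f: "f \<in> invariant_ring p M"
    and T: "is_subalgebra T" "px \<in> T" "NY \<in> T" "h1 p M \<in> T"
  shows "\<exists>k. px ^ k * f \<in> T"
proof -
  let ?e = "peval evXY (h1 p M)" and ?\<sigma> = "\<lambda>u q. q \<circ>\<^sub>p [:[:0, u:], 1:] :: 'a poly poly"
  obtain k P where P: "px ^ k * f = ?e P" using range_evXY_h1_localised by metis
  have "map_poly (?\<sigma> u) P = P" if u: "u \<in> U" for u
  proof -
    have fixed: "shift u f = f" "shift u (h1 p M) = h1 p M"
      using f h1_invariant u by (simp_all add: invariant_iff)
    have X: "shift u (evX a) = evX a" for a
      by (simp add: rhom_peval_comp[OF rhom_shift rhom_Const] o_def)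
    have "shift u (evXY q) = evXY (?\<sigma> u q)" for q
      by (simp add: rhom_peval_comp[OF rhom_shift rhom_evX] o_def X peval_pcompose[OF rhom_evX]
          peval_pCons[OF rhom_evX] peval_pCons[OF rhom_Const] Const.simps algebra_simps)
    then have "shift u (?e P) = ?e (map_poly (?\<sigma> u) P)"
      by (simp add: rhom_peval_comp[OF rhom_shift rhom_evXY] o_def fixed
          peval_map_poly[OF rhom_evXY rhom_pcompose])
    moreover have "shift u (?e P) = ?e P"
      unfolding P[symmetric] by (simp add: shift.simps fixed)
    ultimately have "?e (map_poly (?\<sigma> u) P - P) = 0"
      using rhom.minus[OF rhom_peval[OF rhom_evXY, of "h1 p M"]] by simp
    then show ?thesis using evXY_h1_kernel by fastforce
  qed
  then have inv: "?\<sigma> u (coeff P i) = coeff P i" if "u \<in> U" for u i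
    using that by (metis coeff_map_poly pcompose_0)
  have "evXY (coeff P i) \<in> T" for i
  proof -
    have "\<exists>t. coeff P i = t \<circ>\<^sub>p (\<Prod>v\<in>(\<lambda>u. [:0, u:]) ` U. [:v, 1:])"
      using inv by (intro translation_invariant_poly translation_xy) auto
    then obtain t where "evXY (coeff P i) = peval evX NY t"
      using peval_pcompose[OF rhom_evX] translation_xy(4) by metis
    then show ?thesis
      using peval_mem[OF rhom_evX T(1) peval_mem[OF rhom_Const T(1) _ T(2)] T(3)] T(1)
      by (auto simp: is_subalgebra_def)
  qed
  then have "evXY (coeff P i) * h1 p M ^ i \<in> T" for i
    using T(1) subalgebra_power[OF T(1,4)] unfolding is_subalgebra_def by blast
  then have "?e P \<in> T"
    unfolding peval_sum_coeff[OF rhom_evXY] by (rule subalgebra_sum[OF T(1)])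
  then show ?thesis using P by metis
qed

section \<open>The relation over the ring with x inverted\<close>

definition NY_rest :: "(xyz, 'a) mpoly" where
  "NY_rest = NY - Const c0 * px ^ e0 * h2 p M"

text \<open>All terms of \<open>h2_tilde\<close> other than \<open>N(y)\<close> are polynomials in \<open>x\<close> and \<open>h\<^sub>1\<close>.\<close>

lemma NY_rest_mem:
  assumes "is_subalgebra T" "px \<in> T" "h1 p M \<in> T" shows "NY_rest \<in> T"
proof -
  have C: "Const c \<in> T" for c using assms(1) by (auto simp: is_subalgebra_def)
  have mult: "f * g \<in> T" and add: "f + g \<in> T" if "f \<in> T" "g \<in> T" for f g
    using that assms(1) by (auto simp: is_subalgebra_def)
  have diff: "f - g \<in> T" if "f \<in> T" "g \<in> T" for f g
    using add[OF that(1) mult[OF C[of "- 1"] that(2)]] by (simp add: Const.simps)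
  have num: "numeral k \<in> T" for k using C[of "numeral k"] by (simp add: Const.numeral)
  have "NY_rest = NY - h2_tilde p M" by (simp only: NY_rest_def h2_tilde_eq)
  also have "\<dots> = h1 p M ^ p ^ 3 - Const (alpha p M ^ (p^3)) * h1 p M ^ (2 * p^2) * px ^ (p^4 - 2 * p^3)
     + 2 * Const (alpha p M ^ (p^3 + p^2)) * h1 p M ^ (p^2 + 2 * p) * px ^ (p^4 - p^3 - 2 * p^2)
     - 4 * Const (alpha p M ^ (p^3 + p^2 + p)) * h1 p M ^ (p^2 + p + 2) * px ^ (p^4 - p^3 - p^2 - 2 * p)"
    unfolding h2_tilde_def by simp
  also have "\<dots> \<in> T"
    by (intro add diff mult num C subalgebra_power assms)
  finally show ?thesis .
qed

text \<open>Over \<open>D = \<F>[x][h]\<close> let \<open>g(t)\<close> be the polynomial, monic of degree \<open>p\<close>, whose value at \<open>t = y\<close>,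
\<open>h = h\<^sub>1\<close> is \<open>x\<^bsup>p-1\<^esup> z / s\<close>. The product of \<open>g(t + u x)\<close> over \<open>u\<close> in \<open>U\<close> is invariant under
\<open>t \<mapsto> t + u x\<close> as a polynomial in \<open>t\<close>, so it is a polynomial \<open>S\<close> in the product of the \<open>t + u x\<close>;
comparing degrees, \<open>S\<close> is monic of degree \<open>p\<close>. Evaluation turns the two products into \<open>N(z)\<close>, up to
a power of \<open>x\<close> and a constant, and \<open>N(y)\<close>.\<close>

lemma NZ_relation:
  assumes T: "is_subalgebra T" "px \<in> T" "h1 p M \<in> T"
  obtains t where "\<And>i. t i \<in> T" "(Const (1 / s) * px ^ (p - 1)) ^ p ^ 4 * NZ = NY ^ p + (\<Sum>i<p. t i * NY ^ i)"
proof -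
  define \<theta> where "\<theta> = peval evX (h1 p M)"
  have rhom_\<theta>: "rhom \<theta>" unfolding \<theta>_def by (rule rhom_peval[OF rhom_evX])
  interpret \<psi>: rhom "peval \<theta> py" by (rule rhom_peval[OF rhom_\<theta>])
  define V where "V = (\<lambda>u. [:[:0, u:]:] :: 'a poly poly) ` U"
  have inj: "inj_on (\<lambda>u. [:[:0, u:]:] :: 'a poly poly) U" by (simp add: inj_on_def)
  have V: "finite V" "0 \<in> V" "card V = p ^ 4"
    using finite_U U_0 inj by (force simp: V_def card_image card_U)+
  have V_add: "v + w \<in> V" if "v \<in> V" "w \<in> V" for v w
    using that U_add by (force simp: V_def)
  have \<theta>_V: "\<theta> [:[:0, u:]:] = Const u * px" for u
    by (simp add: \<theta>_def peval_pCons[OF rhom_evX] peval_pCons[OF rhom_Const] Const.simps)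
  \<comment> \<open>\<open>g(t) = t\<^sup>p - h + (r/s) x\<^bsup>p-1\<^esup> t + (1/s) x\<^bsup>p-2\<^esup> t\<^sup>2\<close>\<close>
  let ?q = "[:- [:0, 1:], [:monom (r / s) (p - 1):], [:monom (1 / s) (p - 2):]:] :: 'a poly poly poly"
  let ?g = "monom 1 p + ?q" and ?N = "\<Prod>v\<in>V. [:v, 1:]"
  let ?G = "\<Prod>v\<in>V. ?g \<circ>\<^sub>p [:v, 1:]"
  have "degree ?q \<le> 2" by simp
  then have dq: "degree ?q < degree (monom (1 :: 'a poly poly) p)"
    using p_gt_2 by (simp add: degree_monom_eq)
  then have dg: "degree ?g = p" by (simp add: degree_add_eq_left degree_monom_eq)
  have lg: "lead_coeff ?g = 1"
    unfolding dg using dq by (simp add: degree_monom_eq coeff_eq_0)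
  have N: "degree ?N = p ^ 4" "lead_coeff ?N = 1"
    using prod_linear_monic[OF V(1)] V(3) by simp_all
  have "?g \<circ>\<^sub>p [:v, 1:] \<noteq> 0" for v
    using dg p_gt_2 pcompose_eq_0[of ?g "[:v, 1:]"] by auto
  then have dG: "degree ?G = p * p ^ 4"
    by (subst degree_prod_eq_sum_degree) (simp_all only: degree_pcompose dg, simp_all add: V(3))
  have lG: "lead_coeff ?G = 1"
  proof -
    have "lead_coeff (?g \<circ>\<^sub>p [:v, 1:]) = lead_coeff ?g * lead_coeff [:v, 1:] ^ degree ?g" for v
      by (rule lead_coeff_comp) simp
    then have "lead_coeff (?g \<circ>\<^sub>p [:v, 1:]) = 1" for v
      unfolding lg by simp
    then show ?thesis by (simp only: lead_coeff_prod prod.neutral_const)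
  qed
  obtain S where S: "?G = S \<circ>\<^sub>p ?N"
    using translation_invariant_poly[OF V(1,2) V_add translation_invariant_prod[OF V(1) V_add]] by metis
  have dS: "degree S = p"
    using dG N(1) p_gt_2 unfolding S degree_pcompose by simp
  have lS: "coeff S p = 1"
    using lG lead_coeff_comp[of ?N S] N p_gt_2 unfolding S dS by simp
  have g_eval: "peval \<theta> (shift u py) ?g = Const (1 / s) * px ^ (p - 1) * shift u pz" if u: "u \<in> U" for u
  proof -
    have "shift u (h1 p M) = h1 p M" using h1_invariant u by (simp add: invariant_iff)
    moreover have "\<theta> (- [:0, 1:]) = - h1 p M"
      unfolding rhom.uminus[OF rhom_\<theta>] by (simp add: \<theta>_def peval_X[OF rhom_evX])
    moreover have "\<theta> [:monom c n:] = Const c * px ^ n" for c n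
      by (simp add: \<theta>_def peval_const[OF rhom_evX] peval_monom[OF rhom_Const])
    ultimately have "peval \<theta> (shift u py) ?g
        = shift u (py ^ p + (- h1 p M + py * (Const (r / s) * px ^ (p - 1) + py * (Const (1 / s) * px ^ (p - 2)))))"
      by (simp only: rhom.add[OF rhom_peval[OF rhom_\<theta>]] peval_monom[OF rhom_\<theta>] peval_pCons[OF rhom_\<theta>]
          shift.simps shift_Const shift_Var(1) peval_0 rhom.one[OF rhom_\<theta>] mult_1 mult_zero_right add_0_right)
    also have "py ^ p + (- h1 p M + py * (Const (r / s) * px ^ (p - 1) + py * (Const (1 / s) * px ^ (p - 2))))
        = Const (1 / s) * (px * px ^ (p - 2)) * pz"
      unfolding h1_eq delta_def by (simp add: algebra_simps power2_eq_square)
    also have "px * px ^ (p - 2) = (px :: (xyz, 'a) mpoly) ^ (p - 1)"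
      by (rule px_power_pred[symmetric])
    finally show ?thesis by (simp only: shift.simps shift_Const shift_Var(1))
  qed
  have "peval \<theta> py ?G = (\<Prod>u\<in>U. peval \<theta> (shift u py) ?g)"
    unfolding V_def prod.reindex[OF inj] o_def \<psi>.prod peval_pcompose[OF rhom_\<theta>]
    by (simp add: peval_pCons[OF rhom_\<theta>] \<theta>_V rhom.one[OF rhom_\<theta>] rhom.zero[OF rhom_\<theta>] add.commute)
  also have "\<dots> = (Const (1 / s) * px ^ (p - 1)) ^ p ^ 4 * NZ"
    by (simp only: g_eval prod.distrib prod_constant card_U NZ_eq power_mult_distrib cong: prod.cong)
  finally have lhs: "peval \<theta> py ?G = (Const (1 / s) * px ^ (p - 1)) ^ p ^ 4 * NZ" .
  have "peval \<theta> py ?N = NY"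
    unfolding V_def prod.reindex[OF inj] o_def \<psi>.prod NY_eq
    by (simp add: peval_pCons[OF rhom_\<theta>] \<theta>_V rhom.one[OF rhom_\<theta>] rhom.zero[OF rhom_\<theta>] add.commute)
  then have "peval \<theta> py ?G = peval \<theta> NY S"
    unfolding S peval_pcompose[OF rhom_\<theta>] by simp
  also have "\<dots> = (\<Sum>i\<le>p. \<theta> (coeff S i) * NY ^ i)"
    unfolding peval_sum_coeff[OF rhom_\<theta>] dS ..
  also have "\<dots> = NY ^ p + (\<Sum>i<p. \<theta> (coeff S i) * NY ^ i)"
    using lS by (simp add: rhom.one[OF rhom_\<theta>] flip: lessThan_Suc_atMost)
  finally have rel: "peval \<theta> py ?G = NY ^ p + (\<Sum>i<p. \<theta> (coeff S i) * NY ^ i)" .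
  have "\<theta> a \<in> T" for a
    unfolding \<theta>_def using T
    by (intro peval_mem[OF rhom_evX T(1) peval_mem[OF rhom_Const T(1) _ T(2)] T(3)])
       (auto simp: is_subalgebra_def)
  then show ?thesis using that[of "\<lambda>i. \<theta> (coeff S i)"] rel lhs by simp
qed

end

section \<open>Normal forms and lead monomials of invariants\<close>

lemma UNIV_gen: "UNIV = {GX, GH1, GH2, GNZ}"
  using gen.exhaust by blast

lemma finite_UNIV_gen: "finite (UNIV :: gen set)"
  by (simp add: UNIV_gen)

context rank_four
begin

abbreviation gens :: "gen \<Rightarrow> (xyz, 'a) mpoly" where "gens \<equiv> generators p M"

lemma gens_invariant: "gens i \<in> invariant_ring p M"
  by (cases i) (simp_all add: h1_invariant h2_invariant NZ_invariant, simp add: invariant_iff)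

lemma gens_nz: "gens i \<noteq> 0"
  by (cases i) (simp_all add: lead_h1 lead_h2 lead_NZ)

lemma gens_prod_nz: "fam_prod gens K \<noteq> 0"
  using gens_nz by (simp add: fam_prod_def)

lemma lead_gens:
  "lead_exp (gens GX) = Poly_Mapping.single VX 1" "lead_exp (gens GH1) = Poly_Mapping.single VY p"
  "lead_exp (gens GH2) = Poly_Mapping.single VY m0" "lead_exp (gens GNZ) = Poly_Mapping.single VZ (p ^ 4)"
  using lead_h1 lead_h2 lead_NZ by simp_all

lemma lead_gens_prod:
  "Poly_Mapping.lookup (lead_exp (fam_prod gens K)) VX = Poly_Mapping.lookup K GX"
  "Poly_Mapping.lookup (lead_exp (fam_prod gens K)) VY
    = p * Poly_Mapping.lookup K GH1 + m0 * Poly_Mapping.lookup K GH2"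
  "Poly_Mapping.lookup (lead_exp (fam_prod gens K)) VZ = p ^ 4 * Poly_Mapping.lookup K GNZ"
proof -
  have "Poly_Mapping.lookup (lead_exp (fam_prod gens K)) v
      = (\<Sum>i\<in>UNIV. Poly_Mapping.lookup (lead_exp (gens i ^ Poly_Mapping.lookup K i)) v)" for v
    unfolding fam_prod_superset[OF finite_UNIV_gen subset_UNIV]
    using lead_prod[of UNIV "\<lambda>i. gens i ^ Poly_Mapping.lookup K i"] gens_nz finite_UNIV_gen by simp
  then have *: "Poly_Mapping.lookup (lead_exp (fam_prod gens K)) v
      = (\<Sum>i\<in>{GX, GH1, GH2, GNZ}. Poly_Mapping.lookup K i * Poly_Mapping.lookup (lead_exp (gens i)) v)" for v
    using lookup_lead_power[OF gens_nz] by (simp add: UNIV_gen del: generators.simps)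
  show "Poly_Mapping.lookup (lead_exp (fam_prod gens K)) VX = Poly_Mapping.lookup K GX"
    "Poly_Mapping.lookup (lead_exp (fam_prod gens K)) VY
      = p * Poly_Mapping.lookup K GH1 + m0 * Poly_Mapping.lookup K GH2"
    "Poly_Mapping.lookup (lead_exp (fam_prod gens K)) VZ = p ^ 4 * Poly_Mapping.lookup K GNZ"
    unfolding * by (simp_all add: lead_gens lookup_single mult.commute del: generators.simps)
qed

text \<open>The exponents of \<open>x\<close> and \<open>z\<close> determine those of the first and last generator. The exponent of \<open>y\<close> is
twice the exponent of \<open>h2\<close> modulo \<open>p\<close>, which determines the latter below \<open>p\<close>.\<close>

lemma lead_gens_prod_inj:
  "inj_on (\<lambda>K. lead_exp (fam_prod gens K)) {K. Poly_Mapping.lookup K GH2 < p}"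
proof
  fix K L assume KL: "K \<in> {K. Poly_Mapping.lookup K GH2 < p}" "L \<in> {K. Poly_Mapping.lookup K GH2 < p}"
    and eq: "lead_exp (fam_prod gens K) = lead_exp (fam_prod gens L)"
  note e = arg_cong[OF eq, of "\<lambda>m. Poly_Mapping.lookup m v" for v]
  have X: "Poly_Mapping.lookup K GX = Poly_Mapping.lookup L GX"
    using e[of VX] by (simp add: lead_gens_prod)
  have Z: "Poly_Mapping.lookup K GNZ = Poly_Mapping.lookup L GNZ"
    using e[of VZ] p_gt_2 by (simp add: lead_gens_prod)
  have m: "p * a + m0 * c = p * (a + (p\<^sup>2 + p + 1) * c) + 2 * c" for a c
    by (simp add: algebra_simps eval_nat_numeral)
  have Y: "p * Poly_Mapping.lookup K GH1 + m0 * Poly_Mapping.lookup K GH2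
      = p * Poly_Mapping.lookup L GH1 + m0 * Poly_Mapping.lookup L GH2"
    using e[of VY] by (simp only: lead_gens_prod)
  then have "[2 * Poly_Mapping.lookup K GH2 = 2 * Poly_Mapping.lookup L GH2] (mod p)"
    unfolding m cong_def by (metis mod_mult_self4)
  moreover have "coprime 2 p"
    using prime_p p_gt_2 by (metis coprime_commute prime_imp_coprime primes_dvd_imp_eq two_is_prime_nat less_irrefl)
  ultimately have "[Poly_Mapping.lookup K GH2 = Poly_Mapping.lookup L GH2] (mod p)"
    by (simp add: cong_mult_lcancel_nat coprime_commute)
  then have H2: "Poly_Mapping.lookup K GH2 = Poly_Mapping.lookup L GH2"
    using KL by (simp add: cong_less_modulus_unique_nat)
  then have H1: "Poly_Mapping.lookup K GH1 = Poly_Mapping.lookup L GH1"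
    using Y p_gt_2 by simp
  show "K = L"
  proof (rule poly_mapping_eqI)
    show "Poly_Mapping.lookup K i = Poly_Mapping.lookup L i" for i
      using X Z H1 H2 by (cases i) simp_all
  qed
qed

text \<open>The filtration of the subalgebra generated by \<open>gens\<close> by the exponent of \<open>h2\<close>; level \<open>0\<close> is the
subalgebra generated by \<open>x\<close>, \<open>h1\<close> and \<open>NZ\<close>.\<close>

definition h2_le :: "nat \<Rightarrow> (xyz, 'a) mpoly set" where
  "h2_le d = subst gens ` {P. \<forall>K\<in>Poly_Mapping.keys P. Poly_Mapping.lookup K GH2 \<le> d}"

lemma h2_le_I: "(\<And>K. K \<in> Poly_Mapping.keys P \<Longrightarrow> Poly_Mapping.lookup K GH2 \<le> d) \<Longrightarrow> subst gens P \<in> h2_le d"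
  unfolding h2_le_def by blast

lemma h2_le_mono: "f \<in> h2_le d \<Longrightarrow> d \<le> e \<Longrightarrow> f \<in> h2_le e"
  unfolding h2_le_def by (auto intro: le_trans)

lemma h2_le_add: "f \<in> h2_le d \<Longrightarrow> g \<in> h2_le d \<Longrightarrow> f + g \<in> h2_le d"
proof -
  assume "f \<in> h2_le d" "g \<in> h2_le d"
  then obtain P Q where P: "f = subst gens P" "\<forall>K\<in>Poly_Mapping.keys P. Poly_Mapping.lookup K GH2 \<le> d"
    and Q: "g = subst gens Q" "\<forall>K\<in>Poly_Mapping.keys Q. Poly_Mapping.lookup K GH2 \<le> d"
    unfolding h2_le_def by auto
  have "subst gens (P + Q) \<in> h2_le d"
    by (rule h2_le_I) (use P Q keys_add[of P Q] in auto)
  then show ?thesis by (simp add: P Q subst_add)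
qed

lemma h2_le_mult: "f \<in> h2_le d \<Longrightarrow> g \<in> h2_le e \<Longrightarrow> f * g \<in> h2_le (d + e)"
proof -
  assume "f \<in> h2_le d" "g \<in> h2_le e"
  then obtain P Q where P: "f = subst gens P" "\<forall>K\<in>Poly_Mapping.keys P. Poly_Mapping.lookup K GH2 \<le> d"
    and Q: "g = subst gens Q" "\<forall>K\<in>Poly_Mapping.keys Q. Poly_Mapping.lookup K GH2 \<le> e"
    unfolding h2_le_def by auto
  have "subst gens (P * Q) \<in> h2_le (d + e)"
    by (rule h2_le_I) (use P Q keys_mult[of P Q] in \<open>force simp: lookup_add intro: add_mono\<close>)
  then show ?thesis by (simp add: P Q subst.mult)
qed

lemma h2_le_Const: "Const c \<in> h2_le d"
proof -
  have "subst gens (Const c) \<in> h2_le d"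
    by (rule h2_le_I) (auto simp: Const_def split: if_splits)
  then show ?thesis by simp
qed

lemma h2_le_sum: "(\<And>i. i \<in> S \<Longrightarrow> f i \<in> h2_le d) \<Longrightarrow> sum f S \<in> h2_le d"
  using h2_le_Const[of 0 d] by (induction S rule: infinite_finite_induct) (simp_all add: h2_le_add Const.zero)

lemma h2_le_0_subalgebra: "is_subalgebra (h2_le 0)"
  using h2_le_add[of _ 0] h2_le_mult[of _ 0 _ 0] h2_le_Const[of _ 0] by (auto simp: is_subalgebra_def)

lemma h2_le_fam_prod: "Poly_Mapping.lookup K GH2 \<le> d \<Longrightarrow> fam_prod gens K \<in> h2_le d"
  using h2_le_I[of "Poly_Mapping.single K 1" d] by (simp add: subst_single Const.one)

lemma h2_le_gens: "gens i \<in> h2_le (if i = GH2 then 1 else 0)"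
  using h2_le_fam_prod[of "Poly_Mapping.single i 1"] by (simp add: fam_prod_single lookup_single when_def)

lemma h2_le_mult_0: "f \<in> h2_le 0 \<Longrightarrow> g \<in> h2_le d \<Longrightarrow> f * g \<in> h2_le d"
  using h2_le_mult[of f 0 g d] by simp

lemma h2_le_power: "f \<in> h2_le 1 \<Longrightarrow> f ^ n \<in> h2_le n"
proof (induction n)
  case 0
  show ?case using h2_le_Const[of 1 0] by (simp add: Const.one)
next
  case (Suc n)
  then show ?case using h2_le_mult[of f 1 "f ^ n" n] by simp
qed

lemma px_h2_le: "px ^ k \<in> h2_le 0" and h1_h2_le: "h1 p M \<in> h2_le 0" and NZ_h2_le: "NZ \<in> h2_le 0" and h2_mem_h2_le: "h2 p M \<in> h2_le 1"
  using h2_le_gens[of GX] h2_le_gens[of GH1] h2_le_gens[of GNZ] h2_le_gens[of GH2]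
  by (auto intro: subalgebra_power[OF h2_le_0_subalgebra])

lemma NY_h2_le: "NY \<in> h2_le 1"
proof -
  have "NY = Const c0 * px ^ e0 * h2 p M + NY_rest" by (simp add: NY_rest_def)
  moreover have "Const c0 * px ^ e0 * h2 p M \<in> h2_le 1"
    by (intro h2_le_mult_0 h2_mem_h2_le h2_le_Const px_h2_le)
  moreover have "NY_rest \<in> h2_le 1"
    using NY_rest_mem[OF h2_le_0_subalgebra _ h1_h2_le] px_h2_le[of 1] h2_le_mono by force
  ultimately show ?thesis by (simp add: h2_le_add)
qed

text \<open>Raise \<open>NY = c0 x\<^sup>e h2 + \<dots>\<close> to the \<open>p\<close>-th power, which is additive, and replace \<open>NY\<^sup>p\<close> by means of
\<open>NZ_relation\<close>.\<close>

lemma h2_power_p: "px ^ (e0 * p) * h2 p M ^ p \<in> h2_le (p - 1)"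
proof -
  obtain t where t: "\<And>i. t i \<in> h2_le 0"
    and rel: "(Const (1 / s) * px ^ (p - 1)) ^ p ^ 4 * NZ = NY ^ p + (\<Sum>i<p. t i * NY ^ i)"
    using NZ_relation[OF h2_le_0_subalgebra _ h1_h2_le] px_h2_le[of 1] by auto
  have "NY = Const c0 * px ^ e0 * h2 p M + NY_rest" by (simp add: NY_rest_def)
  then have "NY ^ p = (Const c0 * px ^ e0 * h2 p M) ^ p + NY_rest ^ p"
    using frob_mpoly[of "Const c0 * px ^ e0 * h2 p M" NY_rest 1] by simp
  also have "(Const c0 * px ^ e0 * h2 p M) ^ p = Const (c0 ^ p) * (px ^ (e0 * p) * h2 p M ^ p)"
  proof -
    have "(Const a * x ^ e0 * y) ^ p = Const (a ^ p) * (x ^ (e0 * p) * y ^ p)" for a and x y :: "(xyz, 'a) mpoly"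
      by (simp only: power_mult_distrib Const.power power_mult mult.assoc)
    then show ?thesis .
  qed
  finally have "Const (c0 ^ p) * (px ^ (e0 * p) * h2 p M ^ p)
      = (Const (1 / s) * px ^ (p - 1)) ^ p ^ 4 * NZ + Const (- 1) * (\<Sum>i<p. t i * NY ^ i) + Const (- 1) * NY_rest ^ p"
    unfolding rel by (simp add: Const.simps)
  also have "\<dots> \<in> h2_le (p - 1)"
  proof (intro h2_le_add h2_le_mult_0 h2_le_sum h2_le_Const)
    have "NY_rest \<in> h2_le 0" using NY_rest_mem[OF h2_le_0_subalgebra _ h1_h2_le] px_h2_le[of 1] by simp
    then show "NY_rest ^ p \<in> h2_le (p - 1)"
      using subalgebra_power[OF h2_le_0_subalgebra] h2_le_mono by blast
    show "(Const (1 / s) * px ^ (p - 1)) ^ p ^ 4 \<in> h2_le 0"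
      by (intro subalgebra_power[OF h2_le_0_subalgebra] h2_le_mult_0 h2_le_Const px_h2_le)
    show "NZ \<in> h2_le (p - 1)" using NZ_h2_le h2_le_mono by blast
    show "t i \<in> h2_le 0" for i by (rule t)
    show "NY ^ i \<in> h2_le (p - 1)" if "i \<in> {..<p}" for i
      using h2_le_mono[OF h2_le_power[OF NY_h2_le]] that by simp
  qed
  finally have "Const (1 / c0 ^ p) * (Const (c0 ^ p) * (px ^ (e0 * p) * h2 p M ^ p)) \<in> h2_le (p - 1)"
    by (rule h2_le_mult_0[OF h2_le_Const])
  moreover have "Const (1 / c0 ^ p) * (Const (c0 ^ p) * f) = f" for f :: "(xyz, 'a) mpoly"
    unfolding mult.assoc[symmetric] Const.mult[symmetric] using c0_nz by (simp add: Const.one)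
  ultimately show ?thesis by (simp only:)
qed

text \<open>As long as \<open>h2\<close> occurs with exponent at least \<open>p\<close>, trade \<open>p\<close> factors by means of \<open>h2_power_p\<close>; this
lowers the exponent at the price of a power of \<open>x\<close>.\<close>

lemma h2_le_localised: "g \<in> h2_le d \<Longrightarrow> \<exists>k. px ^ k * g \<in> h2_le (p - 1)"
proof (induction d arbitrary: g rule: less_induct)
  case (less d)
  show ?case
  proof (cases "d \<le> p - 1")
    case True
    then show ?thesis using h2_le_mono[OF less.prems] by (intro exI[of _ 0]) simp
  next
    case False
    then have d: "p \<le> d" "d - 1 < d" using p_gt_2 by simp_all
    obtain P where P: "g = subst gens P" "\<And>K. K \<in> Poly_Mapping.keys P \<Longrightarrow> Poly_Mapping.lookup K GH2 \<le> d"
      using less.prems unfolding h2_le_def by auto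
    have step: "px ^ (e0 * p) * fam_prod gens K \<in> h2_le (d - 1)" if K: "K \<in> Poly_Mapping.keys P" for K
    proof (cases "Poly_Mapping.lookup K GH2 \<le> d - 1")
      case True
      then show ?thesis by (intro h2_le_mult_0 px_h2_le h2_le_fam_prod)
    next
      case False
      define K' where "K' = K - Poly_Mapping.single GH2 p"
      have KH: "Poly_Mapping.lookup K GH2 = d" using False P(2)[OF K] d by simp
      have K': "K = K' + Poly_Mapping.single GH2 p"
        using KH d(1) by (intro poly_mapping_eqI)
          (auto simp: K'_def lookup_add lookup_minus lookup_single when_def)
      have "Poly_Mapping.lookup K' GH2 = d - p" by (simp add: K'_def lookup_minus KH)
      then have "fam_prod gens K' * (px ^ (e0 * p) * h2 p M ^ p) \<in> h2_le (d - p + (p - 1))"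
        by (intro h2_le_mult h2_le_fam_prod h2_power_p) simp
      moreover have "d - p + (p - 1) = d - 1" using d(1) p_gt_2 by simp
      moreover have "px ^ (e0 * p) * fam_prod gens K = fam_prod gens K' * (px ^ (e0 * p) * h2 p M ^ p)"
        unfolding K' fam_prod_add fam_prod_single by (simp add: mult_ac)
      ultimately show ?thesis by (simp only:)
    qed
    have "px ^ (e0 * p) * g = (\<Sum>K\<in>Poly_Mapping.keys P. Const (Poly_Mapping.lookup P K) * (px ^ (e0 * p) * fam_prod gens K))"
      unfolding P(1) subst_def sum_distrib_left by (simp add: mult_ac)
    also have "\<dots> \<in> h2_le (d - 1)" by (intro h2_le_sum h2_le_mult_0 h2_le_Const step)
    finally obtain k where "px ^ k * (px ^ (e0 * p) * g) \<in> h2_le (p - 1)"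
      using less.IH[OF d(2)] by blast
    then have "px ^ (k + e0 * p) * g \<in> h2_le (p - 1)" by (simp add: power_add mult.assoc)
    then show ?thesis ..
  qed
qed

text \<open>The heart of the proof. A power of \<open>x\<close> times \<open>f\<close> is a combination of products with distinct lead
monomials, so its lead monomial is that of one product; that product contains at least the same power
of \<open>x\<close>, which is then removed on both sides.\<close>

lemma invariant_lead:
  assumes f: "f \<in> invariant_ring p M" "f \<noteq> 0"
  shows "\<exists>K. lead_exp f = lead_exp (fam_prod gens K)"
proof -
  let ?T = "range (subst gens)"
  have T: "is_subalgebra ?T" by (rule subalgebra_range_subst)
  have b: "gens i \<in> ?T" for i using subst_Var[of gens i] by (metis rangeI)
  have px: "px \<in> ?T" and h1: "h1 p M \<in> ?T" and h2: "h2 p M \<in> ?T"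
    using b[of GX] b[of GH1] b[of GH2] by simp_all
  have "NY = Const c0 * px ^ e0 * h2 p M + NY_rest" by (simp add: NY_rest_def)
  moreover have "Const c0 * px ^ e0 * h2 p M \<in> ?T"
    using subalgebra_Const_mult[OF T subalgebra_power[OF T px], of c0 e0] h2 T unfolding is_subalgebra_def by blast
  ultimately have "NY \<in> ?T"
    using NY_rest_mem[OF T px h1] T unfolding is_subalgebra_def by metis
  then obtain k P where P: "px ^ k * f = subst gens P"
    using localised_generation[OF f(1) T px _ h1] by blast
  have "subst gens P \<in> h2_le (\<Sum>K\<in>Poly_Mapping.keys P. Poly_Mapping.lookup K GH2)"
    by (intro h2_le_I member_le_sum) simp_all
  then obtain l where "px ^ l * (px ^ k * f) \<in> h2_le (p - 1)"
    unfolding P using h2_le_localised by blast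
  then have "px ^ (l + k) * f \<in> h2_le (p - 1)" by (simp add: power_add mult.assoc)
  then obtain Q where Q: "px ^ (l + k) * f = subst gens Q"
      "\<And>K. K \<in> Poly_Mapping.keys Q \<Longrightarrow> Poly_Mapping.lookup K GH2 \<le> p - 1"
    unfolding h2_le_def by auto
  have "Q \<noteq> 0"
  proof
    assume "Q = 0"
    then have "px ^ (l + k) * f = 0" using Q(1) by (simp add: subst.zero)
    then show False using f(2) by simp
  qed
  moreover have "inj_on (\<lambda>K. lead_exp (fam_prod gens K)) (Poly_Mapping.keys Q)"
    using Q(2) p_gt_2 by (intro inj_on_subset[OF lead_gens_prod_inj]) force
  ultimately obtain K where K: "lead_exp (px ^ (l + k) * f) = lead_exp (fam_prod gens K)"
    using distinct_leads(2)[OF gens_prod_nz] unfolding Q(1) by blast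
  have px_lead: "lead_exp (px ^ n :: (xyz, 'a) mpoly) = Poly_Mapping.single VX n" for n
    unfolding Var_power by (rule lead_single) simp
  have f_lead: "lead_exp (px ^ (l + k) * f) = Poly_Mapping.single VX (l + k) + lead_exp f"
    using lead_mult(2)[of "px ^ (l + k)" f] f(2) px_lead by simp
  \<comment> \<open>the exponent of \<open>x\<close> in the lead monomial equals that of the generator \<open>x\<close> in the product\<close>
  define K' where "K' = K - Poly_Mapping.single GX (l + k)"
  have "l + k \<le> Poly_Mapping.lookup K GX"
    using arg_cong[OF f_lead, of "\<lambda>m. Poly_Mapping.lookup m VX"] unfolding K
    by (simp add: lead_gens_prod lookup_add)
  then have "K = Poly_Mapping.single GX (l + k) + K'"
    by (intro poly_mapping_eqI) (auto simp: K'_def lookup_add lookup_minus lookup_single when_def)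
  then have "fam_prod gens K = px ^ (l + k) * fam_prod gens K'"
    by (simp add: fam_prod_add fam_prod_single)
  then have "lead_exp (fam_prod gens K) = Poly_Mapping.single VX (l + k) + lead_exp (fam_prod gens K')"
    using lead_mult(2)[of "px ^ (l + k)" "fam_prod gens K'"] gens_prod_nz px_lead by simp
  then have "lead_exp f = lead_exp (fam_prod gens K')"
    using f_lead K by (metis add_left_cancel)
  then show ?thesis ..
qed

lemmas gens_facts = invariants_subalgebra gens_invariant gens_nz invariant_lead

lemma range_gens: "range gens = {px, h1 p M, h2 p M, NZ}"
  by (simp add: UNIV_gen)

lemma tete_a_tete_leads:
  "lead_exp (fam_prod gens (Poly_Mapping.single GH2 p)) = lead_exp (fam_prod gens (Poly_Mapping.single GH1 m0))"
proof (rule poly_mapping_eqI)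
  fix v show "Poly_Mapping.lookup (lead_exp (fam_prod gens (Poly_Mapping.single GH2 p))) v
    = Poly_Mapping.lookup (lead_exp (fam_prod gens (Poly_Mapping.single GH1 m0))) v"
    by (cases v) (simp_all only: lead_gens_prod lookup_single, simp_all add: mult.commute)
qed

end

theorem theorem7p3:
  fixes M :: "'a::field^4^2" and p :: nat
  assumes "prime p" and "p > 2" and "CHAR('a) = p"
    and "gamma p M 1 2 3 4 = 0"
    and "gamma p M 1 2 3 5 = 0"
    and "gamma p M 1 3 5 7 \<noteq> 0"
    and "gamma p M 1 2 5 7 \<noteq> 0"
  shows "is_sagbi_basis {px, h1 p M, h2 p M, orbit_prod p M pz} (invariant_ring p M) \<and>
    (let b = generators p M;
         I = Poly_Mapping.single GH2 p;
         J = Poly_Mapping.single GH1 (p^3 + p^2 + p + 2)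
     in is_tete_a_tete b I J \<and>
        (\<exists>R. subduction_relation b I J R) \<and>
        (\<forall>R. subduction_relation b I J R \<longrightarrow>
             is_hypersurface_with (invariant_ring p M) b R))"
proof -
  obtain r s where rs: "s \<noteq> 0" "\<And>j. M$2$j = r * M$1$j + s * (M$1$j) ^ p"
    "gamma p M 1 3 5 7 / gamma p M 1 2 5 7 = 1 / s"
    "gamma p M 2 3 5 7 / gamma p M 1 2 5 7 = r / s"
    using second_row_of_minors[OF assms(1,3-7)] by metis
  interpret rank_four p M r s
    using assms rs by unfold_locales
  have fin: "finite (range gens)" by (simp add: range_gens)
  have sagbi: "is_sagbi_basis {px, h1 p M, h2 p M, orbit_prod p M pz} (invariant_ring p M)"
    using sagbi_basis[OF gens_facts fin] unfolding range_gens .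
  note tat = tete_a_tete_subduction[OF gens_facts tete_a_tete_leads]
  have "is_hypersurface_with (invariant_ring p M) gens R"
    if "subduction_relation gens (Poly_Mapping.single GH2 p) (Poly_Mapping.single GH1 m0) R" for R
    by (rule relation_ideal_principal[OF gens_facts that _ _ lead_gens_prod_inj])
       (use p_gt_2 in \<open>simp_all add: lookup_single\<close>)
  then show ?thesis using sagbi tat by (simp add: Let_def)
qed

end
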